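(* Let $f:\mathbb{N}\to\mathbb{R}$ be a non-decreasing function with $f(n)>28$ for all $n$, and let $p=p(n)=f(n)\log n/n$. Let $G(n,p)$ be the Erdős–Rényi random graph. Then: (i) asymptotically almost surely, $\mathrm{RC}(G(n,p))\le n^{2+o(1)}$; (ii) for any initial weighting $w_0$ fixed independently of the edges of $G(n,p)$, $$\frac{\mathcal{RC}(G(n,p),w_0)}{n+\frac{n}{f(n)}}\xrightarrow{\ p\ }1\quad\text{as }n\to\infty.$$
   Context: Robot crawler model: let $G=(V,E)$ be a finite connected simple graph with $|V|=n$. An initial weighting is a bijection $w_0:V\to\{-n,-n+1,\dots,-1\}$. At time $1$ the crawler visits $w_0^{-1}(-n)$. If the crawler visits vertex $v$ at time $t$, then $w_t(v)=t$ and $w_t(u)=w_{t-1}(u)$ for all $u\neq v$. If $\min_{y\in V}w_t(y)>0$, the process stops and $\mathcal{RC}(G,w_0):=t$. Otherwise, at time $t+1$ the crawler moves to the neighbour $u$ of $v$ minimising $w_t(u)$. $\mathrm{RC}(G)=\max_{w_0}\mathcal{RC}(G,w_0)$ over all $n!$ initial weightings. $G(n,p)$ has vertex set of size $n$, each of the $\binom n2$ possible edges present independently with probability $p$ (in this regime it is connected a.a.s.). "Asymptotically almost surely" means with probability tending to $1$ as $n\to\infty$; $\xrightarrow{p}$ denotes convergence in probability. *)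

theory Defs
  imports "HOL-Probability.Probability"
begin

text \<open>Graphs on vertex set {0..<n}; a graph is its set of edges, each edge a
  2-element set {i,j} with i < j < n.\<close>

definition all_pairs :: "nat \<Rightarrow> nat set set" where
  "all_pairs n = {e. \<exists>i j. i < j \<and> j < n \<and> e = {i, j}}"

text \<open>Erdos-Renyi random graph G(n,p): every possible edge independently with
  probability p (bernoulli_pmf clamps p to [0,1]).\<close>

definition gnp :: "nat \<Rightarrow> real \<Rightarrow> nat set set pmf" where
  "gnp n p = map_pmf (\<lambda>b. {e \<in> all_pairs n. b e})
                     (Pi_pmf (all_pairs n) False (\<lambda>_. bernoulli_pmf p))"

definition neighbours :: "nat set set \<Rightarrow> nat \<Rightarrow> nat \<Rightarrow> nat set" where
  "neighbours G n v = {u \<in> {0..<n}. {v, u} \<in> G}"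

text \<open>Neighbour of v with minimal current weight (unique, since weights stay distinct).\<close>

definition next_vertex :: "nat set set \<Rightarrow> nat \<Rightarrow> (nat \<Rightarrow> int) \<Rightarrow> nat \<Rightarrow> nat" where
  "next_vertex G n w v =
     (SOME u. u \<in> neighbours G n v \<and> (\<forall>u' \<in> neighbours G n v. w u \<le> w u'))"

text \<open>rc_state G n w0 k = (w_t, v_t) with t = k + 1: the weighting after time t and
  the vertex visited at time t.\<close>

fun rc_state :: "nat set set \<Rightarrow> nat \<Rightarrow> (nat \<Rightarrow> int) \<Rightarrow> nat \<Rightarrow> (nat \<Rightarrow> int) \<times> nat" where
  "rc_state G n w0 0 =
     (let v = inv_into {0..<n} w0 (- int n) in (w0(v := 1), v))"
| "rc_state G n w0 (Suc k) =
     (let (w, v) = rc_state G n w0 k; u = next_vertex G n w v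
      in (w(u := int (k + 2)), u))"

text \<open>Stopping time RC(G,w0): the first time t at which all weights are positive
  (0 if this never happens, which cannot occur for connected graphs).\<close>

definition rc :: "nat set set \<Rightarrow> nat \<Rightarrow> (nat \<Rightarrow> int) \<Rightarrow> nat" where
  "rc G n w0 =
     (if \<exists>k. \<forall>y \<in> {0..<n}. fst (rc_state G n w0 k) y > 0
      then Suc (LEAST k. \<forall>y \<in> {0..<n}. fst (rc_state G n w0 k) y > 0)
      else 0)"

text \<open>Initial weightings: bijections {0..<n} -> {-n..-1}, normalised to 0 outside
  the vertex set (the process only uses values on the vertex set).\<close>

definition weightings :: "nat \<Rightarrow> (nat \<Rightarrow> int) set" where
  "weightings n = {w. bij_betw w {0..<n} {- int n .. -1} \<and> (\<forall>x. x \<notin> {0..<n} \<longrightarrow> w x = 0)}"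

definition RC :: "nat set set \<Rightarrow> nat \<Rightarrow> nat" where
  "RC G n = Max ((\<lambda>w. rc G n w) ` weightings n)"

end

theory Submission
  imports Defs "HOL-Real_Asymp.Real_Asymp"
begin

text \<open>
  (i) Fix a vertex \<open>u\<close> that has not been visited yet. Since the crawler always moves to the least
  recently visited neighbour, a vertex of degree at most \<open>D\<close> is visited at most \<open>D\<close> times
  between two visits of any given neighbour, so vertices at distance \<open>i\<close> from \<open>u\<close> are visited
  at most \<open>(2D)^i\<close> times. With high probability balls around \<open>u\<close> grow by a factor that is \<open>D\<close> up
  to logarithms of the mean degree, until they have nearly \<open>n/D\<close> vertices. A set of that size cannot
  be missed for \<open>n^(1+o(1))\<close> consecutive steps, so at least half of the ball is visited in each window
  of that length, which limits the number of windows to \<open>n^(1+o(1))\<close>.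

  (ii) The adaptivity of the crawl is removed by deleting a vertex \<open>u\<close>: up to the time at which it
  is visited, the crawl agrees with the crawl on \<open>G - u\<close>, which is independent of the edges at \<open>u\<close>.
  Until time \<open>n/2\<close> no vertex is visited twice, and afterwards every revisit goes to a vertex that has only
  been visited before time \<open>n/2\<close>. Hence revisits start from distinct vertices, and an unvisited
  \<open>u\<close> is adjacent to none of these; after \<open>(1+\<epsilon>)n/f\<close> revisits this has probability at most
  \<open>n^(-1-\<epsilon>)\<close>. Conversely, by the second moment method, among the last few vertices in the initial order
  one is adjacent to none of the first \<open>(1-\<epsilon>)n/f\<close> vertices whose remaining unvisited neighbours
  are all among those last vertices.
\<close>

section \<open>The crawler process\<close>

text \<open>In (i) the visit bound grows with the radius by the factor
  \<open>2 * D = \<beta> * \<gamma>\<close>, the balls only by \<gamma>. The powers of \<gamma>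
  cancel against the sizes of balls and of their complements; what survives is \<beta>^I, with
  \<beta> of order ln x for the mean degree x = np, and I of order at most ln n / ln x. Hence
  \<beta>^I is n^(O(ln ln x / ln x)), which is n^(o(1)) because x tends to infinity. In (ii) the
  history of a crawl reveals edges at every vertex it has touched, so no step is independent of the
  past. Every bad event is therefore stated for one fixed vertex y and a set computed from G - y,
  and a union bound runs over y, the index and the possible detours through y. This costs about n^4
  against exp(-x/4), which is of order at most n^(-7) because x is eventually at least 28 ln n; the
  same 28 keeps the number of revisits near n/14 at most. The sharp constant comes from the last
  event alone, which needs no detour and costs only a factor n: n(1-p)^M becomes small once M
  exceeds n/f by a constant factor.\<close>

definition del_vertex :: "nat set set \<Rightarrow> nat \<Rightarrow> nat set set" where
  "del_vertex G y = {e \<in> G. y \<notin> e}"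

text \<open>Without neighbours, \<open>next_vertex\<close> would be an arbitrary number. Standing
  still instead keeps the crawl inside the vertex set on every graph, in particular on
  \<open>del_vertex G y\<close>, where isolated vertices are unavoidable.\<close>

definition step_vertex :: "nat set set \<Rightarrow> nat \<Rightarrow> (nat \<Rightarrow> int) \<Rightarrow> nat \<Rightarrow> nat" where
  "step_vertex G n w v = (if neighbours G n v = {} then v else next_vertex G n w v)"

text \<open>The map \<open>ov\<close> prescribes positions at chosen positive indices; the start is
  never overridden. Index \<open>k\<close> stands for time \<open>k + 1\<close>, which explains the
  weight \<open>k + 2\<close> written at index \<open>Suc k\<close>.\<close>

fun run :: "nat set set \<Rightarrow> nat \<Rightarrow> (nat \<Rightarrow> int) \<Rightarrow> (nat \<Rightarrow> nat option) \<Rightarrow> nat \<Rightarrow> (nat \<Rightarrow> int) \<times> nat" where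
  "run G n w0 ov 0 = (let v = inv_into {0..<n} w0 (- int n) in (w0(v := 1), v))"
| "run G n w0 ov (Suc k) =
     (let (w, v) = run G n w0 ov k;
          u = (case ov (Suc k) of Some z \<Rightarrow> z | None \<Rightarrow> step_vertex G n w v)
      in (w(u := int (k + 2)), u))"

definition pos :: "nat set set \<Rightarrow> nat \<Rightarrow> (nat \<Rightarrow> int) \<Rightarrow> (nat \<Rightarrow> nat option) \<Rightarrow> nat \<Rightarrow> nat" where
  "pos G n w0 ov k = snd (run G n w0 ov k)"

definition wt :: "nat set set \<Rightarrow> nat \<Rightarrow> (nat \<Rightarrow> int) \<Rightarrow> (nat \<Rightarrow> nat option) \<Rightarrow> nat \<Rightarrow> nat \<Rightarrow> int" where
  "wt G n w0 ov k = fst (run G n w0 ov k)"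

abbreviation crawl_pos where "crawl_pos G n w0 \<equiv> pos G n w0 Map.empty"
abbreviation crawl_wt where "crawl_wt G n w0 \<equiv> wt G n w0 Map.empty"

lemma pos_0: "pos G n w0 ov 0 = inv_into {0..<n} w0 (- int n)"
  by (simp add: pos_def Let_def)

lemma wt_0: "wt G n w0 ov 0 = w0(pos G n w0 ov 0 := 1)"
  by (simp add: pos_def wt_def Let_def)

lemma pos_Suc: "pos G n w0 ov (Suc k) =
    (case ov (Suc k) of Some z \<Rightarrow> z
     | None \<Rightarrow> step_vertex G n (wt G n w0 ov k) (pos G n w0 ov k))"
  by (simp add: pos_def wt_def Let_def case_prod_beta split: option.splits)

lemma wt_Suc: "wt G n w0 ov (Suc k) = (wt G n w0 ov k)(pos G n w0 ov (Suc k) := int (k + 2))"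
  by (simp add: pos_def wt_def Let_def split: prod.splits)

lemma wt_unvisited: "y \<notin> pos G n w0 ov ` {..k} \<Longrightarrow> wt G n w0 ov k y = w0 y"
  by (induction k) (auto simp: wt_0 wt_Suc atMost_Suc)

lemma wt_visited_ge: "j \<le> k \<Longrightarrow> int j + 1 \<le> wt G n w0 ov k (pos G n w0 ov j)"
  by (induction k) (auto simp: wt_0 wt_Suc le_Suc_eq)

text \<open>A positive weight records the last visit: \<open>int j + 1\<close> is the time that
  belongs to index \<open>j\<close>.\<close>

lemma wt_visited:
  "y \<in> pos G n w0 ov ` {..k} \<Longrightarrow>
    \<exists>j\<le>k. pos G n w0 ov j = y \<and> wt G n w0 ov k y = int j + 1 \<and> (\<forall>i. j < i \<and> i \<le> k \<longrightarrow> pos G n w0 ov i \<noteq> y)"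
proof (induction k)
  case 0 then show ?case by (auto simp: wt_0)
next
  case (Suc k)
  show ?case
  proof (cases "pos G n w0 ov (Suc k) = y")
    case True then show ?thesis by (intro exI[of _ "Suc k"]) (auto simp: wt_Suc)
  next
    case False
    with Suc.prems have "y \<in> pos G n w0 ov ` {..k}" by (auto simp: atMost_Suc)
    from Suc.IH[OF this] obtain j where "j \<le> k" "pos G n w0 ov j = y" "wt G n w0 ov k y = int j + 1"
      "\<forall>i. j < i \<and> i \<le> k \<longrightarrow> pos G n w0 ov i \<noteq> y" by blast
    then show ?thesis using False by (intro exI[of _ j]) (auto simp: wt_Suc le_Suc_eq)
  qed
qed

abbreviation (input) weighting :: "nat \<Rightarrow> (nat \<Rightarrow> int) \<Rightarrow> bool" where
  "weighting n w0 \<equiv> bij_betw w0 {0..<n} {- int n .. -1}"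

lemma weighting_neg: "weighting n w0 \<Longrightarrow> y < n \<Longrightarrow> w0 y < 0"
  by (force dest: bij_betwE)

lemma wt_pos_iff:
  assumes "weighting n w0" "y < n"
  shows "0 < wt G n w0 ov k y \<longleftrightarrow> y \<in> pos G n w0 ov ` {..k}"
  using wt_unvisited[of y G n w0 ov k] wt_visited_ge[of _ k G n w0 ov] weighting_neg[OF assms]
  by fastforce

text \<open>Visited vertices carry distinct times of last visits, unvisited ones their distinct
  negative initial weights. Hence the minimising neighbour is unique and the choice in
  \<open>next_vertex\<close> is canonical.\<close>

lemma wt_inj:
  assumes "weighting n w0"
  shows "inj_on (wt G n w0 ov k) {0..<n}"
proof (rule inj_onI)
  fix x y assume x: "x \<in> {0..<n}" and y: "y \<in> {0..<n}" and e: "wt G n w0 ov k x = wt G n w0 ov k y"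
  show "x = y"
  proof (cases "x \<in> pos G n w0 ov ` {..k}")
    case True
    then have "y \<in> pos G n w0 ov ` {..k}"
      using wt_pos_iff[OF assms, of x G ov k] wt_pos_iff[OF assms, of y G ov k] x y e by auto
    from wt_visited[OF this] wt_visited[OF True] e show ?thesis by auto
  next
    case False
    then have "y \<notin> pos G n w0 ov ` {..k}"
      using wt_pos_iff[OF assms, of x G ov k] wt_pos_iff[OF assms, of y G ov k] x y e by auto
    then have "w0 x = w0 y" using False e by (simp add: wt_unvisited)
    then show ?thesis using assms x y by (auto simp: bij_betw_def inj_on_def)
  qed
qed

lemma finite_neighbours [simp]: "finite (neighbours G n v)"
  by (simp add: neighbours_def)

lemma next_vertex_is_arg_min:
  assumes "neighbours G n v \<noteq> {}"
  shows "next_vertex G n w v \<in> neighbours G n v \<and> (\<forall>x \<in> neighbours G n v. w (next_vertex G n w v) \<le> w x)"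
proof -
  have "\<exists>u. u \<in> neighbours G n v \<and> (\<forall>u' \<in> neighbours G n v. w u \<le> w u')"
    using ex_min_if_finite[of "w ` neighbours G n v"] assms
    by (metis arg_min_if_finite(1) arg_min_if_finite(2) finite_neighbours not_less)
  from someI_ex[OF this] show ?thesis unfolding next_vertex_def .
qed

lemma next_vertex_eqI:
  assumes "inj_on w {0..<n}" "u \<in> neighbours G n v" "\<And>x. x \<in> neighbours G n v \<Longrightarrow> w u \<le> w x"
  shows "next_vertex G n w v = u"
proof -
  have ne: "neighbours G n v \<noteq> {}" using assms(2) by auto
  from next_vertex_is_arg_min[OF ne, of w] assms(2,3)
  have "w (next_vertex G n w v) = w u" "next_vertex G n w v \<in> neighbours G n v" by force+
  then show ?thesis using assms(1,2) by (auto simp: inj_on_def neighbours_def)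
qed

section \<open>Comparing the crawls on G and on G minus a vertex\<close>

lemma neighbours_del_vertex:
  "v \<noteq> y \<Longrightarrow> neighbours (del_vertex G y) n v = neighbours G n v - {y}"
  by (auto simp: neighbours_def del_vertex_def)

text \<open>A minimiser stays the minimiser over any smaller set that contains it, and injectivity
  excludes ties. So the deletion of \<open>y\<close> is invisible at \<open>v\<close> unless the
  move goes into \<open>y\<close>.\<close>

lemma step_vertex_del_vertex:
  assumes "inj_on w {0..<n}" "v \<noteq> y" "step_vertex G n w v \<noteq> y"
  shows "step_vertex (del_vertex G y) n w v = step_vertex G n w v"
proof (cases "neighbours G n v = {}")
  case True then show ?thesis using assms by (simp add: step_vertex_def neighbours_del_vertex)
next
  case False
  let ?u = "next_vertex G n w v"
  have u: "?u \<in> neighbours G n v" "\<And>x. x \<in> neighbours G n v \<Longrightarrow> w ?u \<le> w x" "?u \<noteq> y"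
    using next_vertex_is_arg_min[OF False, of w] assms(3) False by (auto simp: step_vertex_def)
  have "next_vertex (del_vertex G y) n w v = ?u"
    using assms u by (intro next_vertex_eqI) (auto simp: neighbours_del_vertex)
  then show ?thesis using False u assms by (auto simp: step_vertex_def neighbours_del_vertex)
qed

lemma step_vertex_in:
  "v < n \<Longrightarrow> step_vertex G n w v < n"
  using next_vertex_is_arg_min[of G n v w] by (auto simp: step_vertex_def neighbours_def)

lemma pos_0_in:
  assumes "weighting n w0" "0 < n" shows "pos G n w0 ov 0 < n" "w0 (pos G n w0 ov 0) = - int n"
proof -
  have "- int n \<in> w0 ` {0..<n}" using assms by (auto simp: bij_betw_def)
  from inv_into_into[OF this] f_inv_into_f[OF this] show "pos G n w0 ov 0 < n" "w0 (pos G n w0 ov 0) = - int n"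
    by (auto simp: pos_0)
qed

lemma crawl_pos_in:
  assumes "weighting n w0" "0 < n" shows "crawl_pos G n w0 k < n"
  by (induction k) (use assms in \<open>auto simp: pos_0_in pos_Suc step_vertex_in\<close>)

lemma crawl_step:
  assumes "neighbours G n (crawl_pos G n w0 k) \<noteq> {}"
  shows "crawl_pos G n w0 (Suc k) \<in> neighbours G n (crawl_pos G n w0 k)"
    and "x \<in> neighbours G n (crawl_pos G n w0 k) \<Longrightarrow>
      crawl_wt G n w0 k (crawl_pos G n w0 (Suc k)) \<le> crawl_wt G n w0 k x"
  using next_vertex_is_arg_min[OF assms] assms by (auto simp: pos_Suc step_vertex_def)

lemma crawl_step_adj:
  assumes "crawl_pos G n w0 (Suc k) \<noteq> crawl_pos G n w0 k"
  shows "crawl_pos G n w0 (Suc k) \<in> neighbours G n (crawl_pos G n w0 k)"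
  using crawl_step(1) assms by (fastforce simp: pos_Suc step_vertex_def)

lemma run_eqI:
  assumes "\<And>j. j < k \<Longrightarrow> ov (Suc j) = Some (crawl_pos G n w0 (Suc j)) \<or>
     ov (Suc j) = None \<and> step_vertex G' n (crawl_wt G n w0 j) (crawl_pos G n w0 j) = crawl_pos G n w0 (Suc j)"
  shows "run G' n w0 ov k = run G n w0 Map.empty k"
  using assms
proof (induction k)
  case 0 then show ?case by simp
next
  case (Suc k)
  have IH: "run G' n w0 ov k = run G n w0 Map.empty k" using Suc by simp
  have p: "pos G' n w0 ov (Suc k) = crawl_pos G n w0 (Suc k)"
    using Suc.prems[of k] IH by (auto simp: pos_Suc[of G'] wt_def pos_def[of _ _ _ _ k])
  show ?case
  proof (rule prod_eqI)
    show "snd (run G' n w0 ov (Suc k)) = snd (run G n w0 Map.empty (Suc k))"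
      using p by (simp only: pos_def)
    show "fst (run G' n w0 ov (Suc k)) = fst (run G n w0 Map.empty (Suc k))"
      using p IH wt_Suc[of G'] wt_Suc[of G] by (simp only: wt_def)
  qed
qed

text \<open>Edges at \<open>y\<close> influence the crawl only through moves into \<open>y\<close>
  and out of \<open>y\<close>. The second and third hypotheses force precisely these moves; the last
  one says that whatever is forced is what the crawl on \<open>G\<close> does anyway.\<close>

lemma run_del_vertex:
  assumes "weighting n w0"
    and "\<And>j. j \<le> k \<Longrightarrow> crawl_pos G n w0 j = y \<Longrightarrow> 0 < j \<Longrightarrow> ov j = Some y"
    and "\<And>j. j < k \<Longrightarrow> crawl_pos G n w0 j = y \<Longrightarrow> ov (Suc j) = Some (crawl_pos G n w0 (Suc j))"
    and "\<And>j. j \<le> k \<Longrightarrow> ov j = None \<or> ov j = Some (crawl_pos G n w0 j)"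
  shows "run (del_vertex G y) n w0 ov k = run G n w0 Map.empty k"
proof (rule run_eqI)
  fix j assume "j < k"
  then show "ov (Suc j) = Some (crawl_pos G n w0 (Suc j)) \<or>
     ov (Suc j) = None \<and> step_vertex (del_vertex G y) n (crawl_wt G n w0 j) (crawl_pos G n w0 j) = crawl_pos G n w0 (Suc j)"
    using assms(2)[of "Suc j"] assms(3)[of j] assms(4)[of "Suc j"]
      step_vertex_del_vertex[OF wt_inj[OF assms(1)], of "crawl_pos G n w0 j" y G G Map.empty j]
    by (auto simp: pos_Suc[of G])
qed

lemma rc_state_eq_run:
  assumes "weighting n w0" "0 < n" "\<And>v. v < n \<Longrightarrow> neighbours G n v \<noteq> {}"
  shows "rc_state G n w0 k = run G n w0 Map.empty k"
proof (induction k)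
  case (Suc k)
  have "snd (run G n w0 Map.empty k) < n" using crawl_pos_in[OF assms(1,2)] by (simp add: pos_def)
  then show ?case using Suc assms(3) by (auto simp: Let_def step_vertex_def split: prod.splits)
qed simp

lemma rc_eq:
  assumes "weighting n w0" "0 < n" "\<And>v. v < n \<Longrightarrow> neighbours G n v \<noteq> {}"
  shows "rc G n w0 = (if \<exists>k. {0..<n} \<subseteq> crawl_pos G n w0 ` {..k}
     then Suc (LEAST k. {0..<n} \<subseteq> crawl_pos G n w0 ` {..k}) else 0)"
proof -
  have "(\<forall>y\<in>{0..<n}. fst (rc_state G n w0 k) y > 0) \<longleftrightarrow> {0..<n} \<subseteq> crawl_pos G n w0 ` {..k}" for k
  proof -
    have "fst (rc_state G n w0 k) = crawl_wt G n w0 k"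
      using rc_state_eq_run[OF assms, of k] by (simp add: wt_def)
    then show ?thesis using wt_pos_iff[OF assms(1)] by fastforce
  qed
  then show ?thesis unfolding rc_def by presburger
qed

section \<open>Random subsets\<close>

definition rsub :: "'a set \<Rightarrow> real \<Rightarrow> 'a set pmf" where
  "rsub F p = map_pmf (\<lambda>b. {e \<in> F. b e}) (Pi_pmf F False (\<lambda>_. bernoulli_pmf p))"

lemma set_rsub: "set_pmf (rsub F p) \<subseteq> Pow F"
  by (auto simp: rsub_def)

lemma rsub_union:
  assumes "finite A" "finite B" "A \<inter> B = {}"
  shows "rsub (A \<union> B) p = bind_pmf (rsub A p) (\<lambda>H. map_pmf (\<lambda>K. H \<union> K) (rsub B p))"
proof -
  have "rsub (A \<union> B) p = map_pmf (\<lambda>(f, g). {e \<in> A. f e} \<union> {e \<in> B. g e})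
      (pair_pmf (Pi_pmf A False (\<lambda>_. bernoulli_pmf p)) (Pi_pmf B False (\<lambda>_. bernoulli_pmf p)))"
    unfolding rsub_def Pi_pmf_union[OF assms] pmf.map_comp
    using assms(3) by (intro map_pmf_cong) (auto simp: fun_eq_iff)
  then show ?thesis
    by (simp add: rsub_def pair_pmf_def map_pmf_def bind_assoc_pmf bind_return_pmf)
qed

lemma rsub_split:
  assumes "finite F" "A \<subseteq> F"
  shows "rsub F p = bind_pmf (rsub A p) (\<lambda>H. map_pmf (\<lambda>K. H \<union> K) (rsub (F - A) p))"
proof -
  have "A \<union> (F - A) = F" using assms by auto
  then show ?thesis using rsub_union[of A "F - A" p] assms finite_subset[OF assms(2,1)] by simp
qed

text \<open>The generating function of a binomial variable, as a product over independent
  indicators. It serves with \<open>c = 0\<close> for avoidance (where \<open>0 ^ 0 = 1\<close>),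
  with larger \<open>c\<close> for upper tails and with \<open>c < 1\<close> for lower
  tails.\<close>

lemma expectation_rsub_power:
  assumes "finite F" "T \<subseteq> F" "0 \<le> p" "p \<le> 1" "(0::real) \<le> c"
  shows "measure_pmf.expectation (rsub F p) (\<lambda>K. c ^ card (K \<inter> T)) = (1 - p + p * c) ^ card T"
proof -
  have T: "finite T" using assms finite_subset by auto
  have *: "c ^ card ({e \<in> F. b e} \<inter> T) = (\<Prod>x\<in>F. if x \<in> T \<and> b x then c else 1)" for b
  proof -
    have "(\<Prod>x\<in>F. if x \<in> T \<and> b x then c else 1) = (\<Prod>x\<in>{x\<in>F. x \<in> T \<and> b x}. c)"
      by (rule prod.inter_filter[OF assms(1), symmetric])
    also have "{x\<in>F. x \<in> T \<and> b x} = {e \<in> F. b e} \<inter> T" by auto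
    finally show ?thesis by simp
  qed
  have "measure_pmf.expectation (rsub F p) (\<lambda>K. c ^ card (K \<inter> T)) =
      measure_pmf.expectation (Pi_pmf F False (\<lambda>_. bernoulli_pmf p)) (\<lambda>b. \<Prod>x\<in>F. if x \<in> T \<and> b x then c else 1)"
    by (simp add: rsub_def *)
  also have "\<dots> = (\<Prod>x\<in>F. measure_pmf.expectation (bernoulli_pmf p) (\<lambda>v. if x \<in> T \<and> v then c else 1))"
    using assms by (intro expectation_prod_Pi_pmf) (auto intro: integrable_measure_pmf_finite)
  also have "\<dots> = (\<Prod>x\<in>F. if x \<in> T then 1 - p + p * c else 1)"
    using assms by (intro prod.cong) (auto simp: algebra_simps)
  also have "\<dots> = (\<Prod>x\<in>{x\<in>F. x \<in> T}. 1 - p + p * c)"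
    by (rule prod.inter_filter[OF assms(1), symmetric])
  also have "{x\<in>F. x \<in> T} = T" using assms by auto
  finally show ?thesis by simp
qed

lemma prob_le_expectation:
  assumes "finite (set_pmf M)" "\<And>x. x \<in> set_pmf M \<Longrightarrow> 0 \<le> (f x :: real)"
    "\<And>x. x \<in> set_pmf M \<Longrightarrow> x \<in> A \<Longrightarrow> 1 \<le> f x"
  shows "measure_pmf.prob M A \<le> measure_pmf.expectation M f"
proof -
  have "measure_pmf.prob M A = measure_pmf.expectation M (indicator A)" by simp
  also have "\<dots> \<le> measure_pmf.expectation M f"
    using assms by (intro integral_mono_AE)
      (auto simp: AE_measure_pmf_iff indicator_def intro: integrable_measure_pmf_finite)
  finally show ?thesis .
qed

lemma finite_set_rsub: "finite F \<Longrightarrow> finite (set_pmf (rsub F p))"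
  using set_rsub finite_subset finite_Pow_iff by metis

lemma prob_rsub_avoid:
  assumes "finite F" "T \<subseteq> F" "0 \<le> p" "p \<le> 1"
  shows "measure_pmf.prob (rsub F p) {K. K \<inter> T = {}} = (1 - p) ^ card T"
proof -
  have T: "finite T" using assms finite_subset by auto
  have "measure_pmf.prob (rsub F p) {K. K \<inter> T = {}} =
     measure_pmf.expectation (rsub F p) (indicator {K. K \<inter> T = {}})" by simp
  also have "indicator {K. K \<inter> T = {}} = (\<lambda>K. (0::real) ^ card (K \<inter> T))"
    using T by (auto simp: fun_eq_iff indicator_def)
  finally show ?thesis using expectation_rsub_power[OF assms, of 0] by simp
qed

lemma prob_rsub_markov:
  assumes "finite F" "T \<subseteq> F" "0 \<le> p" "p \<le> 1" "0 < c"
    and "\<And>K. K \<in> A \<Longrightarrow> K \<subseteq> F \<Longrightarrow> C \<le> c ^ card (K \<inter> T)" "0 < C"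
  shows "measure_pmf.prob (rsub F p) A \<le> (1 - p + p * c) ^ card T / C"
proof -
  have "measure_pmf.prob (rsub F p) A \<le> measure_pmf.expectation (rsub F p) (\<lambda>K. c ^ card (K \<inter> T) / C)"
    using assms set_rsub[of F p] finite_set_rsub[OF assms(1), of p]
    by (intro prob_le_expectation) (auto simp: field_simps)
  also have "\<dots> = measure_pmf.expectation (rsub F p) (\<lambda>K. c ^ card (K \<inter> T)) / C" by simp
  finally show ?thesis using expectation_rsub_power[of F T p c] assms by simp
qed

lemma prob_rsub_markov_upper:
  assumes "finite F" "T \<subseteq> F" "0 \<le> p" "p \<le> 1" "1 \<le> c"
  shows "measure_pmf.prob (rsub F p) {K. k \<le> card (K \<inter> T)} \<le> (1 - p + p * c) ^ card T / c ^ k"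
  using assms by (intro prob_rsub_markov) (auto intro: power_increasing)

lemma prob_rsub_markov_lower:
  assumes "finite F" "T \<subseteq> F" "0 \<le> p" "p \<le> 1" "0 < c" "c \<le> 1"
  shows "measure_pmf.prob (rsub F p) {K. card (K \<inter> T) \<le> k} \<le> (1 - p + p * c) ^ card T / c ^ k"
  using assms by (intro prob_rsub_markov) (auto intro: power_decreasing)

text \<open>Reveal the part \<open>A\<close> first. Given \<open>G \<inter> A = H\<close>, the
  target \<open>T H\<close> is a fixed set of unrevealed elements, each absent independently with
  probability \<open>1 - p\<close>. The resulting bound is the same for all \<open>H\<close> and so
  survives averaging.\<close>

lemma prob_rsub_avoid_adaptive_le:
  assumes "finite F" "A \<subseteq> F" "\<And>H. H \<subseteq> A \<Longrightarrow> T H \<subseteq> F - A" "0 \<le> p" "p \<le> 1"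
  shows "measure_pmf.prob (rsub F p) {G. M \<le> card (T (G \<inter> A)) \<and> G \<inter> T (G \<inter> A) = {}} \<le> (1 - p) ^ M"
proof -
  let ?X = "{G. M \<le> card (T (G \<inter> A)) \<and> G \<inter> T (G \<inter> A) = {}}"
  have fin: "finite A" "finite (F - A)" using assms finite_subset by auto
  have "emeasure (map_pmf (\<lambda>K. H \<union> K) (rsub (F - A) p)) ?X \<le> ennreal ((1 - p) ^ M)" if H: "H \<subseteq> A" for H
  proof -
    have TF: "T H \<subseteq> F - A" using assms(3) H by auto
    have eq: "(H \<union> K) \<inter> A = H" "(H \<union> K) \<inter> T H = K \<inter> T H" if "K \<in> set_pmf (rsub (F - A) p)" for K
      using set_rsub[of "F - A" p] that H TF by auto
    have "measure_pmf.prob (map_pmf (\<lambda>K. H \<union> K) (rsub (F - A) p)) ?X =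
        measure_pmf.prob (rsub (F - A) p) {K. M \<le> card (T ((H \<union> K) \<inter> A)) \<and> (H \<union> K) \<inter> T ((H \<union> K) \<inter> A) = {}}"
      by (simp add: vimage_def)
    also have "\<dots> \<le> (1 - p) ^ M"
    proof (cases "M \<le> card (T H)")
      case True
      have "measure_pmf.prob (rsub (F - A) p) {K. M \<le> card (T ((H \<union> K) \<inter> A)) \<and> (H \<union> K) \<inter> T ((H \<union> K) \<inter> A) = {}}
          = measure_pmf.prob (rsub (F - A) p) {K. K \<inter> T H = {}}"
        using True by (intro measure_pmf.finite_measure_eq_AE) (auto simp: AE_measure_pmf_iff eq)
      also have "\<dots> = (1 - p) ^ card (T H)" using assms fin TF by (intro prob_rsub_avoid) auto
      also have "\<dots> \<le> (1 - p) ^ M" using True assms by (intro power_decreasing) auto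
      finally show ?thesis .
    next
      case False
      have "measure_pmf.prob (rsub (F - A) p) {K. M \<le> card (T ((H \<union> K) \<inter> A)) \<and> (H \<union> K) \<inter> T ((H \<union> K) \<inter> A) = {}}
          = measure_pmf.prob (rsub (F - A) p) {}"
        using False by (intro measure_pmf.finite_measure_eq_AE) (auto simp: AE_measure_pmf_iff eq)
      then show ?thesis using assms by simp
    qed
    finally show ?thesis by (simp add: measure_pmf.emeasure_eq_measure ennreal_leI)
  qed
  then have "emeasure (rsub F p) ?X \<le> (\<integral>\<^sup>+H. ennreal ((1 - p) ^ M) \<partial>rsub A p)"
    using set_rsub[of A p] unfolding rsub_split[OF assms(1,2)]
    by (subst emeasure_bind_pmf) (intro nn_integral_mono_AE, auto simp: AE_measure_pmf_iff)
  then show ?thesis using assms by (simp add: measure_pmf.emeasure_eq_measure)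
qed

text \<open>With targets of constant size the conditional probability does not depend on
  \<open>H\<close>. The second moment argument needs this exact value, not only a bound.\<close>

lemma prob_rsub_avoid_adaptive_eq:
  assumes "finite F" "A \<subseteq> F" "\<And>H. H \<subseteq> A \<Longrightarrow> T H \<subseteq> F - A" "0 \<le> p" "p \<le> 1"
    "\<And>H. H \<subseteq> A \<Longrightarrow> card (T H) = M"
  shows "measure_pmf.prob (rsub F p) {G. G \<inter> T (G \<inter> A) = {}} = (1 - p) ^ M"
proof -
  let ?X = "{G. G \<inter> T (G \<inter> A) = {}}"
  have fin: "finite A" "finite (F - A)" using assms finite_subset by auto
  have "emeasure (map_pmf (\<lambda>K. H \<union> K) (rsub (F - A) p)) ?X = ennreal ((1 - p) ^ M)" if H: "H \<subseteq> A" for H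
  proof -
    have TF: "T H \<subseteq> F - A" using assms(3) H by auto
    have eq: "(H \<union> K) \<inter> A = H" "(H \<union> K) \<inter> T H = K \<inter> T H" if "K \<in> set_pmf (rsub (F - A) p)" for K
      using set_rsub[of "F - A" p] that H TF by auto
    have "measure_pmf.prob (map_pmf (\<lambda>K. H \<union> K) (rsub (F - A) p)) ?X =
        measure_pmf.prob (rsub (F - A) p) {K. (H \<union> K) \<inter> T ((H \<union> K) \<inter> A) = {}}"
      by (simp add: vimage_def)
    also have "\<dots> = measure_pmf.prob (rsub (F - A) p) {K. K \<inter> T H = {}}"
      by (intro measure_pmf.finite_measure_eq_AE) (auto simp: AE_measure_pmf_iff eq)
    also have "\<dots> = (1 - p) ^ M" using assms fin TF H by (subst prob_rsub_avoid) auto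
    finally show ?thesis by (simp add: measure_pmf.emeasure_eq_measure)
  qed
  then have "emeasure (rsub F p) ?X = (\<integral>\<^sup>+H. ennreal ((1 - p) ^ M) \<partial>rsub A p)"
    using set_rsub[of A p] unfolding rsub_split[OF assms(1,2)]
    by (subst emeasure_bind_pmf) (intro nn_integral_cong_AE, auto simp: AE_measure_pmf_iff)
  then show ?thesis using assms by (simp add: measure_pmf.emeasure_eq_measure)
qed

section \<open>The random graph as a random subset of the pairs\<close>

lemma finite_all_pairs [simp]: "finite (all_pairs n)"
proof -
  have "all_pairs n \<subseteq> Pow {0..<n}" by (auto simp: all_pairs_def)
  then show ?thesis using finite_subset by auto
qed

lemma all_pairs_iff: "{u, v} \<in> all_pairs n \<longleftrightarrow> u < n \<and> v < n \<and> u \<noteq> v"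
  unfolding all_pairs_def
  by (auto simp: doubleton_eq_iff) (metis linorder_neqE_nat)

lemma gnp_eq_rsub:
  assumes "0 \<le> p" shows "gnp n p = rsub (all_pairs n) (min 1 p)"
proof -
  have "pmf (bernoulli_pmf p) i = pmf (bernoulli_pmf (min 1 p)) i" for i
    using assms by (simp add: bernoulli_pmf.rep_eq)
  then have "bernoulli_pmf p = bernoulli_pmf (min 1 p)" by (rule pmf_eqI)
  then show ?thesis by (simp add: gnp_def rsub_def)
qed

lemma card_all_pairs_subset:
  assumes "finite B" shows "real (card {e \<in> all_pairs n. e \<subseteq> B}) \<le> real (card B) ^ 2 / 2"
proof -
  have "{e \<in> all_pairs n. e \<subseteq> B} \<subseteq> {e. e \<subseteq> B \<and> card e = 2}"
    by (auto simp: all_pairs_def)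
  then have "card {e \<in> all_pairs n. e \<subseteq> B} \<le> card B choose 2"
    using n_subsets[OF assms, of 2] card_mono[of "{e. e \<subseteq> B \<and> card e = 2}"] assms by fastforce
  then have "real (card {e \<in> all_pairs n. e \<subseteq> B}) \<le> real (card B choose 2)" by simp
  also have "\<dots> \<le> real (card B) ^ 2 / 2"
  proof -
    have "2 * (card B choose 2) \<le> card B * (card B - 1)"
      unfolding choose_two by (rule times_div_less_eq_dividend)
    also have "\<dots> \<le> card B * card B" by (intro mult_le_mono) auto
    finally have "real (2 * (card B choose 2)) \<le> real (card B * card B)" by (rule of_nat_mono)
    then show ?thesis by (simp add: power2_eq_square)
  qed
  finally show ?thesis .
qed

section \<open>Visit counts of a crawl\<close>

text \<open>Consecutive elements of \<open>K\<close> are separated by distinct elements of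
  \<open>X\<close>. The induction removes the largest element \<open>b\<close> and restricts
  \<open>X\<close> to the part up to the previous one, \<open>a\<close>; this loses at least the
  element of \<open>X\<close> between \<open>a\<close> and \<open>b\<close>.\<close>

lemma card_interlaced_le:
  fixes K X :: "nat set"
  assumes "finite K" "finite X" "\<And>k k'. k \<in> K \<Longrightarrow> k' \<in> K \<Longrightarrow> k < k' \<Longrightarrow> \<exists>x\<in>X. k < x \<and> x \<le> k'"
  shows "card K \<le> 1 + card X"
  using assms
proof (induction K arbitrary: X rule: finite_linorder_max_induct)
  case empty then show ?case by simp
next
  case (insert b A)
  show ?case
  proof (cases "A = {}")
    case True then show ?thesis by simp
  next
    case False
    define a where "a = Max A"
    have a: "a \<in> A" "\<And>k. k \<in> A \<Longrightarrow> k \<le> a" "a < b" using insert False by (auto simp: a_def)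
    obtain x where x: "x \<in> X" "a < x" using insert.prems(2)[of a b] a by auto
    have "card A \<le> 1 + card (X \<inter> {..a})"
    proof (rule insert.IH)
      fix k k' assume k: "k \<in> A" "k' \<in> A" "k < k'"
      then obtain y where "y \<in> X" "k < y" "y \<le> k'" using insert.prems(2)[of k k'] by auto
      then show "\<exists>x\<in>X \<inter> {..a}. k < x \<and> x \<le> k'" using a(2)[OF k(2)] by auto
    qed (use insert in auto)
    also have "1 + card (X \<inter> {..a}) \<le> card X"
    proof -
      have "card (X \<inter> {..a}) < card X" using x insert.prems(1) by (intro psubset_card_mono psubsetI) force+
      then show ?thesis by simp
    qed
    finally show ?thesis using insert by auto
  qed
qed

fun graph_ball :: "nat set set \<Rightarrow> nat \<Rightarrow> nat set \<Rightarrow> nat \<Rightarrow> nat set" where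
  "graph_ball G n S 0 = S"
| "graph_ball G n S (Suc i) = graph_ball G n S i \<union> {v \<in> {0..<n}. neighbours G n v \<inter> graph_ball G n S i \<noteq> {}}"

lemma graph_ball_subset: "S \<subseteq> {0..<n} \<Longrightarrow> graph_ball G n S i \<subseteq> {0..<n}"
  by (induction i) auto

lemma neighbours_sym: "u < n \<Longrightarrow> v \<in> neighbours G n u \<Longrightarrow> u \<in> neighbours G n v"
  by (auto simp: neighbours_def insert_commute)

lemma neighbours_lt: "v \<in> neighbours G n u \<Longrightarrow> v < n"
  by (auto simp: neighbours_def)

locale crawl =
  fixes G :: "nat set set" and n :: nat and w0 :: "nat \<Rightarrow> int"
  assumes weighting: "weighting n w0" and n_pos: "0 < n"
    and no_isolated: "\<And>v. v < n \<Longrightarrow> neighbours G n v \<noteq> {}"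
begin

abbreviation ps :: "nat \<Rightarrow> nat" where "ps \<equiv> crawl_pos G n w0"

definition visits :: "nat \<Rightarrow> nat \<Rightarrow> nat set \<Rightarrow> nat set" where
  "visits a b X = {k \<in> {a..<b}. ps k \<in> X}"

lemma finite_visits [simp]: "finite (visits a b X)"
  by (simp add: visits_def)

lemma ps_lt: "ps k < n"
  by (rule crawl_pos_in[OF weighting n_pos])

lemma ps_Suc_in: "ps (Suc k) \<in> neighbours G n (ps k)"
  using crawl_step(1) no_isolated ps_lt by blast

lemma wt_ps_Suc_le: "x \<in> neighbours G n (ps k) \<Longrightarrow> crawl_wt G n w0 k (ps (Suc k)) \<le> crawl_wt G n w0 k x"
  using crawl_step(2) no_isolated ps_lt by blast

text \<open>The crawler prefers the least recently visited neighbour, so between two moves into z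
  from vertices adjacent to X0 it must have visited X0.\<close>
lemma card_moves_le:
  assumes "\<And>y. y \<in> Y \<Longrightarrow> y < n \<Longrightarrow> neighbours G n y \<inter> X0 \<noteq> {}"
  shows "card {k \<in> {a..<b}. ps k \<in> Y \<and> ps (Suc k) = z} \<le> 1 + card (visits a b X0)"
proof (rule card_interlaced_le)
  fix k k' assume k: "k \<in> {k \<in> {a..<b}. ps k \<in> Y \<and> ps (Suc k) = z}"
    and k': "k' \<in> {k \<in> {a..<b}. ps k \<in> Y \<and> ps (Suc k) = z}" and "k < k'"
  obtain x where x: "x \<in> neighbours G n (ps k')" "x \<in> X0" using assms[of "ps k'"] k' ps_lt by auto
  have xn: "x < n" using x(1) by (rule neighbours_lt)
  have "int (Suc k) + 1 \<le> crawl_wt G n w0 k' (ps (Suc k))"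
    using \<open>k < k'\<close> by (intro wt_visited_ge) auto
  also have "\<dots> = crawl_wt G n w0 k' (ps (Suc k'))" using k k' by simp
  also have "\<dots> \<le> crawl_wt G n w0 k' x" by (rule wt_ps_Suc_le[OF x(1)])
  finally have le: "int (Suc k) + 1 \<le> crawl_wt G n w0 k' x" .
  then have "x \<in> ps ` {..k'}" using wt_pos_iff[OF weighting xn, of G Map.empty k'] by auto
  from wt_visited[OF this] obtain i where "i \<le> k'" "ps i = x" "crawl_wt G n w0 k' x = int i + 1" by blast
  then show "\<exists>x\<in>visits a b X0. k < x \<and> x \<le> k'"
    using le x(2) k k' by (intro bexI[of _ i]) (auto simp: visits_def)
qed auto

text \<open>Each visit to \<open>y\<close> is followed by a move into one of at most
  \<open>D\<close> neighbours \<open>z\<close>, and \<open>card_moves_le\<close> with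
  \<open>Y = {y}\<close> and \<open>X0 = {x}\<close> limits the moves into each
  \<open>z\<close>.\<close>

lemma card_visits_neighbour:
  assumes "x \<in> neighbours G n y" "card (neighbours G n y) \<le> D"
  shows "card (visits a b {y}) \<le> D * (1 + card (visits a b {x}))"
proof -
  have "visits a b {y} \<subseteq> (\<Union>z\<in>neighbours G n y. {k \<in> {a..<b}. ps k \<in> {y} \<and> ps (Suc k) = z})"
    using ps_Suc_in by (auto simp: visits_def)
  then have "card (visits a b {y}) \<le> card (\<Union>z\<in>neighbours G n y. {k \<in> {a..<b}. ps k \<in> {y} \<and> ps (Suc k) = z})"
    by (intro card_mono) auto
  also have "\<dots> \<le> (\<Sum>z\<in>neighbours G n y. card {k \<in> {a..<b}. ps k \<in> {y} \<and> ps (Suc k) = z})"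
    by (intro card_UN_le) auto
  also have "\<dots> \<le> (\<Sum>z\<in>neighbours G n y. 1 + card (visits a b {x}))"
    using assms(1) by (intro sum_mono card_moves_le) auto
  also have "\<dots> \<le> D * (1 + card (visits a b {x}))"
    using assms(2) by (simp only: sum_constant of_nat_id mult_le_mono1)
  finally show ?thesis .
qed

text \<open>One step away from \<open>S\<close> turns a bound \<open>c\<close> into
  \<open>D * (1 + c)\<close>, which is at most \<open>2 * D * c\<close> once
  \<open>c \<ge> 1\<close>; hence the base \<open>2 * D\<close>.\<close>

lemma card_visits_ball:
  assumes "visits a b S = {}" "\<And>v. v < n \<Longrightarrow> card (neighbours G n v) \<le> D" "1 \<le> D"
    and "y \<in> graph_ball G n S i"
  shows "card (visits a b {y}) \<le> (2 * D) ^ i"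
  using assms(4)
proof (induction i arbitrary: y)
  case 0
  then have "visits a b {y} = {}" using assms(1) by (auto simp: visits_def)
  then show ?case by simp
next
  case (Suc i)
  show ?case
  proof (cases "y \<in> graph_ball G n S i")
    case True
    then have "card (visits a b {y}) \<le> (2 * D) ^ i" by (rule Suc.IH)
    also have "\<dots> \<le> (2 * D) ^ Suc i" using assms(3) by (intro power_increasing) auto
    finally show ?thesis .
  next
    case False
    then obtain x where x: "y < n" "x \<in> neighbours G n y" "x \<in> graph_ball G n S i" using Suc.prems by auto
    have "card (visits a b {y}) \<le> D * (1 + card (visits a b {x}))"
      by (rule card_visits_neighbour[OF x(2) assms(2)[OF x(1)]])
    also have "\<dots> \<le> D * (1 + (2 * D) ^ i)" using Suc.IH[OF x(3)] by simp
    also have "\<dots> \<le> D * ((2 * D) ^ i + (2 * D) ^ i)" using assms(3) by (intro mult_le_mono2 add_le_mono1) simp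
    also have "\<dots> = (2 * D) ^ Suc i" by simp
    finally show ?thesis .
  qed
qed

text \<open>A potential argument: a descending step lowers \<open>l\<close> by at least 1 and any
  other step raises it by at most 1, so descents are paid for by the other steps and by the initial
  level.\<close>

lemma card_down_le:
  fixes l :: "nat \<Rightarrow> nat"
  assumes "\<And>k. l (Suc k) \<le> Suc (l k)"
  shows "a \<le> b \<Longrightarrow> card {k \<in> {a..<b}. l (Suc k) < l k} + l b \<le> l a + card {k \<in> {a..<b}. l k \<le> l (Suc k)}"
proof (induction b)
  case 0 then show ?case by simp
next
  case (Suc b)
  show ?case
  proof (cases "a = Suc b")
    case True then show ?thesis by simp
  next
    case False
    then have "a \<le> b" using Suc by simp
    have *: "card {k \<in> {a..<Suc b}. P k} = card {k \<in> {a..<b}. P k} + (if P b then 1 else 0)" for P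
    proof (cases "P b")
      case True
      then have "{k \<in> {a..<Suc b}. P k} = insert b {k \<in> {a..<b}. P k}" using \<open>a \<le> b\<close> by auto
      then show ?thesis using True by simp
    next
      case False
      then have "{k \<in> {a..<Suc b}. P k} = {k \<in> {a..<b}. P k}" by (auto simp: less_Suc_eq)
      then show ?thesis using False by simp
    qed
    show ?thesis using Suc.IH[OF \<open>a \<le> b\<close>] assms[of b]
      unfolding *[of "\<lambda>k. l (Suc k) < l k"] *[of "\<lambda>k. l k \<le> l (Suc k)"] by (auto split: if_splits)
  qed
qed

text \<open>Steps are classified by whether they approach S; each retreating or level step from distance
  i + 1 uses an ordered edge inside the set at distance greater than i, at most 1 + (2D)^i times.\<close>
lemma window_length_le:
  assumes S: "visits a b S = {}" and deg: "\<And>v. v < n \<Longrightarrow> card (neighbours G n v) \<le> D" "1 \<le> D"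
    and cover: "{0..<n} \<subseteq> graph_ball G n S I"
    and E: "\<And>i. i \<in> {1..I} \<Longrightarrow>
      card {(y, z). y \<in> {0..<n} - graph_ball G n S i \<and> z \<in> {0..<n} - graph_ball G n S i \<and> z \<in> neighbours G n y} \<le> E i"
  shows "b - a \<le> I + 2 * (n + (\<Sum>i=1..I. E i * (1 + (2 * D) ^ i)))"
proof (cases "a \<le> b")
  case True
  define lev where "lev y = (LEAST i. y \<in> graph_ball G n S i)" for y
  have lev_in: "y \<in> graph_ball G n S (lev y)" if "y < n" for y
    unfolding lev_def by (rule LeastI[of _ I]) (use cover that in auto)
  have lev_le: "lev y \<le> i" if "y \<in> graph_ball G n S i" for y i
    unfolding lev_def using that by (rule Least_le)
  have lev_I: "lev y \<le> I" if "y < n" for y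
    by (rule lev_le) (use cover that in auto)
  have notin: "y \<notin> graph_ball G n S i" if "i < lev y" for y i
    using lev_le[of y i] that by linarith
  define l where "l k = lev (ps k)" for k
  have l_Suc: "l (Suc k) \<le> Suc (l k)" for k
  proof -
    have "ps k \<in> neighbours G n (ps (Suc k)) \<inter> graph_ball G n S (lev (ps k))"
      using lev_in[OF ps_lt] neighbours_sym[OF ps_lt ps_Suc_in] by blast
    then have "ps (Suc k) \<in> graph_ball G n S (Suc (lev (ps k)))" using ps_lt[of "Suc k"] by auto
    then show ?thesis unfolding l_def by (rule lev_le)
  qed
  define ND where "ND = {k \<in> {a..<b}. l k \<le> l (Suc k)}"
  \<comment> \<open>A step that does not descend from level \<open>i + 1\<close> has both ends
    outside the ball of radius \<open>i\<close>, so for \<open>i \<ge> 1\<close> such steps are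
    counted per pair in \<open>P i\<close>. Sources of level 1 are pooled in \<open>R\<close>: all
    of them are adjacent to \<open>S\<close>, so each target is used at most once, and the total is
    \<open>n\<close> instead of one term per edge.\<close>
  define P where "P i = {(y, z). y \<in> {0..<n} - graph_ball G n S i \<and> z \<in> {0..<n} - graph_ball G n S i \<and> z \<in> neighbours G n y}" for i
  define Q where "Q i = (\<lambda>(y, z). {k \<in> {a..<b}. ps k \<in> {v. v = y \<and> lev v = Suc i} \<and> ps (Suc k) = z})" for i
  define R where "R z = {k \<in> {a..<b}. ps k \<in> {v. lev v = 1} \<and> ps (Suc k) = z}" for z
  have finP: "finite (P i)" for i
    by (rule finite_subset[of _ "{0..<n} \<times> {0..<n}"]) (auto simp: P_def)
  have finQ: "finite (Q i e)" for i e by (cases e) (simp add: Q_def)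
  have "ND \<subseteq> (\<Union>z\<in>{0..<n}. R z) \<union> (\<Union>i\<in>{1..I}. \<Union>e\<in>P i. Q i e)"
  proof
    fix k assume k: "k \<in> ND"
    have "l k \<noteq> 0"
    proof
      assume "l k = 0"
      then have "ps k \<in> S" using lev_in[OF ps_lt, of k] by (simp add: l_def)
      then show False using S k by (auto simp: visits_def ND_def)
    qed
    then have "l k = 1 \<or> l k = Suc (l k - 1) \<and> 1 \<le> l k - 1" by linarith
    then consider "l k = 1" | i where "l k = Suc i" "1 \<le> i" by blast
    then show "k \<in> (\<Union>z\<in>{0..<n}. R z) \<union> (\<Union>i\<in>{1..I}. \<Union>e\<in>P i. Q i e)"
    proof cases
      case 1
      then have "k \<in> R (ps (Suc k))" using k by (simp add: R_def ND_def l_def)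
      then show ?thesis using ps_lt[of "Suc k"] by (intro UnI1 UN_I) auto
    next
      case 2
      have "i \<le> I" using lev_I[OF ps_lt, of k] 2 by (simp add: l_def)
      moreover have "(ps k, ps (Suc k)) \<in> P i"
        using 2 k ps_lt[of k] ps_lt[of "Suc k"] ps_Suc_in[of k] notin[of i "ps k"] notin[of i "ps (Suc k)"]
        by (simp add: P_def ND_def l_def)
      moreover have "k \<in> Q i (ps k, ps (Suc k))" using k 2 by (simp add: Q_def ND_def l_def)
      ultimately show ?thesis using \<open>1 \<le> i\<close> by (meson UN_I UnI2 atLeastAtMost_iff)
    qed
  qed
  then have "card ND \<le> card ((\<Union>z\<in>{0..<n}. R z) \<union> (\<Union>i\<in>{1..I}. \<Union>e\<in>P i. Q i e))"
    using finP finQ by (intro card_mono) (auto simp: R_def)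
  also have "\<dots> \<le> card (\<Union>z\<in>{0..<n}. R z) + card (\<Union>i\<in>{1..I}. \<Union>e\<in>P i. Q i e)" by (rule card_Un_le)
  finally have ND1: "card ND \<le> card (\<Union>z\<in>{0..<n}. R z) + card (\<Union>i\<in>{1..I}. \<Union>e\<in>P i. Q i e)" .
  have "card (\<Union>z\<in>{0..<n}. R z) \<le> (\<Sum>z\<in>{0..<n}. card (R z))" by (intro card_UN_le) auto
  also have "\<dots> \<le> (\<Sum>z\<in>{0..<n}. 1)"
  proof (intro sum_mono)
    fix z
    have "card (R z) \<le> 1 + card (visits a b S)" unfolding R_def
    proof (rule card_moves_le)
      fix y assume "y \<in> {v. lev v = 1}" "y < n"
      then show "neighbours G n y \<inter> S \<noteq> {}" using lev_in[of y] notin[of 0 y] by auto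
    qed
    then show "card (R z) \<le> 1" using S by simp
  qed
  also have "\<dots> = n" by simp
  finally have ND2: "card (\<Union>z\<in>{0..<n}. R z) \<le> n" .
  have "card (\<Union>i\<in>{1..I}. \<Union>e\<in>P i. Q i e) \<le> (\<Sum>i=1..I. card (\<Union>e\<in>P i. Q i e))" by (intro card_UN_le) auto
  also have "\<dots> \<le> (\<Sum>i=1..I. E i * (1 + (2 * D) ^ i))"
  proof (intro sum_mono)
    fix i assume i: "i \<in> {1..I}"
    have "card (\<Union>e\<in>P i. Q i e) \<le> (\<Sum>e\<in>P i. card (Q i e))" by (intro card_UN_le finP)
    also have "\<dots> \<le> (\<Sum>e\<in>P i. 1 + (2 * D) ^ i)"
    proof (intro sum_mono)
      fix e assume "e \<in> P i"
      obtain y z where e: "e = (y, z)" by (cases e)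
      show "card (Q i e) \<le> 1 + (2 * D) ^ i"
      proof (cases "y < n \<and> lev y = Suc i")
        case False
        then have "Q i e = {}" using ps_lt by (auto simp: Q_def e)
        then show ?thesis by simp
      next
        case True
        then have "y \<in> graph_ball G n S (Suc i)" "y \<notin> graph_ball G n S i" using lev_in[of y] notin[of i y] by auto
        then obtain x where x: "x \<in> neighbours G n y" "x \<in> graph_ball G n S i" by auto
        have "card (Q i e) \<le> 1 + card (visits a b {x})"
          unfolding Q_def e prod.case by (rule card_moves_le) (use x in auto)
        also have "\<dots> \<le> 1 + (2 * D) ^ i" using card_visits_ball[OF S deg x(2)] by simp
        finally show ?thesis .
      qed
    qed
    also have "\<dots> \<le> E i * (1 + (2 * D) ^ i)"
      using E[OF i] unfolding P_def[symmetric] by (simp only: sum_constant of_nat_id mult_le_mono1)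
    finally show "card (\<Union>e\<in>P i. Q i e) \<le> E i * (1 + (2 * D) ^ i)" .
  qed
  finally have ND: "card ND \<le> n + (\<Sum>i=1..I. E i * (1 + (2 * D) ^ i))" using ND1 ND2 by linarith
  \<comment> \<open>There are at most \<open>I + card ND\<close> descending steps by
    \<open>card_down_le\<close>, hence at most \<open>I + 2 * card ND\<close> steps in all.\<close>
  have "{a..<b} = {k \<in> {a..<b}. l (Suc k) < l k} \<union> ND"
    unfolding ND_def by auto
  then have "b - a = card ({k \<in> {a..<b}. l (Suc k) < l k} \<union> ND)"
    by (metis card_atLeastLessThan)
  also have "\<dots> \<le> card {k \<in> {a..<b}. l (Suc k) < l k} + card ND" by (rule card_Un_le)
  also have "\<dots> \<le> I + 2 * card ND"
    using card_down_le[of l, OF l_Suc True] lev_I[OF ps_lt, of a] unfolding ND_def l_def by simp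
  finally show ?thesis using ND by simp
qed simp

end

section \<open>Covering time in expanding graphs\<close>

definition degree_bounds :: "nat set set \<Rightarrow> nat \<Rightarrow> real \<Rightarrow> nat \<Rightarrow> bool" where
  "degree_bounds G n \<delta> D \<longleftrightarrow> (\<forall>v<n. \<delta> \<le> real (card (neighbours G n v)) \<and> card (neighbours G n v) \<le> D)"

definition locally_sparse :: "nat set set \<Rightarrow> nat \<Rightarrow> nat \<Rightarrow> nat \<Rightarrow> bool" where
  "locally_sparse G n m s \<longleftrightarrow> (\<forall>B\<subseteq>{0..<n}. card B \<le> s \<longrightarrow> card {e \<in> G. e \<subseteq> B} \<le> m * card B)"

definition large_sets_joined :: "nat set set \<Rightarrow> nat \<Rightarrow> nat \<Rightarrow> bool" where
  "large_sets_joined G n s \<longleftrightarrow> (\<forall>A B. A \<subseteq> {0..<n} \<longrightarrow> B \<subseteq> {0..<n} \<longrightarrow> A \<inter> B = {} \<longrightarrow>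
     s \<le> card A \<longrightarrow> s \<le> card B \<longrightarrow> (\<exists>a\<in>A. \<exists>b\<in>B. {a, b} \<in> G))"

lemma card_ordered_edges_le:
  assumes "G \<subseteq> all_pairs n"
  shows "card {(y, z). y \<in> B \<and> z \<in> B \<and> z \<in> neighbours G n y} \<le> 2 * card {e \<in> G. e \<subseteq> B}"
proof -
  have fin: "finite {e \<in> G. e \<subseteq> B}" using assms finite_subset[of G] by auto
  have "card {(y, z). y \<in> B \<and> z \<in> B \<and> z \<in> neighbours G n y} \<le> card ({e \<in> G. e \<subseteq> B} \<times> (UNIV :: bool set))"
  proof (rule card_inj_on_le[of "\<lambda>(y, z). ({y, z}, y < z)"])
    show "inj_on (\<lambda>(y, z). ({y, z}, y < z)) {(y, z). y \<in> B \<and> z \<in> B \<and> z \<in> neighbours G n y}"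
      by (auto simp: inj_on_def doubleton_eq_iff)
    show "(\<lambda>(y, z). ({y, z}, y < z)) ` {(y, z). y \<in> B \<and> z \<in> B \<and> z \<in> neighbours G n y}
        \<subseteq> {e \<in> G. e \<subseteq> B} \<times> UNIV"
      by (auto simp: neighbours_def)
    show "finite ({e \<in> G. e \<subseteq> B} \<times> (UNIV :: bool set))" using fin by simp
  qed
  then show ?thesis by (simp add: card_cartesian_product)
qed

text \<open>Here \<gamma> is the expansion factor that minimum degree \<delta> forces on sets whose
  neighbourhoods span at most \<open>m\<close> edges per vertex, and \<beta> measures by how much
  the growth rate \<open>2 * D\<close> of the visit bound exceeds it.\<close>

locale expanding_crawl = crawl +
  fixes D m s :: nat and \<delta> \<gamma> \<beta> :: real
  assumes edges: "G \<subseteq> all_pairs n"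
    and deg: "degree_bounds G n \<delta> D"
    and sparse: "locally_sparse G n m (2 * s)"
    and joined: "large_sets_joined G n s"
    and m_pos: "1 \<le> m" and s_pos: "1 \<le> s" and D_pos: "1 \<le> D"
    and \<delta>: "\<delta> = \<gamma> * (2 * real m)" and \<gamma>: "1 < \<gamma>"
    and \<beta>: "2 * real D = \<beta> * \<gamma>" "1 \<le> \<beta>"
begin

lemma deg_D: "v < n \<Longrightarrow> card (neighbours G n v) \<le> D"
  and deg_\<delta>: "v < n \<Longrightarrow> \<delta> \<le> real (card (neighbours G n v))"
  using deg by (auto simp: degree_bounds_def)

text \<open>Double counting of ordered edges that start in \<open>A\<close>: at least \<delta> per
  vertex, all of them inside \<open>B\<close>, which spans at most \<open>m * card B\<close> edges.
  The relation between \<delta> and \<gamma> is made so that \<open>2 * m\<close> cancels.\<close>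

lemma expansion:
  assumes "A \<subseteq> B" "B \<subseteq> {0..<n}" "card B \<le> 2 * s" "\<And>y. y \<in> A \<Longrightarrow> neighbours G n y \<subseteq> B"
  shows "\<gamma> * real (card A) \<le> real (card B)"
proof -
  have fin: "finite A" "finite B" using finite_subset[OF assms(2)] finite_subset[OF assms(1)] by auto
  have "real (card A) * \<delta> = (\<Sum>y\<in>A. \<delta>)" by simp
  also have "\<dots> \<le> (\<Sum>y\<in>A. real (card (neighbours G n y)))"
    using assms deg_\<delta> by (intro sum_mono) auto
  also have "\<dots> = real (card (Sigma A (neighbours G n)))"
    using fin by (simp add: card_SigmaI)
  also have "\<dots> \<le> real (card {(y, z). y \<in> B \<and> z \<in> B \<and> z \<in> neighbours G n y})"
  proof (intro of_nat_mono card_mono)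
    show "finite {(y, z). y \<in> B \<and> z \<in> B \<and> z \<in> neighbours G n y}"
      by (rule finite_subset[of _ "B \<times> B"]) (use fin in auto)
  qed (use assms in auto)
  also have "\<dots> \<le> real (2 * card {e \<in> G. e \<subseteq> B})"
    by (intro of_nat_mono card_ordered_edges_le edges)
  also have "\<dots> \<le> real (2 * (m * card B))"
    using sparse assms by (intro of_nat_mono mult_le_mono2) (auto simp: locally_sparse_def)
  finally have "(\<gamma> * real (card A)) * (2 * real m) \<le> real (card B) * (2 * real m)"
    by (simp add: \<delta> mult_ac)
  then show ?thesis using m_pos by simp
qed

lemma ball_growth:
  assumes "u < n" "\<And>i. i < j \<Longrightarrow> card (graph_ball G n {u} (Suc i)) \<le> 2 * s"
  shows "\<gamma> ^ j \<le> real (card (graph_ball G n {u} j))"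
  using assms(2)
proof (induction j)
  case 0 then show ?case by simp
next
  case (Suc j)
  have "\<gamma> ^ Suc j \<le> \<gamma> * real (card (graph_ball G n {u} j))"
    using Suc \<gamma> by simp
  also have "\<dots> \<le> real (card (graph_ball G n {u} (Suc j)))"
  proof (rule expansion)
    have V: "graph_ball G n {u} i \<subseteq> {0..<n}" for i using assms(1) by (intro graph_ball_subset) auto
    show "graph_ball G n {u} (Suc j) \<subseteq> {0..<n}" by (rule V)
    show "graph_ball G n {u} j \<subseteq> graph_ball G n {u} (Suc j)" by simp
    show "card (graph_ball G n {u} (Suc j)) \<le> 2 * s" using Suc.prems[of j] by blast
    fix y assume y: "y \<in> graph_ball G n {u} j"
    then have yn: "y < n" using V[of j] by auto
    show "neighbours G n y \<subseteq> graph_ball G n {u} (Suc j)"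
    proof
      fix z assume "z \<in> neighbours G n y"
      then show "z \<in> graph_ball G n {u} (Suc j)"
        using neighbours_sym[OF yn \<open>z \<in> neighbours G n y\<close>] neighbours_lt[OF \<open>z \<in> neighbours G n y\<close>] y by auto
    qed
  qed
  finally show ?case .
qed

text \<open>The first step is \<open>joined\<close>: \<open>s\<close> vertices outside the first
  ball would have an edge to \<open>S\<close>. Afterwards \<open>expansion\<close> is read from
  outside inwards: neighbours of a vertex beyond distance \<open>i + 2\<close> lie beyond distance
  \<open>i + 1\<close>, so the outer set is smaller by the factor \<gamma>.\<close>

lemma co_ball_shrink:
  assumes "S \<subseteq> {0..<n}" "s \<le> card S"
  shows "\<gamma> ^ i * real (card ({0..<n} - graph_ball G n S (Suc i))) \<le> real s"
proof (induction i)
  case 0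
  have "card ({0..<n} - graph_ball G n S (Suc 0)) < s"
  proof (rule ccontr)
    assume "\<not> ?thesis"
    then have *: "s \<le> card ({0..<n} - graph_ball G n S (Suc 0))" by simp
    have "\<exists>a\<in>S. \<exists>b\<in>{0..<n} - graph_ball G n S (Suc 0). {a, b} \<in> G"
      by (rule joined[unfolded large_sets_joined_def, rule_format, OF assms(1) _ _ assms(2) *]) auto
    then obtain a b where ab: "a \<in> S" "b < n" "b \<notin> graph_ball G n S (Suc 0)" "{a, b} \<in> G"
      by (metis DiffE atLeastLessThan_iff)
    then have "a \<in> neighbours G n b" using assms(1) by (auto simp: neighbours_def insert_commute)
    then show False using ab by auto
  qed
  then show ?case by simp
next
  case (Suc i)
  let ?D = "\<lambda>i. {0..<n} - graph_ball G n S i"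
  have "\<gamma> * real (card (?D (Suc (Suc i)))) \<le> real (card (?D (Suc i)))"
  proof (rule expansion)
    have "1 * real (card (?D (Suc i))) \<le> \<gamma> ^ i * real (card (?D (Suc i)))"
      using \<gamma> by (intro mult_right_mono one_le_power) auto
    then have "real (card (?D (Suc i))) \<le> real s" using Suc.IH by linarith
    then show "card (?D (Suc i)) \<le> 2 * s" by linarith
    show "?D (Suc (Suc i)) \<subseteq> ?D (Suc i)" by auto
    fix y assume "y \<in> ?D (Suc (Suc i))"
    then show "neighbours G n y \<subseteq> ?D (Suc i)" using neighbours_lt by auto
  qed auto
  then have "\<gamma> ^ i * (\<gamma> * real (card (?D (Suc (Suc i))))) \<le> \<gamma> ^ i * real (card (?D (Suc i)))"
    using \<gamma> by (intro mult_left_mono) auto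
  then show ?case using Suc.IH by (simp add: mult_ac)
qed

text \<open>The set beyond radius \<open>i\<close> decays like \<gamma>^(-i), while the visit bound
  grows like (\<beta>\<gamma>)^i. In the sum of \<open>window_length_le\<close> the powers of
  \<gamma> cancel, and each of the \<open>I + 1\<close> terms is bounded through \<beta>^I. The
  assumption on \<open>I\<close> makes the last outer set smaller than one vertex, hence
  empty.\<close>

lemma window_bound:
  assumes S: "visits a b S = {}" "S \<subseteq> {0..<n}" "s \<le> card S" and I: "real s < \<gamma> ^ I"
  shows "real (b - a) \<le> real (I + 1) + 2 * real n + 16 * real (I + 1) * real m * real s * real D * \<beta> ^ I"
proof -
  let ?D = "\<lambda>i. {0..<n} - graph_ball G n S i"
  have shrink: "\<gamma> ^ i * real (card (?D (Suc i))) \<le> real s" for i by (rule co_ball_shrink[OF S(2,3)])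
  have small: "card (?D (Suc i)) \<le> 2 * s" for i
  proof -
    have "1 * real (card (?D (Suc i))) \<le> \<gamma> ^ i * real (card (?D (Suc i)))"
      using \<gamma> by (intro mult_right_mono one_le_power) auto
    then show ?thesis using shrink[of i] by linarith
  qed
  have "card (?D (Suc I)) = 0"
  proof (rule ccontr)
    assume "card (?D (Suc I)) \<noteq> 0"
    then have "1 \<le> real (card (?D (Suc I)))" by linarith
    then have "\<gamma> ^ I * 1 \<le> \<gamma> ^ I * real (card (?D (Suc I)))" using \<gamma> by (intro mult_left_mono) auto
    then show False using shrink[of I] I by linarith
  qed
  then have "?D (Suc I) = {}" by (simp only: card_0_eq finite_Diff finite_atLeastLessThan)
  then have cover: "{0..<n} \<subseteq> graph_ball G n S (Suc I)" by blast
  have "b - a \<le> Suc I + 2 * (n + (\<Sum>i=1..Suc I. (2 * m * card (?D i)) * (1 + (2 * D) ^ i)))"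
  proof (rule window_length_le[OF S(1) deg_D D_pos cover])
    fix i assume i: "i \<in> {1..Suc I}"
    have "card {(y, z). y \<in> ?D i \<and> z \<in> ?D i \<and> z \<in> neighbours G n y} \<le> 2 * card {e \<in> G. e \<subseteq> ?D i}"
      by (rule card_ordered_edges_le[OF edges])
    also have "card {e \<in> G. e \<subseteq> ?D i} \<le> m * card (?D i)"
      using sparse small[of "i - 1"] i unfolding locally_sparse_def by (cases i) (auto simp del: graph_ball.simps)
    finally show "card {(y, z). y \<in> ?D i \<and> z \<in> ?D i \<and> z \<in> neighbours G n y} \<le> 2 * m * card (?D i)"
      by (simp add: mult_ac)
  qed
  then have "real (b - a) \<le> real (Suc I + 2 * (n + (\<Sum>i=1..Suc I. (2 * m * card (?D i)) * (1 + (2 * D) ^ i))))"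
    by (rule of_nat_mono)
  also have "\<dots> = real (I + 1) + 2 * real n + 2 * (\<Sum>i=1..Suc I. real ((2 * m * card (?D i)) * (1 + (2 * D) ^ i)))"
    by simp
  finally have len: "real (b - a) \<le> real (I + 1) + 2 * real n + 2 * (\<Sum>i=1..Suc I. real ((2 * m * card (?D i)) * (1 + (2 * D) ^ i)))" .
  have "(\<Sum>i=1..Suc I. real ((2 * m * card (?D i)) * (1 + (2 * D) ^ i))) \<le>
      (\<Sum>i=1..Suc I. 8 * real m * real s * real D * \<beta> ^ I)"
  proof (intro sum_mono)
    fix i assume i: "i \<in> {1..Suc I}"
    then obtain j where j: "i = Suc j" "j \<le> I" by (cases i) auto
    have "1 \<le> (2 * real D) ^ i" using D_pos by (intro one_le_power) simp
    then have "real (1 + (2 * D) ^ i) \<le> 2 * (2 * real D) ^ i"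
      unfolding of_nat_add of_nat_power of_nat_mult of_nat_numeral of_nat_1 by linarith
    \<comment> \<open>One factor \<open>2 * D\<close> is split off because the decay starts only at
      radius 1: the set beyond radius \<open>Suc j\<close> comes with
      \<open>\<gamma> ^ j\<close>.\<close>
    also have "\<dots> = 4 * real D * (\<beta> ^ j * \<gamma> ^ j)"
      unfolding power_mult_distrib[symmetric] \<beta>(1)[symmetric] j(1) by simp
    finally have "real ((2 * m * card (?D i)) * (1 + (2 * D) ^ i)) \<le> (2 * real m * real (card (?D i))) * (4 * real D * (\<beta> ^ j * \<gamma> ^ j))"
      unfolding of_nat_mult by (intro mult_mono) auto
    also have "\<dots> = 8 * real m * real D * \<beta> ^ j * (\<gamma> ^ j * real (card (?D (Suc j))))"
      by (simp add: j mult_ac)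
    also have "\<dots> \<le> 8 * real m * real D * \<beta> ^ j * real s"
      using \<beta> by (intro mult_left_mono shrink) auto
    also have "\<dots> \<le> 8 * real m * real D * \<beta> ^ I * real s"
      using \<beta> j by (intro mult_right_mono mult_left_mono power_increasing) auto
    finally show "real ((2 * m * card (?D i)) * (1 + (2 * D) ^ i)) \<le> 8 * real m * real s * real D * \<beta> ^ I"
      by (simp add: mult_ac)
  qed
  also have "\<dots> = real (I + 1) * (8 * real m * real s * real D * \<beta> ^ I)"
    by simp
  finally have "2 * (\<Sum>i=1..Suc I. real ((2 * m * card (?D i)) * (1 + (2 * D) ^ i)))
      \<le> 2 * (real (I + 1) * (8 * real m * real s * real D * \<beta> ^ I))" by simp
  also have "\<dots> = 16 * real (I + 1) * real m * real s * real D * \<beta> ^ I" by simp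
  finally show ?thesis using len by linarith
qed

lemma visits_ge:
  assumes "finite X" "\<And>a. a + \<tau> \<le> q * \<tau> \<Longrightarrow> r \<le> card (ps ` {a..<a + \<tau>} \<inter> X)"
  shows "q * r \<le> card (visits 0 (q * \<tau>) X)"
  using assms(2)
proof (induction q)
  case 0 then show ?case by simp
next
  case (Suc q)
  let ?W = "visits (q * \<tau>) (q * \<tau> + \<tau>) X"
  have "r \<le> card (ps ` {q * \<tau>..<q * \<tau> + \<tau>} \<inter> X)" by (rule Suc.prems) simp
  also have "\<dots> \<le> card (ps ` ?W)" by (intro card_mono) (auto simp: visits_def)
  also have "card (ps ` ?W) \<le> card ?W" by (intro card_image_le) simp
  finally have r: "r \<le> card ?W" .
  have "q * r \<le> card (visits 0 (q * \<tau>) X)" by (rule Suc.IH) (use Suc.prems in auto)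
  moreover have "card (visits 0 (q * \<tau>) X \<union> ?W) = card (visits 0 (q * \<tau>) X) + card ?W"
    by (intro card_Un_disjoint) (auto simp: visits_def)
  moreover have "visits 0 (q * \<tau>) X \<union> ?W \<subseteq> visits 0 (Suc q * \<tau>) X" by (auto simp: visits_def)
  then have "card (visits 0 (q * \<tau>) X \<union> ?W) \<le> card (visits 0 (Suc q * \<tau>) X)" by (intro card_mono) auto
  ultimately show ?case using r by simp
qed

theorem cover_time_bound:
  assumes u: "u < n" "u \<notin> ps ` {..<T}" and I: "2 * real s < \<gamma> ^ I"
  shows "real T \<le> (real (I + 1) + 2 * real n + 16 * real (I + 1) * real m * real s * real D * \<beta> ^ I + 1)
     * (8 * real D * real s * \<beta> ^ I + 1)"
proof -
  define t0 where "t0 = real (I + 1) + 2 * real n + 16 * real (I + 1) * real m * real s * real D * \<beta> ^ I"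
  \<comment> \<open>The least integer above \<open>t0\<close>: a window of this length contradicts
    \<open>window_bound\<close>, so it cannot miss \<open>s\<close> vertices.\<close>
  define \<tau> where "\<tau> = Suc (nat \<lfloor>t0\<rfloor>)"
  have t0: "0 \<le> t0" using \<beta> by (simp add: t0_def)
  have \<tau>: "t0 < real \<tau>" "real \<tau> \<le> t0 + 1" unfolding \<tau>_def using t0 by linarith+
  define B where "B = graph_ball G n {u}"
  have BV: "B i \<subseteq> {0..<n}" for i using u unfolding B_def by (intro graph_ball_subset) auto
  have finB: "finite (B i)" for i using BV finite_subset by blast
  have "\<exists>J\<le>I. 2 * s < card (B J)"
  proof (rule ccontr)
    assume "\<not> ?thesis"
    then have *: "\<And>i. i \<le> I \<Longrightarrow> card (B i) \<le> 2 * s" by (meson not_less)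
    have "\<gamma> ^ I \<le> real (card (B I))" unfolding B_def
    proof (rule ball_growth[OF u(1)])
      fix i assume "i < I"
      then show "card (graph_ball G n {u} (Suc i)) \<le> 2 * s"
        using *[of "Suc i"] unfolding B_def by linarith
    qed
    also have "\<dots> \<le> real (2 * s)" using *[of I] by (intro of_nat_mono) auto
    finally show False using I by simp
  qed
  \<comment> \<open>The first radius beyond \<open>2 * s\<close> vertices serves twice: the ball
    keeps at least half of its vertices when \<open>s\<close> are removed, and the previous ball
    still has at most \<open>2 * s\<close>, which bounds \<open>\<gamma> ^ (J - 1)\<close> and with
    it \<open>(2 * D) ^ J\<close>.\<close>
  define J where "J = (LEAST J. 2 * s < card (B J))"
  have J: "2 * s < card (B J)" "J \<le> I" and J': "\<And>i. i < J \<Longrightarrow> card (B i) \<le> 2 * s"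
  proof -
    obtain J0 where J0: "J0 \<le> I" "2 * s < card (B J0)" using \<open>\<exists>J\<le>I. 2 * s < card (B J)\<close> by blast
    show "2 * s < card (B J)" unfolding J_def by (rule LeastI, rule J0)
    show "J \<le> I" unfolding J_def using Least_le[of "\<lambda>J. 2 * s < card (B J)", OF J0(2)] J0(1) by (rule order_trans)
    show "card (B i) \<le> 2 * s" if "i < J" for i
      using not_less_Least[of i "\<lambda>J. 2 * s < card (B J)"] that unfolding J_def by simp
  qed
  have "J \<noteq> 0"
  proof
    assume "J = 0" then show False using J s_pos by (simp add: B_def)
  qed
  then obtain j where j: "J = Suc j" by (cases J) auto
  have gj: "\<gamma> ^ j \<le> real (2 * s)"
  proof -
    have "\<gamma> ^ j \<le> real (card (B j))" unfolding B_def
      by (intro ball_growth u(1)) (use J' j in \<open>simp add: B_def del: graph_ball.simps\<close>)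
    also have "\<dots> \<le> real (2 * s)" using J'[of j] j by (intro of_nat_mono) auto
    finally show ?thesis .
  qed
  have "(2 * real D) ^ J = 2 * real D * (\<beta> ^ j * \<gamma> ^ j)"
    unfolding power_mult_distrib[symmetric] \<beta>(1)[symmetric] j by simp
  also have "\<dots> \<le> 2 * real D * (\<beta> ^ I * real (2 * s))"
    using \<beta> j J \<gamma> gj by (intro mult_left_mono mult_mono power_increasing) auto
  finally have DJ: "(2 * real D) ^ J \<le> 4 * real D * real s * \<beta> ^ I" by (simp add: mult_ac)
  define q where "q = T div \<tau>"
  have qT: "q * \<tau> \<le> T" by (simp add: q_def)
  \<comment> \<open>Each window visits at least \<open>r\<close> vertices of the ball, as otherwise
    \<open>s\<close> missed ones would remain. Since \<open>card (B J) \<le> 2 * r\<close>, the size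
    of the ball cancels in the comparison with the total number of visits.\<close>
  define r where "r = card (B J) - s"
  have "q * r \<le> card (visits 0 (q * \<tau>) (B J))"
  proof (rule visits_ge[OF finB])
    fix a assume a: "a + \<tau> \<le> q * \<tau>"
    let ?W = "ps ` {a..<a + \<tau>}"
    show "r \<le> card (?W \<inter> B J)"
    proof (rule ccontr)
      assume "\<not> ?thesis"
      moreover have "card (B J) = card (?W \<inter> B J) + card (B J - ?W)"
        using card_Int_Diff[OF finB, of J ?W] by (simp add: Int_commute)
      ultimately have "s \<le> card (B J - ?W)" unfolding r_def by linarith
      then have "real (a + \<tau> - a) \<le> t0" unfolding t0_def
        using BV[of J] I by (intro window_bound[of _ _ "B J - ?W"]) (auto simp: visits_def)
      then show False using \<tau> by simp
    qed
  qed
  also have "\<dots> \<le> card (\<Union>y\<in>B J. visits 0 (q * \<tau>) {y})"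
    using finB by (intro card_mono) (auto simp: visits_def)
  also have "\<dots> \<le> (\<Sum>y\<in>B J. card (visits 0 (q * \<tau>) {y}))" by (intro card_UN_le finB)
  also have "\<dots> \<le> (\<Sum>y\<in>B J. (2 * D) ^ J)"
  proof (intro sum_mono)
    fix y assume "y \<in> B J"
    have "visits 0 (q * \<tau>) {u} = {}" using u(2) qT by (force simp: visits_def)
    then show "card (visits 0 (q * \<tau>) {y}) \<le> (2 * D) ^ J"
      using card_visits_ball[OF _ deg_D D_pos] \<open>y \<in> B J\<close> unfolding B_def by blast
  qed
  also have "\<dots> = card (B J) * (2 * D) ^ J" by simp
  finally have "q * r \<le> card (B J) * (2 * D) ^ J" .
  moreover have "card (B J) \<le> 2 * r" using J(1) by (simp add: r_def)
  ultimately have "q * r \<le> (2 * r) * (2 * D) ^ J" by (meson mult_le_mono1 order_trans)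
  then have "r * q \<le> r * (2 * (2 * D) ^ J)" by (simp add: mult_ac)
  moreover have "0 < r" using J(1) by (simp add: r_def)
  ultimately have "q \<le> 2 * (2 * D) ^ J" by simp
  then have "real q \<le> real (2 * (2 * D) ^ J)" by (rule of_nat_mono)
  also have "\<dots> = 2 * (2 * real D) ^ J" by simp
  also have "\<dots> \<le> 8 * real D * real s * \<beta> ^ I" using DJ by linarith
  finally have q: "real q \<le> 8 * real D * real s * \<beta> ^ I" .
  have "T \<le> \<tau> * (q + 1)"
    unfolding q_def using dividend_less_times_div[of \<tau> T] by (simp add: \<tau>_def mult_ac)
  then have "real T \<le> real \<tau> * (real q + 1)" by (metis of_nat_1 of_nat_add of_nat_le_iff of_nat_mult)
  also have "\<dots> \<le> (t0 + 1) * (8 * real D * real s * \<beta> ^ I + 1)"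
    using \<tau> q t0 by (intro mult_mono) auto
  finally show ?thesis by (simp add: t0_def)
qed

end

section \<open>Revisits\<close>

definition revisit :: "(nat \<Rightarrow> nat) \<Rightarrow> nat \<Rightarrow> bool" where
  "revisit P j \<longleftrightarrow> P (Suc j) \<in> P ` {..j}"

definition revisit_sources :: "(nat \<Rightarrow> nat) \<Rightarrow> nat \<Rightarrow> nat set" where
  "revisit_sources P k = P ` {j. j < k \<and> revisit P j}"

lemma revisitI: "i \<le> j \<Longrightarrow> P (Suc j) = P i \<Longrightarrow> revisit P j"
  unfolding revisit_def by (metis atMost_iff imageI)

lemma card_revisits: "card (P ` {..k}) + card {j. j < k \<and> revisit P j} = k + 1"
proof (induction k)
  case (Suc k)
  have "P ` {..Suc k} = insert (P (Suc k)) (P ` {..k})" by (auto simp: atMost_Suc)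
  moreover have "{j. j < Suc k \<and> revisit P j} = (if revisit P k then insert k {j. j < k \<and> revisit P j} else {j. j < k \<and> revisit P j})"
    by (auto simp: less_Suc_eq)
  ultimately show ?case using Suc.IH by (auto simp: revisit_def insert_absorb)
qed simp

lemma revisits_Suc: "card {j. j < Suc k \<and> revisit P j} \<le> Suc (card {j. j < k \<and> revisit P j})"
proof -
  have "{j. j < Suc k \<and> revisit P j} \<subseteq> insert k {j. j < k \<and> revisit P j}" by (auto simp: less_Suc_eq)
  then have "card {j. j < Suc k \<and> revisit P j} \<le> card (insert k {j. j < k \<and> revisit P j})" by (intro card_mono) auto
  then show ?thesis by (simp add: card_insert_if split: if_splits)
qed

lemma revisits_reach:
  assumes "M \<le> card {j. j < k \<and> revisit P j}"
  shows "\<exists>k'\<le>k. card {j. j < k' \<and> revisit P j} = M"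
  using assms
proof (induction k)
  case 0 then show ?case by auto
next
  case (Suc k)
  show ?case
  proof (cases "M \<le> card {j. j < k \<and> revisit P j}")
    case True then show ?thesis using Suc.IH le_Suc_eq by auto
  next
    case False
    then have "card {j. j < Suc k \<and> revisit P j} = M" using revisits_Suc[of k P] Suc.prems by linarith
    then show ?thesis by auto
  qed
qed

lemma revisits_mono: "i \<le> k \<Longrightarrow> card {j. j < i \<and> revisit P j} \<le> card {j. j < k \<and> revisit P j}"
  by (intro card_mono) auto

lemma inj_on_no_revisit:
  assumes "\<And>j. j < k \<Longrightarrow> \<not> revisit P j"
  shows "inj_on P {..k}"
proof -
  have *: "P i \<noteq> P j" if "i < j" "j \<le> k" for i j
  proof
    assume "P i = P j"
    then have "revisit P (j - 1)" using that by (intro revisitI[of i]) auto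
    moreover have "j - 1 < k" using that by auto
    ultimately show False using assms by blast
  qed
  show ?thesis by (rule linorder_inj_onI) (use * in auto)
qed

section \<open>Vertex sets computed from the graph without one vertex\<close>

definition other_unvisited :: "nat set set \<Rightarrow> nat \<Rightarrow> (nat \<Rightarrow> int) \<Rightarrow> nat \<Rightarrow> nat \<Rightarrow> nat set" where
  "other_unvisited H n w0 j y = {0..<n} - crawl_pos H n w0 ` {..<j} - {y}"

text \<open>Weights are read at index \<open>j - 1\<close>, the last one before the crawl stands on
  \<open>y\<close>. A positive weight of at most \<theta> means a last visit at an index below
  \<theta>. Excluding \<open>y\<close> gives the form that \<open>prob_avoids_le\<close>
  requires.\<close>

definition old_vertices :: "nat set set \<Rightarrow> nat \<Rightarrow> (nat \<Rightarrow> int) \<Rightarrow> (nat \<Rightarrow> nat option) \<Rightarrow> nat \<Rightarrow> nat \<Rightarrow> nat \<Rightarrow> nat set" where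
  "old_vertices H n w0 ov \<theta> j y = {v \<in> {0..<n}. v \<noteq> y \<and> 0 < wt H n w0 ov (j - 1) v \<and> wt H n w0 ov (j - 1) v \<le> int \<theta>}"

text \<open>Stopping at the first index with \<open>M\<close> sources makes the set a function of
  \<open>H\<close> alone, with no reference to the time at which \<open>u\<close> is missed in
  \<open>G\<close>; removing \<open>u\<close> keeps it off the deleted vertex for every
  \<open>H\<close>.\<close>

definition first_revisit_sources :: "nat set set \<Rightarrow> nat \<Rightarrow> (nat \<Rightarrow> int) \<Rightarrow> nat \<Rightarrow> nat \<Rightarrow> nat set" where
  "first_revisit_sources H n w0 M u =
    (if \<exists>k. M \<le> card (revisit_sources (crawl_pos H n w0) k)
     then revisit_sources (crawl_pos H n w0) (LEAST k. M \<le> card (revisit_sources (crawl_pos H n w0) k)) - {u} else {})"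

text \<open>Forcing the crawl on G - y through y at time i and on to z imitates a crawl on G that has visited
  y once, yet stays independent of the edges at y.\<close>
definition detours :: "nat \<Rightarrow> nat \<Rightarrow> nat \<Rightarrow> (nat \<Rightarrow> nat option) set" where
  "detours n K y = insert Map.empty ((\<lambda>(i, z). [i \<mapsto> y, Suc i \<mapsto> z]) ` ({..K} \<times> {0..<n}))"

definition avoids :: "nat set set \<Rightarrow> nat \<Rightarrow> nat \<Rightarrow> nat \<Rightarrow> nat set \<Rightarrow> bool" where
  "avoids G n y N X \<longleftrightarrow> N \<le> card X \<and> neighbours G n y \<inter> X = {}"

context crawl begin

text \<open>Unvisited vertices have negative weights and win against all visited ones, so a move to
  a visited vertex shows that no neighbour was left unvisited.\<close>

lemma revisit_no_unvisited:
  assumes "revisit ps j" shows "neighbours G n (ps j) \<subseteq> ps ` {..j}"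
proof
  fix x assume x: "x \<in> neighbours G n (ps j)"
  have "0 < crawl_wt G n w0 j (ps (Suc j))"
    using assms wt_pos_iff[OF weighting ps_lt, of G Map.empty j "Suc j"] by (simp add: revisit_def)
  also have "\<dots> \<le> crawl_wt G n w0 j x" by (rule wt_ps_Suc_le[OF x])
  finally show "x \<in> ps ` {..j}" using wt_pos_iff[OF weighting neighbours_lt[OF x]] by blast
qed

lemma crawl_del_unvisited:
  assumes "\<And>i. i \<le> k \<Longrightarrow> ps i \<noteq> y" "i \<le> k"
  shows "run (del_vertex G y) n w0 Map.empty i = run G n w0 Map.empty i"
  using assms by (intro run_del_vertex weighting) auto

text \<open>The hypotheses speak of crawls on graphs with a vertex deleted; the work is to show that
  these agree with the crawl on \<open>G\<close> for as long as needed. The order matters: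
  \<open>early\<close> confines visits before index \<theta> to one per vertex, which lets a single
  detour suffice in \<open>old\<close>, and \<open>old\<close> makes the sources in
  \<open>last\<close> distinct.\<close>

theorem covered_by:
  assumes early: "\<And>y j. y < n \<Longrightarrow> j < \<theta> \<Longrightarrow> \<not> avoids G n y (n - \<theta>) (other_unvisited (del_vertex G y) n w0 j y)"
    and old: "\<And>y j ov. y < n \<Longrightarrow> j \<le> n + M \<Longrightarrow> ov \<in> detours n (n + M) y \<Longrightarrow>
        \<not> avoids G n y N (old_vertices (del_vertex G y) n w0 ov \<theta> j y)"
    and last: "\<And>u. u < n \<Longrightarrow> \<not> avoids G n u M (first_revisit_sources (del_vertex G u) n w0 M u)"
    and size: "M + N + 1 \<le> \<theta>" "\<theta> \<le> n"
  shows "{0..<n} \<subseteq> ps ` {..n + M}"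
proof (rule ccontr)
  assume "\<not> ?thesis"
  then obtain u where u: "u < n" "u \<notin> ps ` {..n + M}" by (meson atLeastLessThan_iff subsetI)
  have fresh: "\<not> revisit ps j" if "j < \<theta>" for j
    using that
  proof (induction j rule: less_induct)
    case (less j)
    show ?case
    proof
      assume rev: "revisit ps j"
      define y where "y = ps j"
      have inj: "inj_on ps {..j}" using less by (intro inj_on_no_revisit) auto
      have ne: "ps i \<noteq> y" if "i < j" for i 
        using inj_onD[OF inj, of i j] that unfolding y_def by auto
      \<comment> \<open>No earlier revisit means that \<open>y\<close> is reached at index
        \<open>j\<close> for the first time, so before that its deletion goes unnoticed.\<close>
      have "crawl_pos (del_vertex G y) n w0 i = ps i" if "i < j" for i
      proof -
        have "run (del_vertex G y) n w0 Map.empty i = run G n w0 Map.empty i"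
          by (rule crawl_del_unvisited[of i]) (use ne that in auto)
        then show ?thesis by (simp add: pos_def)
      qed
      then have "crawl_pos (del_vertex G y) n w0 ` {..<j} = ps ` {..<j}" by (intro image_cong) auto
      then have eq: "other_unvisited (del_vertex G y) n w0 j y = {0..<n} - ps ` {..<j} - {y}"
        by (simp add: other_unvisited_def)
      have "neighbours G n y \<inter> ({0..<n} - ps ` {..<j} - {y}) = {}"
      proof -
        have "{..j} = insert j {..<j}" by auto
        then show ?thesis using revisit_no_unvisited[OF rev] by (auto simp: y_def)
      qed
      moreover have "n - \<theta> \<le> card ({0..<n} - ps ` {..<j} - {y})"
      proof -
        have "card (insert y (ps ` {..<j})) \<le> Suc j"
          using card_image_le[of "{..<j}" ps] by (simp add: card_insert_if)
        moreover have "card {0..<n} - card (insert y (ps ` {..<j})) \<le> card ({0..<n} - insert y (ps ` {..<j}))"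
          by (intro diff_card_le_card_Diff) auto
        moreover have "{0..<n} - insert y (ps ` {..<j}) = {0..<n} - ps ` {..<j} - {y}" by auto
        ultimately show ?thesis using less.prems by simp
      qed
      ultimately have "avoids G n y (n - \<theta>) (other_unvisited (del_vertex G y) n w0 j y)"
        unfolding avoids_def eq by simp
      moreover have "y < n" by (simp add: y_def ps_lt)
      ultimately show False using early[OF _ less.prems] by blast
    qed
  qed
  have inj_\<theta>: "inj_on ps {..\<theta>}" by (rule inj_on_no_revisit) (rule fresh)
  have into_old: "crawl_wt G n w0 j (ps (Suc j)) \<le> int \<theta>"
    if "revisit ps j" "j \<le> n + M" "card {i. i < j \<and> revisit ps i} \<le> M" for j
    using that
  proof (induction j rule: less_induct)
    case (less j)
    have j\<theta>: "\<theta> \<le> j" using fresh less.prems(1) by (meson not_less)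
    then have j0: "0 < j" using size by simp
    define y where "y = ps j"
    have y: "y < n" by (simp add: y_def ps_lt)
    obtain ov where ov: "ov \<in> detours n (n + M) y" "run (del_vertex G y) n w0 ov (j - 1) = run G n w0 Map.empty (j - 1)"
    proof (cases "y \<in> ps ` {..j - 1}")
      case False
      then have "run (del_vertex G y) n w0 Map.empty (j - 1) = run G n w0 Map.empty (j - 1)"
        by (intro crawl_del_unvisited[of "j - 1"]) auto
      then show ?thesis using that[of Map.empty] by (simp add: detours_def)
    next
      case True
      from wt_visited[OF this] obtain i0 where i0: "i0 \<le> j - 1" "ps i0 = y" "crawl_wt G n w0 (j - 1) y = int i0 + 1"
        and i0_last: "\<forall>i. i0 < i \<and> i \<le> j - 1 \<longrightarrow> ps i \<noteq> y" by blast
      \<comment> \<open>The crawl came to \<open>y\<close> by a revisit, which by induction led to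
        an old vertex. So the only earlier visit to \<open>y\<close> is at an index
        \<open>i0\<close> below \<theta>, and one detour reproduces the run.\<close>
      have "revisit ps (j - 1)" using True j0 by (simp add: revisit_def y_def)
      then have "crawl_wt G n w0 (j - 1) (ps (Suc (j - 1))) \<le> int \<theta>"
        using less.prems j0 revisits_mono[of "j - 1" j ps] by (intro less.IH) auto
      then have i0\<theta>: "i0 < \<theta>" using i0 j0 by (simp add: y_def)
      have only: "i = i0" if "ps i = y" "i \<le> j - 1" for i
      proof (cases "i0 < i")
        case True then show ?thesis using that i0_last by blast
      next
        case False then show ?thesis using inj_onD[OF inj_\<theta>, of i i0] that i0 i0\<theta> by auto
      qed
      let ?ov = "[i0 \<mapsto> y, Suc i0 \<mapsto> ps (Suc i0)]"
      have "run (del_vertex G y) n w0 ?ov (j - 1) = run G n w0 Map.empty (j - 1)"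
      proof (rule run_del_vertex[OF weighting])
        fix i assume i: "i \<le> j - 1" "ps i = y"
        then have "i = i0" using only by blast
        then show "?ov i = Some y" by simp
      next
        fix i assume i: "i < j - 1" "ps i = y"
        then have "i = i0" using only[OF i(2)] by simp
        then show "?ov (Suc i) = Some (ps (Suc i))" by simp
      next
        fix i show "?ov i = None \<or> ?ov i = Some (ps i)" using i0(2) by simp
      qed
      moreover have "?ov \<in> detours n (n + M) y"
      proof -
        have "(i0, ps (Suc i0)) \<in> {..n + M} \<times> {0..<n}" using i0(1) less.prems(2) ps_lt by simp
        from imageI[OF this, of "\<lambda>(i, z). [i \<mapsto> y, Suc i \<mapsto> z]"] show ?thesis unfolding detours_def by simp
      qed
      ultimately show ?thesis using that by blast
    qed
    define O' where "O' = {v \<in> {0..<n}. v \<noteq> y \<and> 0 < crawl_wt G n w0 (j - 1) v \<and> crawl_wt G n w0 (j - 1) v \<le> int \<theta>}"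
    have O': "old_vertices (del_vertex G y) n w0 ov \<theta> j y = O'"
      proof -
      have "wt (del_vertex G y) n w0 ov (j - 1) = crawl_wt G n w0 (j - 1)" unfolding wt_def ov(2) ..
      then show ?thesis by (simp add: old_vertices_def O'_def)
    qed
    \<comment> \<open>Among the first \<theta> positions a vertex ceases to be old only as the
      target of a revisit, and there are at most \<open>M\<close> of these so far; together with
      \<open>y\<close> this explains \<open>M + N + 1 \<le> \<theta>\<close>.\<close>
    let ?R = "(\<lambda>i. ps (Suc i)) ` {i. i < j \<and> revisit ps i}"
    have "ps ` {..<\<theta>} - insert y ?R \<subseteq> O'"
    proof
      fix v assume v: "v \<in> ps ` {..<\<theta>} - insert y ?R"
      then obtain i where i: "i < \<theta>" "ps i = v" by auto
      then have vis: "v \<in> ps ` {..j - 1}" using j\<theta> by auto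
      from wt_visited[OF vis] obtain l where l: "l \<le> j - 1" "ps l = v" "crawl_wt G n w0 (j - 1) v = int l + 1" by blast
      have "l < \<theta>"
      proof (rule ccontr)
        assume "\<not> l < \<theta>"
        then have "revisit ps (l - 1)" using i l by (intro revisitI[of i]) auto
        then have "v \<in> ?R" using l i \<open>\<not> l < \<theta>\<close> j0 by (intro image_eqI[of _ _ "l - 1"]) auto
        then show False using v by auto
      qed
      then show "v \<in> O'" using l v i ps_lt[of i] by (auto simp: O'_def)
    qed
    then have "card (ps ` {..<\<theta>} - insert y ?R) \<le> card O'" by (intro card_mono) (auto simp: O'_def)
    moreover have "card (ps ` {..<\<theta>}) - card (insert y ?R) \<le> card (ps ` {..<\<theta>} - insert y ?R)"
      by (intro diff_card_le_card_Diff) auto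
    moreover have "card (ps ` {..<\<theta>}) = \<theta>"
      using inj_\<theta> by (subst card_image) (auto simp: inj_on_def)
    moreover have "card (insert y ?R) \<le> Suc M"
      using card_image_le[of "{i. i < j \<and> revisit ps i}" "\<lambda>i. ps (Suc i)"] less.prems(3)
      by (simp add: card_insert_if)
    ultimately have "N \<le> card O'" using size by linarith
    then have "neighbours G n y \<inter> O' \<noteq> {}"
      using old[OF y less.prems(2) ov(1)] by (auto simp: avoids_def O')
    then obtain v where v: "v \<in> neighbours G n y" "v \<in> O'" by blast
    have "crawl_wt G n w0 j (ps (Suc j)) \<le> crawl_wt G n w0 j v"
      using v(1) unfolding y_def by (rule wt_ps_Suc_le)
    also have "\<dots> = crawl_wt G n w0 (j - 1) v"
      using wt_Suc[of G n w0 Map.empty "j - 1"] j0 v(2) by (simp add: O'_def y_def)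
    also have "\<dots> \<le> int \<theta>" using v(2) by (simp add: O'_def)
    finally show ?case .
  qed
  \<comment> \<open>There are \<open>n + M + 1\<close> indices but at most \<open>n - 1\<close>
    values. Cutting at exactly \<open>M\<close> revisits keeps every revisit before the cut within
    the range of \<open>into_old\<close>.\<close>
  have "card (ps ` {..n + M}) \<le> card ({0..<n} - {u})"
    using u ps_lt by (intro card_mono) auto
  then have "M \<le> card {j. j < n + M \<and> revisit ps j}"
    using card_revisits[of ps "n + M"] u by simp
  from revisits_reach[OF this] obtain k where k: "k \<le> n + M" "card {j. j < k \<and> revisit ps j} = M" by blast
  have "inj_on ps {j. j < k \<and> revisit ps j}"
  proof (rule linorder_inj_onI)
    fix j j' assume "j < j'" and j: "j \<in> {j. j < k \<and> revisit ps j}" "j' \<in> {j. j < k \<and> revisit ps j}"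
    show "ps j \<noteq> ps j'"
    proof
      assume eq: "ps j = ps j'"
      \<comment> \<open>A second departure from the same vertex needs a return to it. By
        \<open>into_old\<close> the return leads to a vertex last seen before index \<theta>, but
        this one was visited at \<open>j \<ge> \<theta>\<close>.\<close>
      have "revisit ps (j' - 1)" by (rule revisitI[of j]) (use eq \<open>j < j'\<close> in auto)
      then have "crawl_wt G n w0 (j' - 1) (ps (Suc (j' - 1))) \<le> int \<theta>"
      proof (rule into_old)
        show "j' - 1 \<le> n + M" using j(2) k(1) by auto
        show "card {i. i < j' - 1 \<and> revisit ps i} \<le> M" using revisits_mono[of "j' - 1" k ps] j(2) k(2) by auto
      qed
      moreover have "int j + 1 \<le> crawl_wt G n w0 (j' - 1) (ps j)" using \<open>j < j'\<close> by (intro wt_visited_ge) auto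
      moreover have "\<theta> \<le> j" using fresh[of j] j(1) by force
      moreover have "Suc (j' - 1) = j'" using \<open>j < j'\<close> by simp
      ultimately show False unfolding eq by simp
    qed
  qed auto
  then have card_src: "card (revisit_sources ps k) = M" unfolding revisit_sources_def using k(2) by (simp add: card_image)
  let ?H = "del_vertex G u"
  have pos_eq: "crawl_pos ?H n w0 i = ps i" if "i \<le> n + M" for i
  proof -
    have "run ?H n w0 Map.empty i = run G n w0 Map.empty i"
    proof (rule crawl_del_unvisited[of "n + M"])
      show "ps i \<noteq> u" if "i \<le> n + M" for i using u(2) that by blast
    qed (rule that)
    then show ?thesis by (simp add: pos_def)
  qed
  have src_eq: "revisit_sources (crawl_pos ?H n w0) i = revisit_sources ps i" if "i \<le> k" for i
  proof -
    have "revisit (crawl_pos ?H n w0) j \<longleftrightarrow> revisit ps j" if "j < i" for j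
    proof -
      have "crawl_pos ?H n w0 ` {..j} = ps ` {..j}" using that \<open>i \<le> k\<close> k by (intro image_cong pos_eq) auto
      then show ?thesis using that \<open>i \<le> k\<close> k pos_eq[of "Suc j"] by (simp add: revisit_def)
    qed
    then show ?thesis unfolding revisit_sources_def using \<open>i \<le> k\<close> k
      by (intro image_cong) (auto simp: pos_eq)
  qed
  define k' where "k' = (LEAST k. M \<le> card (revisit_sources (crawl_pos ?H n w0) k))"
  have ex: "M \<le> card (revisit_sources (crawl_pos ?H n w0) k)" by (simp add: src_eq card_src)
  have k': "k' \<le> k" "M \<le> card (revisit_sources (crawl_pos ?H n w0) k')"
    using Least_le[where P="\<lambda>k. M \<le> card (revisit_sources (crawl_pos ?H n w0) k)", OF ex]
      LeastI[where P="\<lambda>k. M \<le> card (revisit_sources (crawl_pos ?H n w0) k)", OF ex]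
    unfolding k'_def by blast+
  have "u \<notin> revisit_sources ps k'" using u k' k by (auto simp: revisit_sources_def)
  then have src: "first_revisit_sources ?H n w0 M u = revisit_sources ps k'"
    unfolding first_revisit_sources_def k'_def[symmetric] using ex src_eq[OF k'(1)] by auto
  have "neighbours G n u \<inter> revisit_sources ps k' = {}"
  proof (rule ccontr)
    assume "neighbours G n u \<inter> revisit_sources ps k' \<noteq> {}"
    then obtain j where j: "j < k'" "revisit ps j" "ps j \<in> neighbours G n u" by (auto simp: revisit_sources_def)
    then have "u \<in> ps ` {..j}" using revisit_no_unvisited neighbours_sym[OF u(1)] by blast
    then show False using u j k' k by auto
  qed
  then show False using last[OF u(1)] k'(2) src_eq[OF k'(1)] by (simp add: avoids_def src)
qed

end

section \<open>Vertices visited last\<close>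

text \<open>Without isolated vertices, a late index is followed by a revisit or by a move into
  \<open>W\<close>. Disregarding \<open>W\<close> makes the notion insensitive to the deletion of a
  vertex of \<open>W\<close>.\<close>

definition late :: "nat set set \<Rightarrow> nat \<Rightarrow> (nat \<Rightarrow> int) \<Rightarrow> nat set \<Rightarrow> nat \<Rightarrow> bool" where
  "late K n w0 W j \<longleftrightarrow> neighbours K n (crawl_pos K n w0 j) - W \<subseteq> crawl_pos K n w0 ` {..j}"

fun late_vertices :: "nat set set \<Rightarrow> nat \<Rightarrow> (nat \<Rightarrow> int) \<Rightarrow> nat set \<Rightarrow> nat \<Rightarrow> nat \<Rightarrow> nat set" where
  "late_vertices K n w0 W M 0 = {}"
| "late_vertices K n w0 W M (Suc k) =
    (if card (late_vertices K n w0 W M k) < M \<and> late K n w0 W k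
     then insert (crawl_pos K n w0 k) (late_vertices K n w0 W M k) else late_vertices K n w0 W M k)"

text \<open>Padding gives the set of late vertices size exactly M, so that the probability
  of avoiding it does not depend on the graph.\<close>
definition padded_late_vertices :: "nat set set \<Rightarrow> nat \<Rightarrow> (nat \<Rightarrow> int) \<Rightarrow> nat set \<Rightarrow> nat \<Rightarrow> nat \<Rightarrow> nat set" where
  "padded_late_vertices K n w0 W M N =
    (let A = late_vertices K n w0 W M N
     in if card A = M then A else (SOME Z. A \<subseteq> Z \<and> Z \<subseteq> A \<union> ({0..<n} - W) \<and> card Z = M))"

lemma late_vertices_subset: "late_vertices K n w0 W M k \<subseteq> crawl_pos K n w0 ` {j. j < k \<and> late K n w0 W j}"
  by (induction k) (auto simp: less_Suc_eq)

lemma finite_late_vertices [simp]: "finite (late_vertices K n w0 W M k)"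
  by (induction k) auto

lemma late_vertices_mono: "i \<le> k \<Longrightarrow> late_vertices K n w0 W M i \<subseteq> late_vertices K n w0 W M k"
  by (rule lift_Suc_mono_le[of "late_vertices K n w0 W M"]) auto

lemma card_late_vertices_le: "card (late_vertices K n w0 W M k) \<le> M"
  by (induction k) (auto simp: card_insert_if)

lemma padded_late_vertices:
  assumes "M \<le> card ({0..<n} - W)"
  shows "card (padded_late_vertices K n w0 W M N) = M"
    and "late_vertices K n w0 W M N \<subseteq> padded_late_vertices K n w0 W M N"
    and "padded_late_vertices K n w0 W M N \<subseteq> late_vertices K n w0 W M N \<union> ({0..<n} - W)"
proof -
  let ?A = "late_vertices K n w0 W M N"
  have "\<exists>Z. ?A \<subseteq> Z \<and> Z \<subseteq> ?A \<union> ({0..<n} - W) \<and> card Z = M"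
  proof -
    have "M \<le> card (?A \<union> ({0..<n} - W))"
      using assms by (rule order_trans) (intro card_mono, auto)
    then show ?thesis
      using exists_subset_between[of ?A M "?A \<union> ({0..<n} - W)"] card_late_vertices_le by auto
  qed
  from someI_ex[OF this]
  show "card (padded_late_vertices K n w0 W M N) = M"
    "?A \<subseteq> padded_late_vertices K n w0 W M N"
    "padded_late_vertices K n w0 W M N \<subseteq> ?A \<union> ({0..<n} - W)"
    by (auto simp: padded_late_vertices_def Let_def)
qed

text \<open>The graph \<open>{}\<close> is a placeholder, as the starting vertex depends on
  \<open>w0\<close> only.\<close>

definition late_in_order :: "nat \<Rightarrow> (nat \<Rightarrow> int) \<Rightarrow> nat set \<Rightarrow> bool" where
  "late_in_order n w0 W \<longleftrightarrow> W \<subseteq> {0..<n} \<and> crawl_pos {} n w0 0 \<notin> W \<and> (\<forall>x\<in>{0..<n} - W. \<forall>u\<in>W. w0 x < w0 u)"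

lemma crawl_pos_0: "crawl_pos K n w0 0 = crawl_pos {} n w0 0"
  by (simp add: pos_0)

lemma del_vertex_isolated: "y \<notin> neighbours (del_vertex K y) n v"
  by (simp add: neighbours_def del_vertex_def)

lemma neighbours_del_subset: "neighbours (del_vertex K y) n v \<subseteq> neighbours K n v"
  by (auto simp: neighbours_def del_vertex_def)

lemma crawl_avoids:
  assumes "\<And>v. y \<notin> neighbours K n v" "crawl_pos K n w0 0 \<noteq> y"
  shows "crawl_pos K n w0 k \<noteq> y"
proof (induction k)
  case (Suc k)
  then show ?case using crawl_step_adj[of K n w0 k] assms(1) by metis
qed (use assms in auto)

text \<open>From a vertex that is not late, some unvisited neighbour outside \<open>W\<close>
  precedes \<open>u\<close> in the initial order; a vertex that is late has been collected and is by
  \<open>avoid\<close> not adjacent to \<open>u\<close>. So the crawl does not enter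
  \<open>u\<close> before \<open>M\<close> late vertices are found, and until then the deletion of
  \<open>u\<close> has no effect. Both alternatives of \<open>avoid\<close> work, since the two late
  sets agree along the induction; survival can be tested on either graph.\<close>

lemma late_run_del_vertex:
  assumes wg: "weighting n w0" and n: "0 < n" and W: "late_in_order n w0 W" and u: "u \<in> W"
    and M: "M \<le> card ({0..<n} - W)"
    and avoid: "neighbours K n u \<inter> padded_late_vertices K n w0 W M N = {} \<or>
       neighbours K n u \<inter> padded_late_vertices (del_vertex K u) n w0 W M N = {}"
  shows "k \<le> N \<Longrightarrow> late_vertices K n w0 W M k = late_vertices (del_vertex K u) n w0 W M k \<and>
    (card (late_vertices K n w0 W M k) = M \<or>
     (run (del_vertex K u) n w0 Map.empty k = run K n w0 Map.empty k \<and> u \<notin> crawl_pos K n w0 ` {..k}))"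
proof (induction k)
  case 0
  then show ?case using W u crawl_pos_0[of K n w0] by (auto simp: late_in_order_def pos_0)
next
  case (Suc k)
  let ?K = "del_vertex K u"
  have un: "u < n" using W u by (auto simp: late_in_order_def)
  show ?case
  proof (cases "card (late_vertices K n w0 W M k) = M")
    case True
    then show ?thesis using Suc by auto
  next
    case False
    then have small: "card (late_vertices K n w0 W M k) < M" using card_late_vertices_le le_neq_implies_less by blast
    have IH: "late_vertices K n w0 W M k = late_vertices ?K n w0 W M k"
       "run ?K n w0 Map.empty k = run K n w0 Map.empty k" "u \<notin> crawl_pos K n w0 ` {..k}"
      using Suc False by auto
    define v where "v = crawl_pos K n w0 k"
    have vu: "v \<noteq> u" using IH(3) by (auto simp: v_def)
    have vn: "v < n" unfolding v_def by (rule crawl_pos_in[OF wg n])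
    have posk: "crawl_pos ?K n w0 k = v" using IH(2) by (simp add: pos_def v_def)
    have wtk: "crawl_wt ?K n w0 k = crawl_wt K n w0 k" using IH(2) by (simp add: wt_def)
    have vis: "x \<in> crawl_pos ?K n w0 ` {..k} \<longleftrightarrow> x \<in> crawl_pos K n w0 ` {..k}" if "x < n" for x
      using wt_pos_iff[OF wg that, of ?K Map.empty k] wt_pos_iff[OF wg that, of K Map.empty k] by (simp add: wtk)
    have late_iff: "late ?K n w0 W k \<longleftrightarrow> late K n w0 W k"
    proof -
      have "neighbours ?K n v - W = neighbours K n v - W"
        using u by (auto simp: neighbours_del_vertex[OF vu])
      then show ?thesis unfolding late_def posk v_def[symmetric] using vis neighbours_lt by blast
    qed
    have step: "step_vertex K n (crawl_wt K n w0 k) v \<noteq> u \<and>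
        step_vertex ?K n (crawl_wt K n w0 k) v = step_vertex K n (crawl_wt K n w0 k) v"
    proof -
      have "step_vertex K n (crawl_wt K n w0 k) v \<noteq> u"
      proof (cases "late K n w0 W k")
        case True
        have "v \<in> late_vertices K n w0 W M (Suc k)" "v \<in> late_vertices ?K n w0 W M (Suc k)"
          using True small late_iff IH(1) posk by (auto simp: v_def)
        then have "v \<in> late_vertices K n w0 W M N" "v \<in> late_vertices ?K n w0 W M N"
          using Suc.prems late_vertices_mono[of "Suc k" N] by (meson subsetD)+
        then have "v \<notin> neighbours K n u"
          using avoid padded_late_vertices(2)[OF M, of K w0 N] padded_late_vertices(2)[OF M, of ?K w0 N] by blast
        then have "u \<notin> neighbours K n v" using neighbours_sym[OF vn] by blast
        then show ?thesis using vu next_vertex_is_arg_min[of K n v "crawl_wt K n w0 k"]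
          by (auto simp: step_vertex_def)
      next
        case False
        then obtain x where x: "x \<in> neighbours K n v" "x \<notin> W" "x \<notin> crawl_pos K n w0 ` {..k}"
          by (auto simp: late_def v_def)
        have "w0 x < w0 u" using W u x neighbours_lt[OF x(1)] by (auto simp: late_in_order_def)
        then have "crawl_wt K n w0 k x < crawl_wt K n w0 k u" using x(3) IH(3) by (simp add: wt_unvisited)
        moreover have "crawl_wt K n w0 k (step_vertex K n (crawl_wt K n w0 k) v) \<le> crawl_wt K n w0 k x"
          using next_vertex_is_arg_min[of K n v "crawl_wt K n w0 k"] x(1) by (auto simp: step_vertex_def)
        ultimately show ?thesis by force
      qed
      then show ?thesis using step_vertex_del_vertex[OF wt_inj[OF wg] vu] by blast
    qed
    have "crawl_pos K n w0 (Suc k) = step_vertex K n (crawl_wt K n w0 k) v" by (simp add: pos_Suc v_def)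
    moreover have "crawl_pos ?K n w0 (Suc k) = step_vertex ?K n (crawl_wt K n w0 k) v"
      by (simp add: pos_Suc posk wtk)
    ultimately have p: "crawl_pos ?K n w0 (Suc k) = crawl_pos K n w0 (Suc k)" "crawl_pos K n w0 (Suc k) \<noteq> u"
      using step by auto
    have "run ?K n w0 Map.empty (Suc k) = run K n w0 Map.empty (Suc k)"
    proof (rule prod_eqI)
      show "snd (run ?K n w0 Map.empty (Suc k)) = snd (run K n w0 Map.empty (Suc k))"
        using p(1) by (simp only: pos_def)
      show "fst (run ?K n w0 Map.empty (Suc k)) = fst (run K n w0 Map.empty (Suc k))"
        using p(1) wtk wt_Suc[of ?K n w0 Map.empty k] wt_Suc[of K n w0 Map.empty k] by (simp only: wt_def)
    qed
    moreover have "u \<notin> crawl_pos K n w0 ` {..Suc k}" using IH(3) p(2) by (auto simp: atMost_Suc)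
    moreover have "late_vertices K n w0 W M (Suc k) = late_vertices ?K n w0 W M (Suc k)"
      using IH(1) late_iff posk by (simp add: v_def)
    ultimately show ?thesis by blast
  qed
qed

text \<open>The padding depends on the graph only through its late vertices, so equal late sets are
  padded equally.\<close>

lemma padded_late_vertices_del:
  assumes "weighting n w0" "0 < n" "late_in_order n w0 W" "u \<in> W" "M \<le> card ({0..<n} - W)"
    and "neighbours K n u \<inter> padded_late_vertices K n w0 W M N = {} \<or>
       neighbours K n u \<inter> padded_late_vertices (del_vertex K u) n w0 W M N = {}"
  shows "padded_late_vertices K n w0 W M N = padded_late_vertices (del_vertex K u) n w0 W M N"
  using late_run_del_vertex[OF assms, of N] by (simp add: padded_late_vertices_def)

definition survives :: "nat \<Rightarrow> (nat \<Rightarrow> int) \<Rightarrow> nat set \<Rightarrow> nat \<Rightarrow> nat \<Rightarrow> nat \<Rightarrow> nat set set \<Rightarrow> bool" where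
  "survives n w0 W M N u G \<longleftrightarrow> neighbours G n u \<inter> padded_late_vertices (del_vertex G u) n w0 W M N = {}"

lemma del_vertex_commute: "del_vertex (del_vertex G u) v = del_vertex (del_vertex G v) u"
  by (auto simp: del_vertex_def)

text \<open>Survival of \<open>u\<close> refers to \<open>G - u\<close>, which still contains edges
  at \<open>v\<close>. Three applications of the invariance under deletion replace both sets by that
  of \<open>G - u - v\<close>, which is independent of all edges at \<open>u\<close> and at
  \<open>v\<close>.\<close>

lemma survives_pair:
  assumes A: "weighting n w0" "0 < n" "late_in_order n w0 W" and u: "u \<in> W" "v \<in> W"
    and M: "M \<le> card ({0..<n} - W)" and S: "survives n w0 W M N u G" "survives n w0 W M N v G"
  shows "neighbours G n u \<inter> padded_late_vertices (del_vertex (del_vertex G u) v) n w0 W M N = {}"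
    and "neighbours G n v \<inter> padded_late_vertices (del_vertex (del_vertex G u) v) n w0 W M N = {}"
proof -
  let ?Y = "\<lambda>K. padded_late_vertices K n w0 W M N"
  have 1: "?Y G = ?Y (del_vertex G u)" using S(1) by (intro padded_late_vertices_del A u M) (simp add: survives_def)
  have 2: "?Y G = ?Y (del_vertex G v)" using S(2) by (intro padded_late_vertices_del A u M) (simp add: survives_def)
  have "neighbours (del_vertex G u) n v \<inter> ?Y (del_vertex G u) = {}"
    using S(2) 1 2 neighbours_del_subset by (fastforce simp: survives_def)
  then have 3: "?Y (del_vertex G u) = ?Y (del_vertex (del_vertex G u) v)"
    by (intro padded_late_vertices_del A u M) simp
  show "neighbours G n u \<inter> ?Y (del_vertex (del_vertex G u) v) = {}"
    "neighbours G n v \<inter> ?Y (del_vertex (del_vertex G u) v) = {}"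
    using S 1 2 3 by (simp_all add: survives_def)
qed

text \<open>Vertices of \<open>R\<close> are nobody's neighbours and not the start, so they are
  never visited; the padding avoids them because it is taken outside \<open>W\<close>.\<close>

lemma padded_late_vertices_subset:
  assumes "weighting n w0" "0 < n" "late_in_order n w0 W" "M \<le> card ({0..<n} - W)" "R \<subseteq> W"
    and "\<And>u v. u \<in> R \<Longrightarrow> u \<notin> neighbours K n v"
  shows "padded_late_vertices K n w0 W M N \<subseteq> {0..<n} - R"
proof -
  have "crawl_pos K n w0 k \<notin> R" for k
  proof
    assume r: "crawl_pos K n w0 k \<in> R"
    then have "crawl_pos K n w0 0 \<noteq> crawl_pos K n w0 k"
      using assms(3,5) crawl_pos_0[of K n w0] by (auto simp: late_in_order_def)
    with r show False using crawl_avoids[of "crawl_pos K n w0 k" K n w0 k] assms(6) by blast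
  qed
  then show ?thesis
    using padded_late_vertices(3)[OF assms(4), of K w0 N] late_vertices_subset[of K n w0 W M N]
      crawl_pos_in[OF assms(1,2), of K] assms(5) by fastforce
qed

text \<open>Each late index is followed by a revisit or by a first visit in \<open>W\<close>, and
  the latter happens at most \<open>card W\<close> times. When all vertices are visited by index
  \<open>k\<close>, \<open>k + 1\<close> is \<open>n\<close> plus the number of revisits.\<close>

theorem (in crawl) survives_imp_slow:
  assumes W: "late_in_order n w0 W" "u \<in> W" "M \<le> card ({0..<n} - W)"
    and S: "survives n w0 W M N u G" and cov: "{0..<n} \<subseteq> ps ` {..k}" "k \<le> N"
  shows "n + M \<le> k + 1 + card W"
proof -
  have un: "u < n" and WV: "W \<subseteq> {0..<n}" using W by (auto simp: late_in_order_def)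
  \<comment> \<open>By index \<open>k\<close> also \<open>u\<close> has been visited, which excludes
    the second alternative of \<open>late_run_del_vertex\<close>.\<close>
  have "card (late_vertices G n w0 W M k) = M"
    using late_run_del_vertex[OF weighting n_pos W, of G N k] S cov un by (auto simp: survives_def)
  then have "M \<le> card (ps ` {j. j < k \<and> late G n w0 W j})"
    using card_mono[OF _ late_vertices_subset[of G n w0 W M k]] by auto
  also have "\<dots> \<le> card {j. j < k \<and> late G n w0 W j}" by (intro card_image_le) auto
  also have "\<dots> \<le> card ({j. j < k \<and> revisit ps j} \<union> {j. j < k \<and> \<not> revisit ps j \<and> ps (Suc j) \<in> W})"
  proof (intro card_mono subsetI)
    fix j assume j: "j \<in> {j. j < k \<and> late G n w0 W j}"
    then have "ps (Suc j) \<in> W \<or> ps (Suc j) \<in> ps ` {..j}" using ps_Suc_in[of j] by (auto simp: late_def)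
    then show "j \<in> {j. j < k \<and> revisit ps j} \<union> {j. j < k \<and> \<not> revisit ps j \<and> ps (Suc j) \<in> W}"
      using j by (auto simp: revisit_def)
  qed auto
  also have "\<dots> \<le> card {j. j < k \<and> revisit ps j} + card {j. j < k \<and> \<not> revisit ps j \<and> ps (Suc j) \<in> W}"
    by (rule card_Un_le)
  also have "card {j. j < k \<and> \<not> revisit ps j \<and> ps (Suc j) \<in> W} \<le> card W"
  proof (rule card_inj_on_le[of "\<lambda>j. ps (Suc j)"])
    show "inj_on (\<lambda>j. ps (Suc j)) {j. j < k \<and> \<not> revisit ps j \<and> ps (Suc j) \<in> W}"
    proof (rule linorder_inj_onI)
      fix i j assume "i < j" "i \<in> {j. j < k \<and> \<not> revisit ps j \<and> ps (Suc j) \<in> W}"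
        "j \<in> {j. j < k \<and> \<not> revisit ps j \<and> ps (Suc j) \<in> W}"
      moreover have "ps (Suc i) \<in> ps ` {..j}" using \<open>i < j\<close> by (intro imageI) auto
      ultimately show "ps (Suc i) \<noteq> ps (Suc j)" unfolding revisit_def by (metis (no_types, lifting) mem_Collect_eq)
    qed auto
    show "finite W" using WV finite_subset by blast
  qed auto
  finally have "M \<le> card {j. j < k \<and> revisit ps j} + card W" by simp
  moreover have "ps ` {..k} = {0..<n}" using cov ps_lt by auto
  then have "n + card {j. j < k \<and> revisit ps j} = k + 1" using card_revisits[of ps k] by simp
  ultimately show ?thesis by simp
qed

section \<open>Probability estimates\<close>

abbreviation random_graph :: "nat \<Rightarrow> real \<Rightarrow> nat set set pmf" where
  "random_graph n p \<equiv> rsub (all_pairs n) p"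

lemma prob_mono_on:
  assumes "\<And>x. x \<in> set_pmf M \<Longrightarrow> x \<in> A \<Longrightarrow> x \<in> B"
  shows "measure_pmf.prob M A \<le> measure_pmf.prob M B"
  using assms by (intro measure_pmf.finite_measure_mono_AE) (auto simp: AE_measure_pmf_iff)

lemma prob_eq_on:
  assumes "\<And>x. x \<in> set_pmf M \<Longrightarrow> x \<in> A \<longleftrightarrow> x \<in> B"
  shows "measure_pmf.prob M A = measure_pmf.prob M B"
  using prob_mono_on[of M A B] prob_mono_on[of M B A] assms by auto

lemma prob_Ex_le:
  assumes "finite I" "\<And>i. i \<in> I \<Longrightarrow> measure_pmf.prob M {x. P i x} \<le> c"
  shows "measure_pmf.prob M {x. \<exists>i\<in>I. P i x} \<le> real (card I) * c"
proof -
  have "{x. \<exists>i\<in>I. P i x} = (\<Union>i\<in>I. {x. P i x})" by auto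
  then have "measure_pmf.prob M {x. \<exists>i\<in>I. P i x} \<le> (\<Sum>i\<in>I. measure_pmf.prob M {x. P i x})"
    using assms(1) by (simp add: measure_pmf.finite_measure_subadditive_finite)
  also have "\<dots> \<le> (\<Sum>i\<in>I. c)" using assms(2) by (intro sum_mono)
  finally show ?thesis by simp
qed

lemma random_graph_subset: "G \<in> set_pmf (random_graph n p) \<Longrightarrow> G \<subseteq> all_pairs n"
  using set_rsub by blast

lemma del_vertex_eq_Int: "G \<subseteq> all_pairs n \<Longrightarrow> del_vertex G y = G \<inter> {e \<in> all_pairs n. y \<notin> e}"
  by (auto simp: del_vertex_def)

lemma pair_image_Int:
  assumes "X \<subseteq> {0..<n}"
  shows "G \<inter> (\<lambda>x. {y, x}) ` X = {} \<longleftrightarrow> neighbours G n y \<inter> X = {}"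
proof -
  have "x \<in> neighbours G n y \<longleftrightarrow> {y, x} \<in> G" if "x \<in> X" for x
    using assms that by (auto simp: neighbours_def)
  then show ?thesis by blast
qed

lemma card_pair_image: "card ((\<lambda>x. {y, x}) ` X) = card X"
  by (intro card_image) (auto simp: inj_on_def doubleton_eq_iff)

text \<open>Deleting a vertex y makes the set X a function of the edges not meeting y, which is
  independent of the edges at y.\<close>
lemma prob_avoids_le:
  assumes "0 \<le> p" "p \<le> 1" "y < n" "\<And>H. X H \<subseteq> {0..<n} - {y}"
  shows "measure_pmf.prob (random_graph n p) {G. avoids G n y M (X (del_vertex G y))} \<le> (1 - p) ^ M"
proof -
  let ?A = "{e \<in> all_pairs n. y \<notin> e}" and ?T = "\<lambda>H. (\<lambda>x. {y, x}) ` X H"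
  have "measure_pmf.prob (random_graph n p) {G. avoids G n y M (X (del_vertex G y))} \<le>
      measure_pmf.prob (random_graph n p) {G. M \<le> card (?T (G \<inter> ?A)) \<and> G \<inter> ?T (G \<inter> ?A) = {}}"
  proof (rule prob_mono_on)
    fix G assume "G \<in> set_pmf (random_graph n p)" and G: "G \<in> {G. avoids G n y M (X (del_vertex G y))}"
    then have "del_vertex G y = G \<inter> ?A" by (intro del_vertex_eq_Int random_graph_subset)
    moreover have "X (del_vertex G y) \<subseteq> {0..<n}" using assms(4) by blast
    ultimately show "G \<in> {G. M \<le> card (?T (G \<inter> ?A)) \<and> G \<inter> ?T (G \<inter> ?A) = {}}"
      using G pair_image_Int[of "X (del_vertex G y)" n G y] by (simp add: avoids_def card_pair_image)
  qed
  also have "\<dots> \<le> (1 - p) ^ M"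
  proof (rule prob_rsub_avoid_adaptive_le)
    show "?T H \<subseteq> all_pairs n - ?A" for H
      using assms(3) assms(4)[of H] by (auto simp: all_pairs_iff)
  qed (use assms in auto)
  finally show ?thesis .
qed

lemma prob_avoid_eq:
  assumes "0 \<le> p" "p \<le> 1" "y < n" "\<And>H. X (del_vertex H y) \<subseteq> {0..<n} - {y}" "\<And>H. card (X H) = M"
  shows "measure_pmf.prob (random_graph n p) {G. neighbours G n y \<inter> X (del_vertex G y) = {}} = (1 - p) ^ M"
proof -
  let ?A = "{e \<in> all_pairs n. y \<notin> e}" and ?T = "\<lambda>H. (\<lambda>x. {y, x}) ` X H"
  have "measure_pmf.prob (random_graph n p) {G. neighbours G n y \<inter> X (del_vertex G y) = {}} =
      measure_pmf.prob (random_graph n p) {G. G \<inter> ?T (G \<inter> ?A) = {}}"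
  proof (rule prob_eq_on)
    fix G assume "G \<in> set_pmf (random_graph n p)"
    then have "del_vertex G y = G \<inter> ?A" by (intro del_vertex_eq_Int random_graph_subset)
    moreover have "X (del_vertex G y) \<subseteq> {0..<n}" using assms(4) by blast
    ultimately show "G \<in> {G. neighbours G n y \<inter> X (del_vertex G y) = {}} \<longleftrightarrow> G \<in> {G. G \<inter> ?T (G \<inter> ?A) = {}}"
      using pair_image_Int[of "X (del_vertex G y)" n G y] by simp
  qed
  also have "\<dots> = (1 - p) ^ M"
  proof (rule prob_rsub_avoid_adaptive_eq)
    fix H assume "H \<subseteq> ?A"
    then have "H = del_vertex H y" by (auto simp: del_vertex_def)
    then show "?T H \<subseteq> all_pairs n - ?A"
      using assms(3) assms(4)[of H] by (auto simp: all_pairs_iff)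
  qed (use assms in \<open>auto simp: card_pair_image\<close>)
  finally show ?thesis .
qed

text \<open>Pairs from \<open>u\<close> and pairs from \<open>v\<close> into a set that contains
  neither are distinct, so \<open>M + M\<close> independent edges must be absent.\<close>

lemma prob_avoid_two_le:
  assumes "0 \<le> p" "p \<le> 1" "u < n" "v < n" "u \<noteq> v"
    "\<And>H. X (del_vertex (del_vertex H u) v) \<subseteq> {0..<n} - {u, v}" "\<And>H. card (X H) = M"
  shows "measure_pmf.prob (random_graph n p) {G. neighbours G n u \<inter> X (del_vertex (del_vertex G u) v) = {} \<and>
     neighbours G n v \<inter> X (del_vertex (del_vertex G u) v) = {}} \<le> (1 - p) ^ (M + M)"
proof -
  let ?A = "{e \<in> all_pairs n. u \<notin> e \<and> v \<notin> e}"
    and ?T = "\<lambda>H. (\<lambda>x. {u, x}) ` X H \<union> (\<lambda>x. {v, x}) ` X H"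
  have fix_A: "H = del_vertex (del_vertex H u) v" if "H \<subseteq> ?A" for H using that by (auto simp: del_vertex_def)
  have XH: "X H \<subseteq> {0..<n} - {u, v}" if "H \<subseteq> ?A" for H using assms(6)[of H] fix_A[OF that] by simp
  have "measure_pmf.prob (random_graph n p) {G. neighbours G n u \<inter> X (del_vertex (del_vertex G u) v) = {} \<and>
     neighbours G n v \<inter> X (del_vertex (del_vertex G u) v) = {}} \<le>
      measure_pmf.prob (random_graph n p) {G. G \<inter> ?T (G \<inter> ?A) = {}}"
  proof (rule prob_mono_on)
    fix G assume G: "G \<in> set_pmf (random_graph n p)"
      "G \<in> {G. neighbours G n u \<inter> X (del_vertex (del_vertex G u) v) = {} \<and>
     neighbours G n v \<inter> X (del_vertex (del_vertex G u) v) = {}}"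
    have "del_vertex (del_vertex G u) v = G \<inter> ?A" using random_graph_subset[OF G(1)] by (auto simp: del_vertex_def)
    moreover have "X (G \<inter> ?A) \<subseteq> {0..<n}" using XH[of "G \<inter> ?A"] by auto
    ultimately show "G \<in> {G. G \<inter> ?T (G \<inter> ?A) = {}}"
      using G(2) pair_image_Int[of "X (G \<inter> ?A)" n G u] pair_image_Int[of "X (G \<inter> ?A)" n G v]
      by (simp add: Int_Un_distrib)
  qed
  also have "\<dots> = (1 - p) ^ (M + M)"
  proof (rule prob_rsub_avoid_adaptive_eq)
    fix H assume H: "H \<subseteq> ?A"
    show "?T H \<subseteq> all_pairs n - ?A"
      using assms(3,4) XH[OF H] by (auto simp: all_pairs_iff)
    have "card (?T H) = card ((\<lambda>x. {u, x}) ` X H) + card ((\<lambda>x. {v, x}) ` X H)"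
    proof (rule card_Un_disjoint)
      show "(\<lambda>x. {u, x}) ` X H \<inter> (\<lambda>x. {v, x}) ` X H = {}"
        using XH[OF H] assms(5) by (auto simp: doubleton_eq_iff)
    qed (use XH[OF H] finite_subset[of "X H"] in auto)
    then show "card (?T H) = M + M" by (simp add: card_pair_image assms(7))
  qed (use assms in auto)
  finally show ?thesis by simp
qed

text \<open>Chebyshev's inequality for the number of \<open>u\<close> with \<open>S u\<close>: off
  the diagonal the pairs contribute at most \<open>q ^ 2\<close>, so the variance is at most
  \<open>m * q\<close>, to be divided by the squared mean.\<close>

lemma prob_none_le_second_moment:
  fixes S :: "'b \<Rightarrow> 'a \<Rightarrow> bool" and q :: real
  assumes "finite (set_pmf M)" "finite W" "W \<noteq> {}" "0 < q"
    and "\<And>u. u \<in> W \<Longrightarrow> measure_pmf.prob M {x. S u x} = q"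
    and "\<And>u v. u \<in> W \<Longrightarrow> v \<in> W \<Longrightarrow> u \<noteq> v \<Longrightarrow> measure_pmf.prob M {x. S u x \<and> S v x} \<le> q ^ 2"
  shows "measure_pmf.prob M {x. \<forall>u\<in>W. \<not> S u x} \<le> 1 / (real (card W) * q)"
proof -
  define m where "m = real (card W)"
  have m: "0 < m" using assms by (simp add: m_def card_gt_0_iff)
  define X where "X x = (\<Sum>u\<in>W. indicator {x. S u x} x :: real)" for x
  note int = integrable_measure_pmf_finite[OF assms(1)]
  have EX: "measure_pmf.expectation M X = m * q"
    unfolding X_def using assms(5) by (subst Bochner_Integration.integral_sum) (auto intro: int simp: m_def)
  have X2: "X x ^ 2 = (\<Sum>u\<in>W. \<Sum>v\<in>W. indicator {x. S u x \<and> S v x} x)" for x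
    unfolding X_def power2_eq_square sum_product by (intro sum.cong refl) (auto simp: indicator_def)
  have "measure_pmf.expectation M (\<lambda>x. X x ^ 2) = (\<Sum>u\<in>W. \<Sum>v\<in>W. measure_pmf.prob M {x. S u x \<and> S v x})"
    unfolding X2 by (subst Bochner_Integration.integral_sum; (subst Bochner_Integration.integral_sum)?) (auto intro: int)
  also have "\<dots> \<le> (\<Sum>u\<in>W. \<Sum>v\<in>W. q ^ 2 + (if u = v then q else 0))"
    using assms(4,5,6) by (intro sum_mono) auto
  also have "\<dots> = m * (m * q ^ 2 + q)"
    using assms(2) by (simp add: sum.distrib m_def)
  finally have EX2: "measure_pmf.expectation M (\<lambda>x. X x ^ 2) \<le> m * (m * q ^ 2 + q)" .
  let ?f = "\<lambda>x. (X x - m * q) ^ 2 / (m * q) ^ 2"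
  have "measure_pmf.prob M {x. \<forall>u\<in>W. \<not> S u x} \<le> measure_pmf.expectation M ?f"
  proof (rule prob_le_expectation[OF assms(1)])
    fix x assume "x \<in> {x. \<forall>u\<in>W. \<not> S u x}"
    then have "X x = 0" by (simp add: X_def)
    then show "1 \<le> ?f x" using m assms(4) by simp
  qed simp
  also have "measure_pmf.expectation M ?f = measure_pmf.expectation M (\<lambda>x. (X x ^ 2 - 2 * (m * q) * X x + (m * q) ^ 2) / (m * q) ^ 2)"
    by (simp add: power2_diff algebra_simps)
  also have "\<dots> = (measure_pmf.expectation M (\<lambda>x. X x ^ 2) - 2 * (m * q) * measure_pmf.expectation M X + (m * q) ^ 2) / (m * q) ^ 2"
    by (simp add: int)
  also have "\<dots> \<le> (m * (m * q ^ 2 + q) - 2 * (m * q) * (m * q) + (m * q) ^ 2) / (m * q) ^ 2"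
    unfolding EX using EX2 by (intro divide_right_mono) auto
  also have "\<dots> = 1 / (m * q)"
    using m assms(4) by (simp add: field_simps power2_eq_square)
  finally show ?thesis by (simp add: m_def)
qed

section \<open>Degrees, edges inside small sets, edges between large sets\<close>

lemma card_neighbours_eq:
  assumes "G \<subseteq> all_pairs n" "v < n"
  shows "card (neighbours G n v) = card (G \<inter> (\<lambda>u. {v, u}) ` ({0..<n} - {v}))"
proof -
  have "v \<notin> neighbours G n v"
    using assms(1) all_pairs_iff[of v v n] by (auto simp: neighbours_def)
  then have "G \<inter> (\<lambda>u. {v, u}) ` ({0..<n} - {v}) = (\<lambda>u. {v, u}) ` neighbours G n v"
    by (auto simp: neighbours_def)
  then show ?thesis by (simp add: card_pair_image)
qed

lemma one_plus_power_le_exp: "- 1 \<le> y \<Longrightarrow> (1 + y) ^ k \<le> exp (y * real k)" for y :: real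
  using power_mono[OF exp_ge_add_one_self[of y], of k] by (simp add: exp_of_nat_mult[symmetric] mult.commute)

lemma two_power_le_exp: "(2::real) ^ k \<le> exp (real k)"
  using one_plus_power_le_exp[of 1 k] by simp

lemma exp_le_two_power: "exp (real k / 2) \<le> (2::real) ^ k"
proof -
  have "exp (1::real) \<le> 2 ^ 2" using e_less_272 by simp
  then have "exp (1/2::real) ^ 2 \<le> 2 ^ 2" by (simp add: exp_of_nat_mult[symmetric])
  then have "exp (1/2::real) \<le> 2" by (rule power2_le_imp_le) simp
  then have "exp (1/2::real) ^ k \<le> 2 ^ k" by (rule power_mono) simp
  then show ?thesis by (simp add: exp_of_nat_mult[symmetric])
qed

lemma prob_degree_bounds:
  assumes p: "0 \<le> p" "p \<le> 1" and n: "0 < n" and x: "x = real n * p" and D: "4 * x \<le> real D"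
  shows "measure_pmf.prob (random_graph n p) {G. \<not> degree_bounds G n (x / 4) D} \<le> real n * (2 * exp (1 - x / 4))"
proof -
  have "measure_pmf.prob (random_graph n p) {G. \<not> degree_bounds G n (x / 4) D}
    \<le> measure_pmf.prob (random_graph n p) {G. \<exists>v\<in>{0..<n}. real (card (neighbours G n v)) < x / 4 \<or> D < card (neighbours G n v)}"
    by (intro prob_mono_on) (auto simp: degree_bounds_def not_le)
  also have "\<dots> \<le> real (card {0..<n}) * (2 * exp (1 - x / 4))"
  proof (rule prob_Ex_le)
    fix v assume v: "v \<in> {0..<n}"
    let ?T = "(\<lambda>u. {v, u}) ` ({0..<n} - {v})"
    let ?M = "random_graph n p"
    have T: "card ?T = n - 1" using v by (simp add: card_pair_image)
    have TF: "?T \<subseteq> all_pairs n" using v by (auto simp: all_pairs_iff)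
    define k where "k = nat \<lfloor>x / 4\<rfloor>"
    have x0: "0 \<le> x" using x p by simp
    have k: "real k \<le> x / 4" unfolding k_def using x0 by (intro of_nat_floor) simp
    have "measure_pmf.prob ?M {G. real (card (neighbours G n v)) < x / 4 \<or> D < card (neighbours G n v)} \<le>
       measure_pmf.prob ?M ({G. card (G \<inter> ?T) \<le> k} \<union> {G. D \<le> card (G \<inter> ?T)})"
    proof (rule prob_mono_on)
      fix G assume G: "G \<in> set_pmf ?M" "G \<in> {G. real (card (neighbours G n v)) < x / 4 \<or> D < card (neighbours G n v)}"
      have "card (neighbours G n v) = card (G \<inter> ?T)"
        using v by (intro card_neighbours_eq random_graph_subset[OF G(1)]) auto
      moreover have "card (G \<inter> ?T) \<le> k" if "real (card (G \<inter> ?T)) < x / 4"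
        unfolding k_def using that by (simp add: le_nat_floor)
      ultimately show "G \<in> {G. card (G \<inter> ?T) \<le> k} \<union> {G. D \<le> card (G \<inter> ?T)}" using G(2) by auto
    qed
    also have "\<dots> \<le> measure_pmf.prob ?M {G. card (G \<inter> ?T) \<le> k} + measure_pmf.prob ?M {G. D \<le> card (G \<inter> ?T)}"
      by (rule measure_Un_le) auto
    also have "measure_pmf.prob ?M {G. card (G \<inter> ?T) \<le> k} \<le> exp (1 - x / 4)"
    proof -
      \<comment> \<open>Tilting by \<open>1/2\<close> gives the exponent
        \<open>- x / 2 + p / 2 + k\<close> with \<open>k \<le> x / 4\<close> and
        \<open>p / 2 \<le> 1\<close>.\<close>
      have "measure_pmf.prob ?M {G. card (G \<inter> ?T) \<le> k} \<le> (1 - p + p * (1/2)) ^ card ?T / (1/2) ^ k"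
        by (rule prob_rsub_markov_lower) (use p TF in auto)
      also have "\<dots> = (1 + (- p / 2)) ^ (n - 1) * 2 ^ k"
        unfolding T by (simp add: power_divide field_simps)
      also have "\<dots> \<le> exp (- p / 2 * real (n - 1)) * exp (real k)"
        by (intro mult_mono one_plus_power_le_exp two_power_le_exp) (use p in auto)
      also have "\<dots> = exp (- x / 2 + p / 2 + real k)"
      proof -
        have "- p / 2 * real (n - 1) + real k = - x / 2 + p / 2 + real k"
          using n by (simp add: x of_nat_diff field_simps)
        then show ?thesis by (simp add: exp_add[symmetric])
      qed
      also have "\<dots> \<le> exp (1 - x / 4)" using k p by simp
      finally show ?thesis .
    qed
    also have "measure_pmf.prob ?M {G. D \<le> card (G \<inter> ?T)} \<le> exp (1 - x / 4)"
    proof -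
      \<comment> \<open>Tilting by 2 gives \<open>exp x / 2 ^ D\<close>, and
        \<open>D \<ge> 4 * x\<close> makes the denominator at least
        \<open>exp (2 * x)\<close>.\<close>
      have "measure_pmf.prob ?M {G. D \<le> card (G \<inter> ?T)} \<le> (1 - p + p * 2) ^ card ?T / 2 ^ D"
        by (rule prob_rsub_markov_upper) (use p TF in auto)
      also have "\<dots> = (1 + p) ^ (n - 1) / 2 ^ D" unfolding T by (simp add: add.commute)
      also have "\<dots> \<le> exp (p * real (n - 1)) / exp (real D / 2)"
        by (intro frac_le one_plus_power_le_exp exp_le_two_power) (use p in auto)
      also have "\<dots> \<le> exp x / exp (2 * x)"
      proof (rule frac_le)
        show "exp (p * real (n - 1)) \<le> exp x"
          unfolding x using p by (simp add: mult.commute mult_left_mono)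
        show "exp (2 * x) \<le> exp (real D / 2)" using D by simp
      qed auto
      also have "\<dots> = exp (- x)" by (simp add: exp_diff[symmetric])
      also have "\<dots> \<le> exp (1 - x / 4)" using x0 by simp
      finally show ?thesis .
    qed
    finally show "measure_pmf.prob ?M {G. real (card (neighbours G n v)) < x / 4 \<or> D < card (neighbours G n v)} \<le> 2 * exp (1 - x / 4)"
      by simp
  qed simp
  finally show ?thesis by simp
qed

text \<open>A single term of the binomial expansion of \<open>(1 + y) ^ n\<close> at
  \<open>y = k / n\<close> is at most the whole sum, which is at most \<open>exp k\<close>.\<close>

lemma binomial_le_exp:
  assumes "1 \<le> k" "1 \<le> n"
  shows "real (n choose k) \<le> (exp 1 * real n / real k) ^ k"
proof (cases "k \<le> n")
  case True
  define y where "y = real k / real n"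
  have y: "0 < y" using assms by (simp add: y_def)
  have "real (n choose k) * y ^ k = (\<Sum>i\<in>{k}. real (n choose i) * y ^ i)" by simp
  also have "\<dots> \<le> (\<Sum>i\<le>n. real (n choose i) * y ^ i)"
    using True y by (intro sum_mono2) auto
  also have "\<dots> = (1 + y) ^ n" using binomial_ring[of y 1 n] by (simp add: add.commute)
  also have "\<dots> \<le> exp (y * real n)" using y by (intro one_plus_power_le_exp) auto
  also have "\<dots> = exp 1 ^ k" using assms by (simp add: y_def exp_of_nat_mult[symmetric])
  finally have "real (n choose k) \<le> exp 1 ^ k / y ^ k" using y by (simp add: field_simps)
  then show ?thesis by (simp add: y_def power_divide[symmetric])
qed (auto simp: binomial_eq_0)

lemma finite_card_subsets: "finite {B. B \<subseteq> {0..<n::nat} \<and> card B = k}"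
  by (rule finite_subset[of _ "Pow {0..<n}"]) auto

text \<open>In the union bound each vertex of a \<open>k\<close>-set costs
  \<open>exp 1 * n / k\<close>, which is \<open>n * p\<close> times
  \<open>exp 1 * (\<mu> / m)\<close> for \<open>\<mu> = m / (p * k)\<close>. One factor
  \<open>1 / \<mu>\<close> pays for \<mu>, the others give \<open>exp (- 1)\<close> each because
  \<open>5 \<ge> exp (3/2)\<close>, and \<open>13 \<ge> exp (5/2)\<close> absorbs the remaining
  constant.\<close>

lemma large_exponent_absorbs:
  fixes \<mu> :: real
  assumes "5 \<le> \<mu>" "13 \<le> m"
  shows "exp 1 * (\<mu> / real m) * (exp (1/2) / \<mu>) ^ m \<le> exp (- real m)"
proof -
  obtain k where k: "m = Suc k" using assms(2) by (cases m) auto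
  have e32: "exp (3/2) \<le> (5::real)"
  proof (rule power2_le_imp_le)
    have "exp (3/2::real) ^ 2 = exp 1 ^ 3" by (simp add: exp_of_nat_mult[symmetric])
    also have "\<dots> \<le> 2.72 ^ 3" using e_less_272 by (intro power_mono) auto
    also have "\<dots> \<le> (5::real) ^ 2" by (simp add: power_divide)
    finally show "exp (3/2::real) ^ 2 \<le> 5 ^ 2" .
  qed simp
  have "exp (1/2) / \<mu> \<le> exp (1/2) / exp (3/2)"
    using assms e32 by (intro divide_left_mono) auto
  also have "\<dots> = exp (- 1)" by (simp add: exp_diff[symmetric])
  finally have *: "exp (1/2) / \<mu> \<le> exp (- 1)" .
  have e52: "exp (5/2) \<le> (13::real)"
  proof (rule power2_le_imp_le)
    have "exp (5/2::real) ^ 2 = exp 1 ^ 5" by (simp add: exp_of_nat_mult[symmetric])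
    also have "\<dots> \<le> 2.72 ^ 5" using e_less_272 by (intro power_mono) auto
    also have "\<dots> \<le> (13::real) ^ 2" by (simp add: power_divide)
    finally show "exp (5/2::real) ^ 2 \<le> 13 ^ 2" .
  qed simp
  have "exp 1 * (\<mu> / real m) * (exp (1/2) / \<mu>) ^ m = exp 1 * exp (1/2) / real m * (exp (1/2) / \<mu>) ^ k"
    using assms by (simp add: k)
  also have "\<dots> \<le> exp 1 * exp (1/2) / real m * exp (- 1) ^ k"
    using * assms by (intro mult_left_mono power_mono) auto
  also have "\<dots> = (exp (5/2) / real m) * exp (- real m)"
    by (simp add: k exp_of_nat_mult[symmetric] exp_add[symmetric] field_simps)
  also have "\<dots> \<le> 1 * exp (- real m)"
    using e52 assms by (intro mult_right_mono) auto
  finally show ?thesis by simp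
qed

lemma prob_not_sparse_size:
  assumes p: "0 < p" "p \<le> 1" and k: "1 \<le> k" and n: "1 \<le> n" and m: "13 \<le> m"
    and small: "5 * (p * real k) \<le> real m"
  shows "measure_pmf.prob (random_graph n p)
      {G. \<exists>B\<in>{B. B \<subseteq> {0..<n} \<and> card B = k}. m * card B < card {e \<in> G. e \<subseteq> B}}
    \<le> (real n * p * exp (- real m)) ^ k"
proof -
  \<comment> \<open>The tilt: \<open>m * k\<close> edges are \<open>2 * \<mu>\<close> times the
    upper bound \<open>p * k ^ 2 / 2\<close> for the mean, and tilting by \<mu> turns the exponent
    into \<open>m * k / 2\<close>.\<close>
  define \<mu> where "\<mu> = real m / (p * real k)"
  have pk: "0 < p * real k" using p k by simp
  have \<mu>: "5 \<le> \<mu>" using small pk by (simp add: \<mu>_def field_simps)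
  let ?c = "((exp (1/2) / \<mu>) ^ m) ^ k"
  have "measure_pmf.prob (random_graph n p) {G. m * card B < card {e \<in> G. e \<subseteq> B}} \<le> ?c"
    if B: "B \<in> {B. B \<subseteq> {0..<n} \<and> card B = k}" for B
  proof -
    let ?T = "{e \<in> all_pairs n. e \<subseteq> B}"
    have "measure_pmf.prob (random_graph n p) {G. m * card B < card {e \<in> G. e \<subseteq> B}} \<le>
       measure_pmf.prob (random_graph n p) {G. m * k \<le> card (G \<inter> ?T)}"
    proof (rule prob_mono_on)
      fix G assume G: "G \<in> set_pmf (random_graph n p)" "G \<in> {G. m * card B < card {e \<in> G. e \<subseteq> B}}"
      have "{e \<in> G. e \<subseteq> B} = G \<inter> ?T" using random_graph_subset[OF G(1)] by auto
      then show "G \<in> {G. m * k \<le> card (G \<inter> ?T)}" using G(2) B by auto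
    qed
    also have "\<dots> \<le> (1 - p + p * \<mu>) ^ card ?T / \<mu> ^ (m * k)"
      by (rule prob_rsub_markov_upper) (use p \<mu> in auto)
    also have "\<dots> \<le> exp (real m * real k / 2) / \<mu> ^ (m * k)"
    proof (rule divide_right_mono)
      have "(1 - p + p * \<mu>) ^ card ?T \<le> (1 + p * \<mu>) ^ card ?T"
        using p \<mu> by (intro power_mono) auto
      also have "\<dots> \<le> exp (p * \<mu> * real (card ?T))"
        by (rule one_plus_power_le_exp) (use p \<mu> in \<open>auto intro: order_trans[of _ 0]\<close>)
      also have "\<dots> \<le> exp (p * \<mu> * (real k ^ 2 / 2))"
        using card_all_pairs_subset[of B n] B finite_subset[of B "{0..<n}"] p \<mu>
        by (subst exp_le_cancel_iff) (intro mult_left_mono, auto)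
      also have "p * \<mu> * (real k ^ 2 / 2) = real m * real k / 2"
        using p k by (simp add: \<mu>_def power2_eq_square)
      finally show "(1 - p + p * \<mu>) ^ card ?T \<le> exp (real m * real k / 2)" .
    qed (use \<mu> in auto)
    also have "\<dots> = ?c"
      by (simp add: power_divide power_mult[symmetric] exp_of_nat_mult[symmetric] mult_ac)
    finally show ?thesis .
  qed
  then have "measure_pmf.prob (random_graph n p)
      {G. \<exists>B\<in>{B. B \<subseteq> {0..<n} \<and> card B = k}. m * card B < card {e \<in> G. e \<subseteq> B}}
    \<le> real (card {B. B \<subseteq> {0..<n} \<and> card B = k}) * ?c"
    by (intro prob_Ex_le finite_card_subsets)
  also have "card {B. B \<subseteq> {0..<n} \<and> card B = k} = n choose k" using n_subsets[of "{0..<n}" k] by simp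
  also have "real (n choose k) * ?c \<le> (exp 1 * real n / real k) ^ k * ?c"
    using k n \<mu> by (intro mult_right_mono binomial_le_exp) auto
  also have "\<dots> = (real n * p * (exp 1 * (\<mu> / real m) * (exp (1/2) / \<mu>) ^ m)) ^ k"
    unfolding power_mult_distrib[symmetric] using p k m by (simp add: \<mu>_def mult_ac)
  also have "\<dots> \<le> (real n * p * exp (- real m)) ^ k"
    using p \<mu> m by (intro power_mono mult_left_mono large_exponent_absorbs) auto
  finally show ?thesis .
qed

text \<open>The choice \<open>m \<ge> 2 * ln x\<close> turns \<open>x * exp (- m)\<close> into at
  most \<open>1 / x\<close>, so that the sizes \<open>k\<close> contribute a geometric
  series.\<close>

lemma prob_not_locally_sparse:
  assumes p: "0 < p" "p \<le> 1" and n: "1 \<le> n" and m: "13 \<le> m" "2 * ln x \<le> real m"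
    and x: "x = real n * p" "2 \<le> x" and small: "5 * (p * real s) \<le> real m"
  shows "measure_pmf.prob (random_graph n p) {G. \<not> locally_sparse G n m s} \<le> 2 / x"
proof -
  let ?P = "\<lambda>k. {G. \<exists>B\<in>{B. B \<subseteq> {0..<n} \<and> card B = k}. m * card B < card {e \<in> G. e \<subseteq> B}}"
  have "measure_pmf.prob (random_graph n p) {G. \<not> locally_sparse G n m s} \<le>
      measure_pmf.prob (random_graph n p) (\<Union>k\<in>{1..s}. ?P k)"
  proof (rule prob_mono_on)
    fix G assume G: "G \<in> set_pmf (random_graph n p)" "G \<in> {G. \<not> locally_sparse G n m s}"
    then obtain B where B: "B \<subseteq> {0..<n}" "card B \<le> s" "m * card B < card {e \<in> G. e \<subseteq> B}"
      by (auto simp: locally_sparse_def not_le)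
    have "card B \<noteq> 0"
    proof
      assume "card B = 0"
      then have "B = {}" using B(1) finite_subset by fastforce
      moreover have "{} \<notin> G" using random_graph_subset[OF G(1)] by (auto simp: all_pairs_def)
      ultimately have "card {e \<in> G. e \<subseteq> B} = 0" by (simp add: card_eq_0_iff)
      then show False using B(3) by linarith
    qed
    then show "G \<in> (\<Union>k\<in>{1..s}. ?P k)" using B by (intro UN_I[of "card B"]) auto
  qed
  also have "\<dots> \<le> (\<Sum>k=1..s. measure_pmf.prob (random_graph n p) (?P k))"
    by (rule measure_pmf.finite_measure_subadditive_finite) auto
  also have "\<dots> \<le> (\<Sum>k=1..s. (1 / x) ^ k)"
  proof (rule sum_mono)
    fix k assume k: "k \<in> {1..s}"
    have "5 * (p * real k) \<le> 5 * (p * real s)" using k p by (intro mult_left_mono) auto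
    then have "5 * (p * real k) \<le> real m" using small by linarith
    then have "measure_pmf.prob (random_graph n p) (?P k) \<le> (real n * p * exp (- real m)) ^ k"
      using k by (intro prob_not_sparse_size p n m(1)) auto
    also have "\<dots> \<le> (1 / x) ^ k"
    proof (rule power_mono)
      have "exp (- real m) \<le> exp (- (2 * ln x))" using m by simp
      also have "\<dots> = 1 / (x * x)" using x(2) by (simp add: exp_minus exp_double power2_eq_square inverse_eq_divide)
      finally have "x * exp (- real m) \<le> x * (1 / (x * x))" using x(2) by (intro mult_left_mono) auto
      also have "\<dots> = 1 / x" using x(2) by simp
      finally show "real n * p * exp (- real m) \<le> 1 / x" unfolding x(1) .
    qed (use p in auto)
    finally show "measure_pmf.prob (random_graph n p) (?P k) \<le> (1 / x) ^ k" .
  qed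
  also have "\<dots> \<le> 2 / x"
  proof -
    have "(\<Sum>k<s. (1 / x) ^ k) \<le> (\<Sum>k<s. (1 / 2) ^ k)"
      using x(2) by (intro sum_mono power_mono) (auto simp: field_simps)
    also have "(\<Sum>k<s. (1 / 2 :: real) ^ k) \<le> 2"
    proof -
      have "(\<Sum>k<s. (1 / 2 :: real) ^ k) = 2 - 2 * (1 / 2) ^ s" by (induction s) auto
      then show ?thesis by simp
    qed
    finally have le: "(\<Sum>k<s. (1 / x) ^ k) \<le> 2" .
    have "(\<Sum>k=1..s. (1 / x) ^ k) = (1 / x) * (\<Sum>k<s. (1 / x) ^ k)"
      by (simp add: sum_distrib_left sum.atLeast1_atMost_eq)
    also have "\<dots> \<le> (1 / x) * 2" using le x(2) by (intro mult_left_mono) auto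
    finally show ?thesis by simp
  qed
  finally show ?thesis .
qed

text \<open>Sets of size exactly \<open>s\<close> suffice. There are at most \<open>x ^ s\<close> of
  them, as \<open>exp 1 \<le> p * s\<close>, while a disjoint pair spans no edge with probability at
  most \<open>x ^ s\<close> to the power -4.\<close>

lemma prob_not_large_sets_joined:
  assumes p: "0 < p" "p \<le> 1" and n: "1 \<le> n" and x: "x = real n * p" "3 \<le> x"
    and s: "1 \<le> s" "4 * ln x \<le> p * real s"
  shows "measure_pmf.prob (random_graph n p) {G. \<not> large_sets_joined G n s} \<le> 1 / x"
proof -
  let ?S = "{B. B \<subseteq> {0..<n} \<and> card B = s}"
  let ?M = "random_graph n p"
  let ?P = "\<lambda>AB G. fst AB \<inter> snd AB = {} \<and> G \<inter> (\<lambda>(a, b). {a, b}) ` (fst AB \<times> snd AB) = {}"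
  have lnx: "1 \<le> ln x"
  proof -
    have "exp 1 \<le> x" using e_less_272 x(2) by linarith
    then show ?thesis using x(2) by (subst ln_ge_iff) auto
  qed
  have "measure_pmf.prob ?M {G. \<not> large_sets_joined G n s} \<le> measure_pmf.prob ?M {G. \<exists>AB\<in>?S \<times> ?S. ?P AB G}"
  proof (rule prob_mono_on)
    fix G assume "G \<in> {G. \<not> large_sets_joined G n s}"
    then obtain A B where AB: "A \<subseteq> {0..<n}" "B \<subseteq> {0..<n}" "A \<inter> B = {}" "s \<le> card A" "s \<le> card B"
      "\<And>a b. a \<in> A \<Longrightarrow> b \<in> B \<Longrightarrow> {a, b} \<notin> G"
      by (auto simp: large_sets_joined_def)
    obtain A' where A': "A' \<subseteq> A" "card A' = s" using obtain_subset_with_card_n[OF AB(4)] by blast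
    obtain B' where B': "B' \<subseteq> B" "card B' = s" using obtain_subset_with_card_n[OF AB(5)] by blast
    have "(A', B') \<in> ?S \<times> ?S" using AB A' B' by auto
    moreover have "?P (A', B') G" using AB A'(1) B'(1) by fastforce
    ultimately show "G \<in> {G. \<exists>AB\<in>?S \<times> ?S. ?P AB G}" by blast
  qed
  also have "\<dots> \<le> real (card (?S \<times> ?S)) * (1 - p) ^ (s * s)"
  proof (rule prob_Ex_le)
    fix AB assume AB': "AB \<in> ?S \<times> ?S"
    obtain A B where AB: "AB = (A, B)" by (cases AB)
    have AB2: "A \<subseteq> {0..<n}" "B \<subseteq> {0..<n}" "card A = s" "card B = s" using AB' AB by auto
    show "measure_pmf.prob ?M {G. ?P AB G} \<le> (1 - p) ^ (s * s)"
    proof (cases "A \<inter> B = {}")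
      case True
      let ?T = "(\<lambda>(a, b). {a, b}) ` (A \<times> B)"
      have "card ?T = s * s"
        using True AB2 by (subst card_image) (auto simp: inj_on_def doubleton_eq_iff card_cartesian_product)
      moreover have "measure_pmf.prob ?M {K. K \<inter> ?T = {}} = (1 - p) ^ card ?T"
      proof (rule prob_rsub_avoid)
        show "?T \<subseteq> all_pairs n" using AB2(1,2) True unfolding subset_eq disjoint_iff by (auto simp: all_pairs_iff)
      qed (use p in auto)
      ultimately show ?thesis using True by (simp add: AB)
    next
      case False then show ?thesis using p by (simp add: AB)
    qed
  qed simp
  also have "card (?S \<times> ?S) = (n choose s) * (n choose s)"
    using n_subsets[of "{0..<n}" s] by (simp add: card_cartesian_product)
  also have "real ((n choose s) * (n choose s)) * (1 - p) ^ (s * s) \<le> (x ^ s * x ^ s) * (exp (- 4 * ln x)) ^ s"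
  proof (rule mult_mono)
    have "real (n choose s) \<le> (exp 1 * real n / real s) ^ s" using s n by (intro binomial_le_exp) auto
    also have "\<dots> \<le> x ^ s"
    proof (rule power_mono)
      have "exp 1 \<le> p * real s" using s lnx e_less_272 by linarith
      then have "real n * exp 1 \<le> real n * (p * real s)" by (intro mult_left_mono) auto
      then show "exp 1 * real n / real s \<le> x" using s x by (simp add: field_simps)
    qed simp
    finally have c: "real (n choose s) \<le> x ^ s" .
    then show "real ((n choose s) * (n choose s)) \<le> x ^ s * x ^ s"
      unfolding of_nat_mult using x by (intro mult_mono) auto
    have "(1 - p) ^ s \<le> exp (- p * real s)" using one_plus_power_le_exp[of "- p" s] p by simp
    also have "\<dots> \<le> exp (- 4 * ln x)" using s by simp
    finally show "(1 - p) ^ (s * s) \<le> exp (- 4 * ln x) ^ s"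
      unfolding power_mult using p by (intro power_mono) auto
  qed (use x p in auto)
  also have "\<dots> = (x * x * exp (- 4 * ln x)) ^ s" by (simp add: power_mult_distrib)
  also have "x * x * exp (- 4 * ln x) = 1 / (x * x)"
  proof -
    have "exp (- 4 * ln x) = exp (- ln x) ^ 4" by (simp add: exp_of_nat_mult[symmetric])
    also have "\<dots> = (1 / x) ^ 4" using x by (simp add: exp_minus inverse_eq_divide)
    finally show ?thesis using x by (simp add: power4_eq_xxxx)
  qed
  also have "(1 / (x * x)) ^ s \<le> (1 / (x * x)) ^ 1"
  proof (rule power_decreasing)
    have "1 * 1 \<le> x * x" using x(2) by (intro mult_mono) auto
    then show "1 / (x * x) \<le> 1" "0 \<le> 1 / (x * x)" by auto
  qed (rule s)
  also have "\<dots> \<le> 1 / x" using x by (simp add: field_simps)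
  finally show ?thesis .
qed

section \<open>Worst-case weightings\<close>

lemma finite_weightings: "finite (weightings n)"
proof (rule finite_subset)
  show "weightings n \<subseteq> {w. \<forall>x. (x \<in> {0..<n} \<longrightarrow> w x \<in> {- int n .. -1}) \<and> (x \<notin> {0..<n} \<longrightarrow> w x = 0)}"
    by (auto simp: weightings_def dest: bij_betwE)
  show "finite {w. \<forall>x. (x \<in> {0..<n} \<longrightarrow> w x \<in> {- int n .. -1}) \<and> (x \<notin> {0..<n} \<longrightarrow> w x = 0)}"
    by (rule finite_set_of_finite_funs) auto
qed

lemma weightings_nonempty: "weightings n \<noteq> {}"
proof -
  have "bij_betw (\<lambda>x. if x < n then int x - int n else 0) {0..<n} {- int n .. -1}"
    by (rule bij_betw_byWitness[where f' = "\<lambda>y. nat (y + int n)"]) auto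
  then have "(\<lambda>x. if x < n then int x - int n else 0) \<in> weightings n" by (auto simp: weightings_def)
  then show ?thesis by auto
qed

lemma RC_le:
  assumes "\<And>w. weighting n w \<Longrightarrow> real (rc G n w) \<le> c"
  shows "real (RC G n) \<le> c"
proof -
  have "RC G n \<in> (\<lambda>w. rc G n w) ` weightings n"
    unfolding RC_def using finite_weightings weightings_nonempty by (intro Max_in) auto
  then show ?thesis using assms by (auto simp: weightings_def)
qed

lemma (in crawl) rc_cases:
  assumes "\<And>u T. u < n \<Longrightarrow> u \<notin> ps ` {..<T} \<Longrightarrow> real T \<le> c" "0 \<le> c"
  shows "real (rc G n w0) \<le> c + 1"
proof (cases "\<exists>k. {0..<n} \<subseteq> ps ` {..k}")
  case False
  \<comment> \<open>Here \<open>rc\<close> takes its default value 0.\<close>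
  then show ?thesis using assms(2) by (simp add: rc_eq[OF weighting n_pos no_isolated])
next
  case True
  define k where "k = (LEAST k. {0..<n} \<subseteq> ps ` {..k})"
  have rc: "rc G n w0 = Suc k" using True by (simp add: rc_eq[OF weighting n_pos no_isolated] k_def)
  show ?thesis
  proof (cases k)
    case 0 then show ?thesis using assms(2) rc by simp
  next
    case (Suc j)
    have "\<not> {0..<n} \<subseteq> ps ` {..j}" using not_less_Least[of j "\<lambda>k. {0..<n} \<subseteq> ps ` {..k}"] Suc k_def by simp
    then obtain u where "u < n" "u \<notin> ps ` {..j}" by (meson atLeastLessThan_iff subsetI)
    then have "real k \<le> c" using assms(1)[of u k] Suc by (simp add: lessThan_Suc_atMost)
    then show ?thesis using rc by simp
  qed
qed

text \<open>What remains of \<open>cover_time_bound\<close> after division by \<open>n ^ 2\<close>;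
  the exponent \<open>2 * I\<close> arises because \<beta>^I bounds both the window length and the
  number of windows. The constant is \<open>20404 * 201 + 1\<close>, with
  \<open>20404 = 16 * 1275 + 4\<close> from the window length and \<open>201 = 8 * 25 + 1\<close>
  from the number of windows.\<close>

definition rc_factor :: "real \<Rightarrow> nat \<Rightarrow> real" where
  "rc_factor \<kappa> I = real (I + 1) * (4080 * \<kappa>) ^ (2 * I) * (4101205 * \<kappa> ^ 3)"

lemma cover_bound_arith:
  fixes \<kappa> :: real
  assumes l: "1 \<le> \<kappa>" and n: "1 \<le> n" and b: "1 \<le> \<beta>" "\<beta> \<le> 4080 * \<kappa>"
    and msD: "real m * real s * real D \<le> 1275 * \<kappa> ^ 2 * n" and sD: "real D * real s \<le> 25 * \<kappa> * n"
  shows "(real (I + 1) + 2 * n + 16 * real (I + 1) * real m * real s * real D * \<beta> ^ I + 1)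
     * (8 * real D * real s * \<beta> ^ I + 1) + 1 \<le> n ^ 2 * rc_factor \<kappa> I"
proof -
  define B where "B = (4080 * \<kappa>) ^ I"
  have B: "1 \<le> B" unfolding B_def by (rule one_le_power) (use l in simp)
  have bB: "\<beta> ^ I \<le> B" unfolding B_def by (rule power_mono) (use b in auto)
  define J where "J = real (I + 1)"
  have J: "1 \<le> J" by (simp add: J_def)
  have l2: "1 \<le> \<kappa> ^ 2" "1 \<le> \<kappa> ^ 3" using l by (auto intro: one_le_power)
  have JB: "1 \<le> J * B" using J B mult_mono[of 1 J 1 B] by simp
  have base: "1 * 1 \<le> n * (J * B)" using n JB by (intro mult_mono) auto
  have "1 \<le> n * (J * B * \<kappa> ^ 2)"
  proof -
    have "1 * (1 * 1) \<le> n * ((J * B) * \<kappa> ^ 2)" using n JB l2 by (intro mult_mono) auto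
    then show ?thesis by simp
  qed
  have f1: "J \<le> n * (J * B * \<kappa> ^ 2)"
  proof -
    have "1 * (J * 1 * 1) \<le> n * (J * B * \<kappa> ^ 2)" using n J B l2 by (intro mult_mono) auto
    then show ?thesis by simp
  qed
  have f2: "n \<le> n * (J * B * \<kappa> ^ 2)"
  proof -
    have "n * (1 * 1 * 1) \<le> n * (J * B * \<kappa> ^ 2)" using n J B l2 by (intro mult_mono) auto
    then show ?thesis by simp
  qed
  have f3: "16 * J * real m * real s * real D * \<beta> ^ I \<le> 20400 * (n * (J * B * \<kappa> ^ 2))"
  proof -
    have "16 * J * real m * real s * real D * \<beta> ^ I = 16 * J * (real m * real s * real D) * \<beta> ^ I" by (simp add: mult_ac)
    also have "\<dots> \<le> 16 * J * (1275 * \<kappa> ^ 2 * n) * B" 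
      by (rule mult_mono[OF mult_left_mono[OF msD] bB]) (use J b n in auto)
    finally show ?thesis by (simp add: mult_ac)
  qed
  have F1: "J + 2 * n + 16 * J * real m * real s * real D * \<beta> ^ I + 1 \<le> 20404 * (n * (J * B * \<kappa> ^ 2))"
    using f1 f2 f3 \<open>1 \<le> n * (J * B * \<kappa> ^ 2)\<close> by linarith
  have g1: "8 * real D * real s * \<beta> ^ I \<le> 200 * (n * (B * \<kappa>))"
  proof -
    have "8 * real D * real s * \<beta> ^ I = 8 * (real D * real s) * \<beta> ^ I" by (simp add: mult_ac)
    also have "\<dots> \<le> 8 * (25 * \<kappa> * n) * B" 
      by (rule mult_mono[OF mult_left_mono[OF sD] bB]) (use b l n in auto)
    finally show ?thesis by (simp add: mult_ac)
  qed
  have g2: "1 \<le> n * (B * \<kappa>)"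
  proof -
    have "1 * (1 * 1) \<le> n * (B * \<kappa>)" using n B l by (intro mult_mono) auto
    then show ?thesis by simp
  qed
  have G1: "8 * real D * real s * \<beta> ^ I + 1 \<le> 201 * (n * (B * \<kappa>))" using g1 g2 by linarith
  have "(J + 2 * n + 16 * J * real m * real s * real D * \<beta> ^ I + 1) * (8 * real D * real s * \<beta> ^ I + 1) \<le>
     (20404 * (n * (J * B * \<kappa> ^ 2))) * (201 * (n * (B * \<kappa>)))"
    using F1 G1 b n J B l by (intro mult_mono) auto
  also have "\<dots> = 4101204 * (n ^ 2 * (J * B ^ 2 * \<kappa> ^ 3))" by (simp add: power2_eq_square power3_eq_cube)
  finally have main: "(J + 2 * n + 16 * J * real m * real s * real D * \<beta> ^ I + 1) * (8 * real D * real s * \<beta> ^ I + 1)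
     \<le> 4101204 * (n ^ 2 * (J * B ^ 2 * \<kappa> ^ 3))" .
  have "1 * (1 * 1 * 1) \<le> n ^ 2 * (J * B ^ 2 * \<kappa> ^ 3)"
    using n J B l2(2) by (intro mult_mono one_le_power[of n] one_le_power[of B]) auto
  then have "(J + 2 * n + 16 * J * real m * real s * real D * \<beta> ^ I + 1) * (8 * real D * real s * \<beta> ^ I + 1) + 1
     \<le> 4101205 * (n ^ 2 * (J * B ^ 2 * \<kappa> ^ 3))" using main by linarith
  also have "\<dots> = n ^ 2 * rc_factor \<kappa> I"
  proof -
    have "B ^ 2 = (4080 * \<kappa>) ^ (2 * I)" unfolding B_def power_mult[symmetric] by (simp add: mult.commute)
    then show ?thesis by (simp add: rc_factor_def J_def mult_ac)
  qed
  finally show ?thesis by (simp add: J_def)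
qed

lemma prob_RC_large:
  assumes p: "0 < p" "p \<le> 1" and n: "1 \<le> n" and x: "x = real n * p" "3 \<le> x"
    and \<kappa>: "\<kappa> = ln x" "408 * \<kappa> < x" and I: "10 * \<kappa> * real n < (x / (408 * \<kappa>)) ^ I"
  shows "measure_pmf.prob (random_graph n p) {G. \<not> real (RC G n) \<le> real n ^ 2 * rc_factor \<kappa> I}
    \<le> real n * (2 * exp (1 - x / 4)) + 3 / x"
proof -
  \<comment> \<open>Large sets are joined once \<open>p * s \<ge> 4 * ln x\<close>; sets of size
    \<open>2 * s\<close> are sparse once
    \<open>m \<ge> 50 * \<kappa> \<ge> 5 * (p * (2 * s))\<close>; degrees stay below
    \<open>D \<ge> 4 * x\<close>. Rounding leaves \<open>p * s \<le> 5 * \<kappa>\<close>,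
    \<open>m \<le> 51 * \<kappa>\<close> and \<open>D \<le> 5 * x\<close>, whence
    \<open>408 = 8 * 51\<close> in the bound for \<gamma> and \<open>4080 = 16 * 5 * 51\<close> in
    that for \<beta>.\<close>
  define s where "s = nat \<lceil>4 * \<kappa> / p\<rceil>"
  define m where "m = nat \<lceil>50 * \<kappa>\<rceil>"
  define D where "D = nat \<lceil>4 * x\<rceil>"
  define \<gamma> where "\<gamma> = x / 4 / (2 * real m)"
  define \<beta> where "\<beta> = 2 * real D / \<gamma>"
  have l1: "1 \<le> \<kappa>"
  proof -
    have "exp 1 \<le> x" using e_less_272 x(2) by linarith
    then show ?thesis unfolding \<kappa>(1) using x(2) by (subst ln_ge_iff) auto
  qed
  have s: "4 * \<kappa> / p \<le> real s" "real s \<le> 4 * \<kappa> / p + 1" unfolding s_def using l1 p by (auto intro: real_nat_ceiling_ge)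
  have s1: "1 \<le> s"
  proof -
    have "0 < 4 * \<kappa> / p" using l1 p by simp
    then have "0 < real s" using s(1) by linarith
    then show ?thesis by simp
  qed
  have s5: "real s \<le> 5 * \<kappa> / p"
  proof -
    have "1 \<le> \<kappa> / p" using l1 p by (simp add: field_simps)
    moreover have "4 * \<kappa> / p + \<kappa> / p = 5 * \<kappa> / p" by (simp add: add_divide_distrib[symmetric])
    ultimately show ?thesis using s(2) by linarith
  qed
  have m: "50 * \<kappa> \<le> real m" "real m \<le> 51 * \<kappa>" unfolding m_def using l1 by linarith+
  have m50: "50 \<le> m" using m(1) l1 by linarith
  have D: "4 * x \<le> real D" "real D \<le> 5 * x" unfolding D_def using x(2) by linarith+
  have g0: "x / (408 * \<kappa>) \<le> \<gamma>"
  proof -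
    have "x / (408 * \<kappa>) \<le> x / (8 * real m)" using m l1 x(2) m50 by (intro divide_left_mono) auto
    then show ?thesis by (simp add: \<gamma>_def)
  qed
  have g1: "1 < \<gamma>"
  proof -
    have "1 < x / (408 * \<kappa>)" using \<kappa>(2) l1 by simp
    then show ?thesis using g0 by linarith
  qed
  have \<beta>_eq: "\<beta> = 16 * real D * real m / x" unfolding \<beta>_def \<gamma>_def by simp
  have b1: "1 \<le> \<beta>"
  proof -
    have "x * 1 \<le> real D * real m" using D m50 x(2) by (intro mult_mono) auto
    then show ?thesis using x(2) by (simp add: \<beta>_eq field_simps)
  qed
  have b2: "\<beta> \<le> 4080 * \<kappa>"
  proof -
    have "real D * real m \<le> 5 * x * (51 * \<kappa>)" using D m x(2) by (intro mult_mono) auto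
    then show ?thesis using x(2) by (simp add: \<beta>_eq field_simps)
  qed
  have np: "real n / x = 1 / p" using n p by (simp add: x(1))
  have sD: "real D * real s \<le> 25 * \<kappa> * real n"
  proof -
    have "real D * real s \<le> 5 * x * (5 * \<kappa> / p)" using D s5 x(2) by (intro mult_mono) auto
    also have "\<dots> = 25 * \<kappa> * real n" using p by (simp add: x(1))
    finally show ?thesis .
  qed
  have msD: "real m * real s * real D \<le> 1275 * \<kappa> ^ 2 * real n"
  proof -
    have "real m * (real D * real s) \<le> 51 * \<kappa> * (25 * \<kappa> * real n)" 
      by (rule mult_mono[OF m(2) sD]) (use l1 in auto)
    then show ?thesis by (simp add: power2_eq_square mult_ac)
  qed
  have I': "2 * real s < \<gamma> ^ I"
  proof -
    have "2 * real s \<le> 2 * (5 * \<kappa> / p)" using s5 by simp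
    also have "\<dots> = 10 * \<kappa> / p" by simp
    also have "\<dots> = 10 * \<kappa> * (real n / x)" by (simp add: np)
    also have "\<dots> \<le> 10 * \<kappa> * real n" using x(2) l1 n by (intro mult_left_mono) (auto simp: field_simps)
    also have "\<dots> < (x / (408 * \<kappa>)) ^ I" by (rule I)
    also have "\<dots> \<le> \<gamma> ^ I" using g0 x(2) l1 by (intro power_mono) auto
    finally show ?thesis .
  qed
  let ?M = "random_graph n p"
  have det: "real (RC G n) \<le> real n ^ 2 * rc_factor \<kappa> I"
    if G: "G \<subseteq> all_pairs n" "degree_bounds G n (x / 4) D" "locally_sparse G n m (2 * s)" "large_sets_joined G n s" for G
  proof (rule RC_le)
    fix w assume w: "weighting n w"
    interpret expanding_crawl G n w D m s "x / 4" \<gamma> \<beta>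
    proof (unfold_locales)
      show "neighbours G n v \<noteq> {}" if "v < n" for v
        using G(2) that x(2) by (fastforce simp: degree_bounds_def)
      show "x / 4 = \<gamma> * (2 * real m)" using m50 by (simp add: \<gamma>_def)
      show "2 * real D = \<beta> * \<gamma>" using g1 by (simp add: \<beta>_def)
      show "1 \<le> D" using D(1) x(2) by linarith
    qed (use w n G s1 g1 b1 m50 in auto)
    have "real (rc G n w) \<le> (real (I + 1) + 2 * real n + 16 * real (I + 1) * real m * real s * real D * \<beta> ^ I + 1)
     * (8 * real D * real s * \<beta> ^ I + 1) + 1"
      by (rule rc_cases) (use cover_time_bound I' b1 in auto)
    also have "\<dots> \<le> real n ^ 2 * rc_factor \<kappa> I"
      by (rule cover_bound_arith[OF l1 _ b1 b2 msD sD]) (use n in simp)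
    finally show "real (rc G n w) \<le> real n ^ 2 * rc_factor \<kappa> I" .
  qed
  have "measure_pmf.prob ?M {G. \<not> real (RC G n) \<le> real n ^ 2 * rc_factor \<kappa> I} \<le>
    measure_pmf.prob ?M ({G. \<not> degree_bounds G n (x / 4) D} \<union> ({G. \<not> locally_sparse G n m (2 * s)} \<union> {G. \<not> large_sets_joined G n s}))"
    using det random_graph_subset by (intro prob_mono_on) blast
  also have "\<dots> \<le> measure_pmf.prob ?M {G. \<not> degree_bounds G n (x / 4) D} +
     (measure_pmf.prob ?M {G. \<not> locally_sparse G n m (2 * s)} + measure_pmf.prob ?M {G. \<not> large_sets_joined G n s})"
    by (intro order_trans[OF measure_Un_le] add_left_mono measure_Un_le) auto
  also have "\<dots> \<le> real n * (2 * exp (1 - x / 4)) + (2 / x + 1 / x)"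
  proof (intro add_mono)
    show "measure_pmf.prob ?M {G. \<not> degree_bounds G n (x / 4) D} \<le> real n * (2 * exp (1 - x / 4))"
      by (rule prob_degree_bounds) (use p n x D in auto)
    have "5 * (p * real (2 * s)) = p * (10 * real s)" by simp
    also have "\<dots> \<le> p * (10 * (5 * \<kappa> / p))" using s5 p by (intro mult_left_mono) auto
    also have "\<dots> \<le> real m" using p m by simp
    finally have small: "5 * (p * real (2 * s)) \<le> real m" .
    have "2 * ln x \<le> real m" using m(1) l1 unfolding \<kappa>(1)[symmetric] by linarith
    then show "measure_pmf.prob ?M {G. \<not> locally_sparse G n m (2 * s)} \<le> 2 / x"
      using p n x m50 small by (intro prob_not_locally_sparse) auto
    have "4 * ln x \<le> p * real s" using s(1) p by (simp add: \<kappa>(1)[symmetric] field_simps)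
    then show "measure_pmf.prob ?M {G. \<not> large_sets_joined G n s} \<le> 1 / x"
      by (intro prob_not_large_sets_joined p n x s1)
  qed
  finally show ?thesis by simp
qed

section \<open>Asymptotics of the exponent in (i)\<close>

definition radius :: "(nat \<Rightarrow> real) \<Rightarrow> nat \<Rightarrow> nat" where
  "radius x n = nat \<lceil>ln (10 * ln (x n) * real n) / ln (x n / (408 * ln (x n)))\<rceil> + 1"

context
  fixes x :: "nat \<Rightarrow> real"
  assumes x_ge: "\<forall>\<^sub>F n in sequentially. 28 * ln (real n) \<le> x n"
    and x_le: "\<forall>\<^sub>F n in sequentially. x n \<le> real n"
begin

lemma x_at_top: "filterlim x at_top sequentially"
proof (rule filterlim_at_top_mono[OF _ x_ge])
  show "filterlim (\<lambda>n. 28 * ln (real n)) at_top sequentially" by real_asymp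
qed

lemma ln_x_at_top: "filterlim (\<lambda>n. ln (x n)) at_top sequentially"
  by (rule filterlim_compose[OF ln_at_top x_at_top])

lemma ln_at_top': "filterlim (\<lambda>n. ln (real n)) at_top sequentially"
  by real_asymp

text \<open>The radius solves \<open>a ^ I > 10 * \<kappa> * n\<close> for \<open>I\<close>, where
  \<open>a = x n / (408 * \<kappa>)\<close> and \<open>\<kappa> = ln (x n)\<close>; the added 1
  makes the inequality strict. As \<open>ln a \<ge> \<kappa> / 2\<close> for large
  \<open>x n\<close>, this needs at most the order of \<open>ln n / \<kappa>\<close>.\<close>

lemma radius_properties:
  "\<forall>\<^sub>F n in sequentially. 3 \<le> x n \<and> 408 * ln (x n) < x n \<and>
     10 * ln (x n) * real n < (x n / (408 * ln (x n))) ^ radius x n \<and>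
     real (radius x n) \<le> 6 * ln (real n) / ln (x n) + 2 \<and> 1 \<le> ln (x n) \<and> ln (x n) \<le> ln (real n)"
proof -
  have ev1': "\<forall>\<^sub>F n in sequentially. 3 \<le> x n \<and> 408 * ln (x n) < x n \<and> ln (x n) / 2 \<le> ln (x n / (408 * ln (x n))) \<and> 1 \<le> ln (x n)"
    by (rule eventually_compose_filterlim[rotated, OF x_at_top]) (intro eventually_conj; real_asymp)
  have ev2: "\<forall>\<^sub>F n in sequentially. ln (10 * ln (real n) * real n) \<le> 3 * ln (real n)" by real_asymp
  show ?thesis
    using ev1' ev2 x_le eventually_gt_at_top[of 0]
  proof eventually_elim
    case (elim n)
    define \<kappa> where "\<kappa> = ln (x n)"
    define a where "a = x n / (408 * \<kappa>)"
    have \<kappa>: "1 \<le> \<kappa>" "408 * \<kappa> < x n" "\<kappa> / 2 \<le> ln a" using elim by (auto simp: \<kappa>_def a_def)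
    have \<kappa>L: "\<kappa> \<le> ln (real n)" unfolding \<kappa>_def using elim by (intro ln_mono) auto
    have a: "0 < a" "0 < ln a" using \<kappa> by (auto simp: a_def)
    define z where "z = ln (10 * \<kappa> * real n) / ln a"
    have num: "1 \<le> 10 * \<kappa> * real n"
    proof -
      have "1 * 1 \<le> (10 * \<kappa>) * real n" using \<kappa> elim by (intro mult_mono) auto
      then show ?thesis by simp
    qed
    have z0: "0 \<le> z" unfolding z_def using num a by (intro divide_nonneg_pos) auto
    have R: "radius x n = nat \<lceil>z\<rceil> + 1" by (simp add: radius_def z_def a_def \<kappa>_def)
    have "ln (10 * \<kappa> * real n) \<le> ln (10 * ln (real n) * real n)"
      using \<kappa>L \<kappa> num elim by (intro ln_mono mult_right_mono mult_left_mono) auto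
    then have "ln (10 * \<kappa> * real n) \<le> 3 * ln (real n)" using elim by linarith
    then have "z \<le> 3 * ln (real n) / (\<kappa> / 2)" unfolding z_def using \<kappa> \<kappa>L by (intro frac_le) auto
    then have zle: "z \<le> 6 * ln (real n) / \<kappa>" by simp
    have "real (radius x n) \<le> z + 2" unfolding R using z0 by linarith
    then have r1: "real (radius x n) \<le> 6 * ln (real n) / \<kappa> + 2" using zle by linarith
    have "z < real (radius x n)" unfolding R by linarith
    then have "z * ln a < real (radius x n) * ln a" using a by (intro mult_strict_right_mono)
    moreover have "z * ln a = ln (10 * \<kappa> * real n)" using a by (simp add: z_def)
    moreover have "real (radius x n) * ln a = ln (a ^ radius x n)" using a by (simp add: ln_realpow)
    ultimately have "ln (10 * \<kappa> * real n) < ln (a ^ radius x n)" by simp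
    then have "10 * \<kappa> * real n < a ^ radius x n" using num a by (subst (asm) ln_less_cancel_iff) auto
    then show ?case using elim r1 \<kappa>L by (simp add: \<kappa>_def a_def)
  qed
qed

definition rc_exponent :: "nat \<Rightarrow> real" where
  "rc_exponent n = ln (rc_factor (ln (x n)) (radius x n)) / ln (real n)"

lemma rc_factor_ge_1: "1 \<le> \<kappa> \<Longrightarrow> 1 \<le> rc_factor \<kappa> I" for \<kappa> :: real
proof -
  assume k: "1 \<le> \<kappa>"
  have "1 \<le> (4080 * \<kappa>) ^ (2 * I)" by (rule one_le_power) (use k in simp)
  moreover have "1 \<le> \<kappa> ^ 3" by (rule one_le_power[OF k])
  ultimately have "1 * 1 * (1 * 1) \<le> real (I + 1) * (4080 * \<kappa>) ^ (2 * I) * (4101205 * \<kappa> ^ 3)" by (intro mult_mono) auto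
  then show ?thesis by (simp add: rc_factor_def)
qed

text \<open>The critical factor \<open>(4080 * \<kappa>) ^ (2 * I)\<close> contributes
  \<open>12 * ln (4080 * \<kappa>) / \<kappa>\<close>, which vanishes because
  \<open>\<kappa> = ln (x n)\<close> tends to infinity, however slowly. All other factors are
  polylogarithmic in \<open>n\<close> and form \<open>?h1\<close>.\<close>

lemma rc_exponent_tendsto: "rc_exponent \<longlonglongrightarrow> 0"
proof (rule tendsto_sandwich[of "\<lambda>_. 0"])
  let ?h1 = "\<lambda>y::real. ln (8 * y + 1) / y + 4 * ln (4080 * y) / y + ln 4101205 / y + 3 * ln y / y"
  let ?h2 = "\<lambda>y::real. 12 * ln (4080 * y) / y"
  have "(?h1 \<longlongrightarrow> 0) at_top" by real_asymp
  from filterlim_compose[OF this ln_at_top'] have 1: "(\<lambda>n. ?h1 (ln (real n))) \<longlonglongrightarrow> 0" .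
  have "(?h2 \<longlongrightarrow> 0) at_top" by real_asymp
  from filterlim_compose[OF this ln_x_at_top] have 2: "(\<lambda>n. ?h2 (ln (x n))) \<longlonglongrightarrow> 0" .
  show "(\<lambda>n. ?h1 (ln (real n)) + ?h2 (ln (x n))) \<longlonglongrightarrow> 0" using tendsto_add[OF 1 2] by simp
  show "\<forall>\<^sub>F n in sequentially. 0 \<le> rc_exponent n"
    using radius_properties eventually_ge_at_top[of 1]
  proof eventually_elim
    case (elim n)
    then have "1 \<le> rc_factor (ln (x n)) (radius x n)" by (intro rc_factor_ge_1) auto
    then show ?case unfolding rc_exponent_def using elim by (intro divide_nonneg_nonneg ln_ge_zero) auto
  qed
  show "\<forall>\<^sub>F n in sequentially. rc_exponent n \<le> ?h1 (ln (real n)) + ?h2 (ln (x n))"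
    using radius_properties
  proof eventually_elim
    case (elim n)
    define \<kappa> where "\<kappa> = ln (x n)"
    define L where "L = ln (real n)"
    define I where "I = radius x n"
    have k: "1 \<le> \<kappa>" "\<kappa> \<le> L" "real I \<le> 6 * L / \<kappa> + 2" using elim by (auto simp: \<kappa>_def L_def I_def)
    have L: "1 \<le> L" using k by linarith
    have "6 * L / \<kappa> \<le> 6 * L / 1" using k L by (intro divide_left_mono) auto
    then have I8: "real I \<le> 8 * L" using k L by simp
    have "ln (rc_factor \<kappa> I) = ln (real (I + 1)) + real (2 * I) * ln (4080 * \<kappa>) + (ln 4101205 + 3 * ln \<kappa>)"
      unfolding rc_factor_def using k by (simp add: ln_mult ln_realpow distrib_left)
    also have "\<dots> \<le> ln (8 * L + 1) + 2 * (6 * L / \<kappa> + 2) * ln (4080 * \<kappa>) + (ln 4101205 + 3 * ln L)"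
    proof (intro add_mono mult_right_mono mult_left_mono)
      show "ln (real (I + 1)) \<le> ln (8 * L + 1)" using I8 by (intro ln_mono) auto
      show "real (2 * I) \<le> 2 * (6 * L / \<kappa> + 2)" using k by simp
      show "0 \<le> ln (4080 * \<kappa>)" using k by (intro ln_ge_zero) auto
      show "ln \<kappa> \<le> ln L" using k by (intro ln_mono) auto
    qed auto
    also have "\<dots> \<le> ln (8 * L + 1) + (12 * L / \<kappa> * ln (4080 * \<kappa>) + 4 * ln (4080 * L)) + (ln 4101205 + 3 * ln L)"
    proof -
      have "ln (4080 * \<kappa>) \<le> ln (4080 * L)" using k by (intro ln_mono) auto
      then show ?thesis by (simp add: algebra_simps)
    qed
    finally have "ln (rc_factor \<kappa> I) / L \<le>
       (ln (8 * L + 1) + (12 * L / \<kappa> * ln (4080 * \<kappa>) + 4 * ln (4080 * L)) + (ln 4101205 + 3 * ln L)) / L"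
      using L by (intro divide_right_mono) auto
    also have "\<dots> = ?h1 L + ?h2 \<kappa>"
      using L k by (simp add: add_divide_distrib)
    finally show ?case by (simp add: rc_exponent_def \<kappa>_def L_def I_def)
  qed
qed simp

end

text \<open>The mean degree is the smaller of \<open>n\<close> and \<open>f n * ln n\<close>, and
  both are at least \<open>28 * ln n\<close> for large \<open>n\<close>; so clamping the probability
  at 1 does no harm when \<open>f\<close> grows fast.\<close>

lemma edge_density:
  fixes f :: "nat \<Rightarrow> real"
  assumes "\<And>n. f n > 28"
  defines "p \<equiv> (\<lambda>n. min 1 (f n * ln (real n) / real n))"
  shows "\<And>n. 0 \<le> f n * ln (real n) / real n"
    and "\<forall>\<^sub>F n in sequentially. 28 * ln (real n) \<le> real n * p n"
    and "\<forall>\<^sub>F n in sequentially. real n * p n \<le> real n"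
    and "\<forall>\<^sub>F n in sequentially. 0 < p n \<and> p n \<le> 1"
proof -
  show "0 \<le> f n * ln (real n) / real n" for n
    using assms(1)[of n] by (cases "n = 0") (auto intro!: divide_nonneg_nonneg mult_nonneg_nonneg)
  have "\<forall>\<^sub>F n in sequentially. 28 * ln (real n) \<le> real n" by real_asymp
  then show "\<forall>\<^sub>F n in sequentially. 28 * ln (real n) \<le> real n * p n"
    using eventually_gt_at_top[of 0]
  proof eventually_elim
    case (elim n)
    have "28 * ln (real n) \<le> f n * ln (real n)" using assms(1)[of n] elim by (intro mult_right_mono) auto
    then show ?case using elim by (auto simp: p_def min_def)
  qed
  show "\<forall>\<^sub>F n in sequentially. real n * p n \<le> real n"
    by (intro always_eventually allI) (auto simp: p_def mult_left_le)
  show "\<forall>\<^sub>F n in sequentially. 0 < p n \<and> p n \<le> 1"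
    using eventually_gt_at_top[of 1]
  proof eventually_elim
    case (elim n)
    have "0 < f n * ln (real n) / real n" using assms(1)[of n] elim by (intro divide_pos_pos mult_pos_pos) auto
    then show ?case by (auto simp: p_def)
  qed
qed

lemma degree_error_tendsto:
  assumes "\<forall>\<^sub>F n in sequentially. 28 * ln (real n) \<le> x n"
  shows "(\<lambda>n. real n * (2 * exp (1 - x n / 4))) \<longlonglongrightarrow> 0"
proof (rule tendsto_sandwich[of "\<lambda>_. 0"])
  show "(\<lambda>n. real n * (2 * exp (1 - 28 * ln (real n) / 4))) \<longlonglongrightarrow> 0" by real_asymp
  show "\<forall>\<^sub>F n in sequentially. real n * (2 * exp (1 - x n / 4)) \<le> real n * (2 * exp (1 - 28 * ln (real n) / 4))"
    using assms by eventually_elim (intro mult_left_mono, auto)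
qed (auto intro!: always_eventually)

theorem RC_upper_bound:
  fixes f :: "nat \<Rightarrow> real"
  assumes f: "\<And>n. f n > 28"
  shows "\<exists>g :: nat \<Rightarrow> real. g \<longlonglongrightarrow> 0 \<and>
     (\<lambda>n. measure_pmf.prob (gnp n (f n * ln (real n) / real n))
             {G. real (RC G n) \<le> real n powr (2 + g n)}) \<longlonglongrightarrow> 1"
proof -
  define p where "p = (\<lambda>n. min 1 (f n * ln (real n) / real n))"
  define x where "x = (\<lambda>n. real n * p n)"
  note ed = edge_density[of f, OF f]
  have x: "\<forall>\<^sub>F n in sequentially. 28 * ln (real n) \<le> x n" "\<forall>\<^sub>F n in sequentially. x n \<le> real n"
    using ed(2,3) by (simp_all add: x_def p_def)
  have p01: "\<forall>\<^sub>F n in sequentially. 0 < p n \<and> p n \<le> 1" using ed(4) by (simp add: p_def)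
  have gnp: "gnp n (f n * ln (real n) / real n) = random_graph n (p n)" for n
    unfolding p_def by (rule gnp_eq_rsub[OF ed(1)])
  let ?P = "\<lambda>n. measure_pmf.prob (random_graph n (p n)) {G. real (RC G n) \<le> real n powr (2 + rc_exponent x n)}"
  have "?P \<longlonglongrightarrow> 1"
  proof (rule tendsto_sandwich[where h = "\<lambda>_. 1"])
    have "(\<lambda>n. 3 / x n) \<longlonglongrightarrow> 0"
      by (rule tendsto_divide_0[OF tendsto_const filterlim_at_top_imp_at_infinity[OF x_at_top[OF x]]])
    from tendsto_diff[OF tendsto_const tendsto_add[OF degree_error_tendsto[OF x(1)] this], of 1]
    show "(\<lambda>n. 1 - (real n * (2 * exp (1 - x n / 4)) + 3 / x n)) \<longlonglongrightarrow> 1" by simp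
    show "\<forall>\<^sub>F n in sequentially. 1 - (real n * (2 * exp (1 - x n / 4)) + 3 / x n) \<le> ?P n"
      using radius_properties[OF x] p01 eventually_gt_at_top[of 1]
    proof eventually_elim
      case (elim n)
      let ?F = "rc_factor (ln (x n)) (radius x n)"
      have F: "0 < ?F" using rc_factor_ge_1[OF x, of "ln (x n)" "radius x n"] elim by linarith
      have "real n powr (2 + rc_exponent x n) = real n ^ 2 * real n powr (rc_exponent x n)"
        using elim by (simp add: powr_add powr_numeral)
      also have "real n powr (rc_exponent x n) = ?F"
        using elim F by (simp add: powr_def rc_exponent_def[OF x])
      finally have eq: "real n powr (2 + rc_exponent x n) = real n ^ 2 * ?F" .
      have "measure_pmf.prob (random_graph n (p n)) {G. \<not> real (RC G n) \<le> real n ^ 2 * ?F} \<le>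
          real n * (2 * exp (1 - x n / 4)) + 3 / x n"
        by (rule prob_RC_large) (use elim in \<open>auto simp: x_def\<close>)
      moreover have "measure_pmf.prob (random_graph n (p n)) {G. \<not> real (RC G n) \<le> real n ^ 2 * ?F} = 1 - ?P n"
        unfolding eq by (subst measure_pmf.prob_compl[symmetric]) (auto intro!: arg_cong2[where f=measure])
      ultimately show ?case by linarith
    qed
  qed auto
  then show ?thesis using rc_exponent_tendsto[OF x] unfolding gnp by blast
qed

section \<open>Fixed weightings\<close>

definition covered :: "nat set set \<Rightarrow> nat \<Rightarrow> (nat \<Rightarrow> int) \<Rightarrow> nat \<Rightarrow> bool" where
  "covered G n w0 K \<longleftrightarrow> (\<forall>v<n. neighbours G n v \<noteq> {}) \<and> {0..<n} \<subseteq> crawl_pos G n w0 ` {..K}"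

lemma card_detours: "finite (detours n K y)" "card (detours n K y) \<le> 1 + (K + 1) * n"
proof -
  let ?A = "(\<lambda>(i, z). [i \<mapsto> y, Suc i \<mapsto> z]) ` ({..K} \<times> {0..<n})"
  show "finite (detours n K y)" by (simp add: detours_def)
  have "card ?A \<le> card ({..K} \<times> {0..<n})" by (rule card_image_le) simp
  also have "\<dots> = (K + 1) * n" by (simp add: card_cartesian_product)
  finally show "card (detours n K y) \<le> 1 + (K + 1) * n"
    unfolding detours_def using card_insert_le_m1[of "1 + (K + 1) * n" ?A Map.empty] by (simp add: card_insert_if)
qed

lemma revisit_sources_lt:
  assumes "weighting n w0" "0 < n" shows "revisit_sources (crawl_pos H n w0) k \<subseteq> {0..<n}"
  using crawl_pos_in[OF assms, of H] by (auto simp: revisit_sources_def)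

text \<open>The events \<open>?E1\<close> and \<open>?E2\<close> concern sets of linear size and
  tolerate a crude union bound. Only \<open>?E3\<close> is delicate: \<open>n * (1 - p) ^ M\<close>
  decides how large \<open>M\<close> must be.\<close>

lemma prob_not_covered:
  assumes w: "weighting n w0" and p: "0 \<le> p" "p \<le> 1" and x: "x = real n * p" "0 < x"
    and n: "14 \<le> n" and M: "real M \<le> real n / 14 + 1"
  shows "measure_pmf.prob (random_graph n p) {G. \<not> covered G n w0 (n + M)} \<le>
    real n * (2 * exp (1 - x / 4)) + (7 * real n ^ 4 * exp (1 - x / 4) + real n * (1 - p) ^ M)"
proof -
  define \<theta> where "\<theta> = n div 2"
  define N where "N = n div 4"
  define K where "K = n + M"
  define D where "D = nat \<lceil>4 * x\<rceil>"
  have n0: "0 < n" using n by simp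
  have \<theta>: "real n / 2 - 1 / 2 \<le> real \<theta>" "\<theta> \<le> n" "N \<le> n - \<theta>" unfolding \<theta>_def N_def by linarith+
  have N: "real n / 4 - 1 \<le> real N" "real N \<le> real n / 4" unfolding N_def by linarith+
  \<comment> \<open>The inequality \<open>(n / 14 + 1) + n / 4 + 1 \<le> n / 2 - 1 / 2\<close> holds
    precisely from \<open>n = 14\<close> on.\<close>
  have size: "M + N + 1 \<le> \<theta>"
  proof -
    have "real (M + N + 1) \<le> real \<theta>" using \<theta>(1) N(2) M n by simp
    then show ?thesis by simp
  qed
  have Kn: "real (K + 1) \<le> 2 * real n" using M n by (simp add: K_def)
  let ?M = "random_graph n p"
  define c where "c = exp (1 - x / 4)"
  have pN: "(1 - p) ^ N \<le> c"
  proof -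
    have "(1 - p) ^ N \<le> exp (- p * real N)" using one_plus_power_le_exp[of "- p" N] p by simp
    also have "\<dots> \<le> exp (1 - x / 4)"
    proof -
      have "p * (real n / 4 - 1) \<le> p * real N" using N p by (intro mult_left_mono) auto
      then show ?thesis using p by (simp add: x algebra_simps)
    qed
    finally show ?thesis by (simp add: c_def)
  qed
  let ?E1 = "{G. \<exists>y\<in>{0..<n}. \<exists>j\<in>{..<\<theta>}. avoids G n y (n - \<theta>) (other_unvisited (del_vertex G y) n w0 j y)}"
  let ?E2 = "{G. \<exists>y\<in>{0..<n}. \<exists>j\<in>{..K}. \<exists>ov\<in>detours n K y. avoids G n y N (old_vertices (del_vertex G y) n w0 ov \<theta> j y)}"
  let ?E3 = "{G. \<exists>u\<in>{0..<n}. avoids G n u M (first_revisit_sources (del_vertex G u) n w0 M u)}"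
  let ?E0 = "{G. \<not> degree_bounds G n (x / 4) D}"
  have "measure_pmf.prob ?M {G. \<not> covered G n w0 (n + M)} \<le> measure_pmf.prob ?M (?E0 \<union> (?E1 \<union> (?E2 \<union> ?E3)))"
  proof (rule prob_mono_on, rule ccontr)
    fix G assume G: "G \<in> set_pmf ?M" "G \<in> {G. \<not> covered G n w0 (n + M)}" "G \<notin> ?E0 \<union> (?E1 \<union> (?E2 \<union> ?E3))"
    have ne: "neighbours G n v \<noteq> {}" if "v < n" for v
      using G(3) that x(2) by (fastforce simp: degree_bounds_def)
    interpret crawl G n w0 by unfold_locales (use w n0 ne in auto)
    have "{0..<n} \<subseteq> ps ` {..n + M}"
      by (rule covered_by[of \<theta> M N]) (use G(3) size \<theta>(2) in \<open>auto simp: K_def\<close>)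
    then show False using G(2) ne unfolding covered_def by blast
  qed
  also have "\<dots> \<le> measure_pmf.prob ?M ?E0 + (measure_pmf.prob ?M ?E1 + (measure_pmf.prob ?M ?E2 + measure_pmf.prob ?M ?E3))"
    by (intro order_trans[OF measure_Un_le] add_left_mono measure_Un_le) auto
  also have "\<dots> \<le> real n * (2 * exp (1 - x / 4)) + (real n ^ 2 * c + (6 * real n ^ 4 * c + real n * (1 - p) ^ M))"
  proof (intro add_mono)
    have "4 * x \<le> real D" unfolding D_def by linarith
    then show "measure_pmf.prob ?M ?E0 \<le> real n * (2 * exp (1 - x / 4))"
      by (intro prob_degree_bounds p n0 x)
    have "measure_pmf.prob ?M ?E1 \<le> real (card {0..<n}) * (real (card {..<\<theta>}) * (1 - p) ^ (n - \<theta>))"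
      by (intro prob_Ex_le prob_avoids_le p) (auto simp: other_unvisited_def)
    also have "\<dots> \<le> real n * (real n * c)"
    proof -
      have "(1 - p) ^ (n - \<theta>) \<le> (1 - p) ^ N" using \<theta>(3) p by (intro power_decreasing) auto
      then have "(1 - p) ^ (n - \<theta>) \<le> c" using pN by linarith
      then show ?thesis using \<theta>(2) p by (intro mult_mono) auto
    qed
    finally show "measure_pmf.prob ?M ?E1 \<le> real n ^ 2 * c" by (simp add: power2_eq_square)
    have "measure_pmf.prob ?M ?E2 \<le> real (card {0..<n}) * (real (card {..K}) * (real (1 + (K + 1) * n) * (1 - p) ^ N))"
    proof (intro prob_Ex_le)
      fix y j assume y: "y \<in> {0..<n}"
      have "measure_pmf.prob ?M {G. \<exists>ov\<in>detours n K y. avoids G n y N (old_vertices (del_vertex G y) n w0 ov \<theta> j y)}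
        \<le> real (card (detours n K y)) * (1 - p) ^ N"
        using y by (intro prob_Ex_le prob_avoids_le p card_detours) (auto simp: old_vertices_def)
      also have "\<dots> \<le> real (1 + (K + 1) * n) * (1 - p) ^ N"
        using p card_detours(2)[of n K y] by (intro mult_right_mono of_nat_mono) auto
      finally show "measure_pmf.prob ?M {G. \<exists>ov\<in>detours n K y. avoids G n y N (old_vertices (del_vertex G y) n w0 ov \<theta> j y)}
        \<le> real (1 + (K + 1) * n) * (1 - p) ^ N" .
    qed auto
    \<comment> \<open>The factors count the vertices \<open>y\<close>, the indices \<open>j\<close>
      and the detours.\<close>
    also have "\<dots> \<le> real n * ((2 * real n) * ((3 * real n ^ 2) * c))"
    proof (intro mult_mono)
      show "real (card {..K}) \<le> 2 * real n" using Kn by simp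
      have "real (1 + (K + 1) * n) = 1 + real (K + 1) * real n" by (simp add: algebra_simps)
      also have "\<dots> \<le> 1 * 1 + (2 * real n) * real n" using Kn by (intro add_mono mult_right_mono) auto
      also have "\<dots> \<le> real n * real n + (2 * real n) * real n" using n by (intro add_mono mult_mono) auto
      finally show "real (1 + (K + 1) * n) \<le> 3 * real n ^ 2" by (simp add: power2_eq_square)
    qed (use pN p in auto)
    finally show "measure_pmf.prob ?M ?E2 \<le> 6 * real n ^ 4 * c"
      by (simp add: power2_eq_square power4_eq_xxxx mult_ac)
    have "measure_pmf.prob ?M ?E3 \<le> real (card {0..<n}) * (1 - p) ^ M"
      using revisit_sources_lt[OF w n0]
      by (intro prob_Ex_le prob_avoids_le p) (auto simp: first_revisit_sources_def)
    then show "measure_pmf.prob ?M ?E3 \<le> real n * (1 - p) ^ M" by simp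
  qed
  also have "\<dots> \<le> real n * (2 * exp (1 - x / 4)) + (7 * real n ^ 4 * c + real n * (1 - p) ^ M)"
  proof -
    have "real n ^ 2 \<le> real n ^ 4" using n by (intro power_increasing) auto
    then have "real n ^ 2 * c \<le> real n ^ 4 * c" by (intro mult_right_mono) (auto simp: c_def)
    then show ?thesis by linarith
  qed
  finally show ?thesis by (simp add: c_def)
qed

section \<open>Surviving vertices at the end of the initial order\<close>

definition last_vertices :: "nat \<Rightarrow> (nat \<Rightarrow> int) \<Rightarrow> nat \<Rightarrow> nat set" where
  "last_vertices n w0 m = {v \<in> {0..<n}. - int m \<le> w0 v}"

lemma card_last_vertices:
  assumes "weighting n w0" "m \<le> n" shows "card (last_vertices n w0 m) = m"
proof -
  have "w0 ` last_vertices n w0 m = {- int m .. -1}"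
  proof
    show "w0 ` last_vertices n w0 m \<subseteq> {- int m .. -1}"
      using weighting_neg[OF assms(1)] by (fastforce simp: last_vertices_def)
    show "{- int m .. -1} \<subseteq> w0 ` last_vertices n w0 m"
    proof
      fix z assume z: "z \<in> {- int m .. -1}"
      then have "z \<in> w0 ` {0..<n}" using assms by (auto simp: bij_betw_def)
      then show "z \<in> w0 ` last_vertices n w0 m" using z by (auto simp: last_vertices_def)
    qed
  qed
  moreover have "inj_on w0 (last_vertices n w0 m)"
    using assms(1) by (auto simp: bij_betw_def last_vertices_def intro: inj_on_subset)
  ultimately have "card (last_vertices n w0 m) = card {- int m .. -1}" by (metis card_image)
  then show ?thesis by simp
qed

lemma late_in_order_last_vertices:
  assumes "weighting n w0" "m < n" shows "late_in_order n w0 (last_vertices n w0 m)"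
  using pos_0_in[OF assms(1), of "{}" Map.empty] assms(2)
  by (auto simp: late_in_order_def last_vertices_def)

lemma prob_no_survivor:
  assumes w: "weighting n w0" and p: "0 \<le> p" "p < 1" and n: "1 \<le> m" "m < n" "M + m \<le> n"
  shows "measure_pmf.prob (random_graph n p) {G. \<forall>u\<in>last_vertices n w0 m. \<not> survives n w0 (last_vertices n w0 m) M N u G}
    \<le> 1 / (real m * (1 - p) ^ M)"
proof -
  let ?W = "last_vertices n w0 m" and ?P = "random_graph n p"
  let ?X = "\<lambda>K. padded_late_vertices K n w0 ?W M N"
  have n0: "0 < n" using n by simp
  have W: "late_in_order n w0 ?W" by (rule late_in_order_last_vertices[OF w n(2)])
  have WV: "?W \<subseteq> {0..<n}" by (auto simp: last_vertices_def)
  have cW: "card ?W = m" using card_last_vertices[OF w] n by simp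
  have M: "M \<le> card ({0..<n} - ?W)" using WV cW n by (subst card_Diff_subset) (auto intro: finite_subset)
  have card: "card (?X K) = M" for K by (rule padded_late_vertices(1)[OF M])
  have "measure_pmf.prob ?P {G. \<forall>u\<in>?W. \<not> survives n w0 ?W M N u G} \<le> 1 / (real (card ?W) * (1 - p) ^ M)"
  proof (rule prob_none_le_second_moment)
    show "finite (set_pmf ?P)" by (rule finite_set_rsub) simp
    show "finite ?W" "?W \<noteq> {}" using WV finite_subset cW n by auto
    show "0 < (1 - p) ^ M" using p by simp
    fix u assume u: "u \<in> ?W"
    then have un: "u < n" using WV by auto
    show "measure_pmf.prob ?P {G. survives n w0 ?W M N u G} = (1 - p) ^ M"
      unfolding survives_def
    proof (rule prob_avoid_eq[OF p(1) _ un _ card])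
      show "?X (del_vertex H u) \<subseteq> {0..<n} - {u}" for H
        by (rule padded_late_vertices_subset[OF w n0 W M]) (use u del_vertex_isolated in auto)
    qed (use p in auto)
    fix v assume v: "v \<in> ?W" "u \<noteq> v"
    then have vn: "v < n" using WV by auto
    have "measure_pmf.prob ?P {G. survives n w0 ?W M N u G \<and> survives n w0 ?W M N v G} \<le>
       measure_pmf.prob ?P {G. neighbours G n u \<inter> ?X (del_vertex (del_vertex G u) v) = {} \<and>
         neighbours G n v \<inter> ?X (del_vertex (del_vertex G u) v) = {}}"
      using survives_pair[OF w n0 W u v(1) M] by (intro prob_mono_on) blast
    also have "\<dots> \<le> (1 - p) ^ (M + M)"
    proof (rule prob_avoid_two_le[OF p(1) _ un vn v(2) _ card])
      have iso: "z \<notin> neighbours (del_vertex (del_vertex H u) v) n y" if "z \<in> {u, v}" for z H y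
        using that del_vertex_isolated[of v "del_vertex H u" n y] del_vertex_isolated[of u "del_vertex H v" n y]
        by (auto simp: del_vertex_commute[of H u v])
      show "?X (del_vertex (del_vertex H u) v) \<subseteq> {0..<n} - {u, v}" for H
        by (rule padded_late_vertices_subset[OF w n0 W M]) (use u v iso in auto)
    qed (use p in auto)
    finally show "measure_pmf.prob ?P {G. survives n w0 ?W M N u G \<and> survives n w0 ?W M N v G} \<le> ((1 - p) ^ M)\<^sup>2"
      by (simp add: power_add power2_eq_square)
  qed
  then show ?thesis by (simp add: cW)
qed

lemma rc_of_covered:
  assumes "weighting n w0" "0 < n" "covered G n w0 K"
  shows "n \<le> rc G n w0" "rc G n w0 \<le> K + 1"
    and "late_in_order n w0 W \<Longrightarrow> M \<le> card ({0..<n} - W) \<Longrightarrow> u \<in> W \<Longrightarrow> survives n w0 W M K u G \<Longrightarrow>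
      n + M \<le> rc G n w0 + card W"
proof -
  interpret crawl G n w0 by unfold_locales (use assms in \<open>auto simp: covered_def\<close>)
  let ?Q = "\<lambda>k. {0..<n} \<subseteq> ps ` {..k}"
  have QK: "?Q K" using assms(3) by (simp add: covered_def)
  define k where "k = (LEAST k. ?Q k)"
  have k: "?Q k" "k \<le> K" unfolding k_def using LeastI[of ?Q, OF QK] Least_le[of ?Q, OF QK] by auto
  have "\<exists>k. ?Q k" using QK by blast
  then have rc: "rc G n w0 = Suc k" unfolding k_def by (simp add: rc_eq[OF weighting n_pos no_isolated])
  have "n \<le> card (ps ` {..k})" using card_mono[OF _ k(1)] by simp
  also have "\<dots> \<le> Suc k" using card_image_le[of "{..k}" ps] by simp
  finally show "n \<le> rc G n w0" by (simp add: rc)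
  show "rc G n w0 \<le> K + 1" using k(2) by (simp add: rc)
  show "n + M \<le> rc G n w0 + card W"
    if "late_in_order n w0 W" "M \<le> card ({0..<n} - W)" "u \<in> W" "survives n w0 W M K u G"
    using survives_imp_slow[OF that(1,3,2,4) k] by (simp add: rc)
qed

section \<open>Concentration for a fixed weighting\<close>

lemma abs_ratio_le:
  fixes r d \<epsilon> :: real
  assumes "0 < d" "r - d \<le> \<epsilon> * d" "d - r \<le> \<epsilon> * d"
  shows "\<bar>r / d - 1\<bar> \<le> \<epsilon>"
proof -
  have "\<bar>r / d - 1\<bar> = \<bar>r - d\<bar> / d" using assms(1) by (simp add: diff_divide_distrib[symmetric] abs_div_pos[symmetric] field_simps)
  also have "\<dots> \<le> \<epsilon>" using assms by (simp add: field_simps abs_le_iff)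
  finally show ?thesis .
qed

text \<open>For \<open>f > 1 / \<epsilon>\<close> the correction \<open>n / f\<close> is below
  \<open>\<epsilon> * n\<close>, and the trivial bound \<open>n \<le> rc\<close> is enough from
  below. Survivors are thus needed only for \<open>f \<le> 1 / \<epsilon>\<close>, where a rate
  \<open>B\<close> that is uniform in \<open>f\<close> is available.\<close>

lemma rc_concentration_step:
  fixes f :: real
  assumes w: "weighting n w0" and \<epsilon>: "0 < \<epsilon>" and f: "28 < f" and e: "e = min \<epsilon> 1"
    and n: "14 \<le> n" "2 \<le> \<epsilon> * real n" and p: "p = min 1 (f * ln (real n) / real n)" "0 < p"
    and B: "f \<le> 1 / \<epsilon> \<Longrightarrow> 0 < B \<and> p < 1 \<and> 1 \<le> real n * e / (4 * f) \<and>
      B \<le> real (nat \<lfloor>e * real n / (4 * f)\<rfloor>) * (1 - p) ^ nat \<lfloor>(1 - e / 2) * real n / f\<rfloor>" "0 < B"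
  shows "measure_pmf.prob (random_graph n p) {G. \<bar>real (rc G n w0) / (real n + real n / f) - 1\<bar> > \<epsilon>} \<le>
    real n * (2 * exp (1 - real n * p / 4)) + (7 * real n ^ 4 * exp (1 - real n * p / 4) + real n powr (- e)) + 1 / B"
proof -
  define y where "y = real n / f"
  have y: "0 < y" unfolding y_def using f n by simp
  have y28: "y \<le> real n / 28" unfolding y_def using f by (intro divide_left_mono) auto
  have e01: "0 < e" "e \<le> 1" "e \<le> \<epsilon>" using \<epsilon> by (auto simp: e)
  \<comment> \<open>Without clamping, \<open>n * (1 - p) ^ M\<close> is at most
    \<open>n powr (- e)\<close>, while \<open>m * (1 - p) ^ M'\<close> is of order at least
    \<open>n powr (e / 2)\<close> for bounded \<open>f\<close>. Giving up \<open>m\<close> vertices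
    and \<open>e / 2 * (n / f)\<close> late ones costs \<open>3 / 4 * e * (n / f)\<close>, within
    the tolerance. The cap \<open>e \<le> 1\<close> keeps \<open>M\<close> at most
    \<open>n / 14 + 1\<close>.\<close>
  define M where "M = nat \<lceil>(1 + e) * real n / f\<rceil>"
  define M' where "M' = nat \<lfloor>(1 - e / 2) * real n / f\<rfloor>"
  define m where "m = nat \<lfloor>e * real n / (4 * f)\<rfloor>"
  have My: "(1 + e) * real n / f = (1 + e) * y" "(1 - e / 2) * real n / f = (1 - e / 2) * y" "e * real n / (4 * f) = e * y / 4"
    by (simp_all add: y_def)
  have ey: "0 < (1 + e) * y" "0 \<le> (1 - e / 2) * y" "0 \<le> e * y" "e * y \<le> \<epsilon> * y" "e * y \<le> y" using e01 y by auto
  have M: "(1 + e) * y \<le> real M" "real M \<le> (1 + e) * y + 1" unfolding M_def My using ey by linarith+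
  have M': "(1 - e / 2) * y - 1 \<le> real M'" "real M' \<le> (1 - e / 2) * y" unfolding M'_def My using ey by linarith+
  have m: "real m \<le> e * y / 4" unfolding m_def My using ey by linarith
  have n0: "0 < n" using n by simp
  let ?W = "last_vertices n w0 m"
  let ?K = "n + M"
  let ?NS = "{G. f \<le> 1 / \<epsilon> \<and> (\<forall>u\<in>?W. \<not> survives n w0 ?W M' ?K u G)}"
  have mn: "m < n" "M' + m \<le> n"
  proof -
    have "real m < real n" using m ey y28 n by linarith
    then show "m < n" by simp
    have "real (M' + m) \<le> real n" using m M' ey y28 n by (simp add: algebra_simps)
    then show "M' + m \<le> n" by simp
  qed
  have lower: "n + M' \<le> rc G n w0 + m" if "covered G n w0 ?K" "G \<notin> ?NS" "f \<le> 1 / \<epsilon>" for G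
  proof -
    have WV: "?W \<subseteq> {0..<n}" by (auto simp: last_vertices_def)
    have cW: "card ?W = m" using card_last_vertices[OF w] mn by simp
    obtain u where u: "u \<in> ?W" "survives n w0 ?W M' ?K u G" using \<open>G \<notin> ?NS\<close> \<open>f \<le> 1 / \<epsilon>\<close> by blast
    have "M' \<le> card ({0..<n} - ?W)" using WV cW mn by (subst card_Diff_subset) (auto intro: finite_subset)
    from rc_of_covered(3)[OF w n0 that(1) late_in_order_last_vertices[OF w mn(1)] this u]
    show ?thesis by (simp add: cW)
  qed
  have det: "\<bar>real (rc G n w0) / (real n + y) - 1\<bar> \<le> \<epsilon>" if C: "covered G n w0 ?K" and NS: "G \<notin> ?NS" for G
  proof (rule abs_ratio_le)
    show "0 < real n + y" using y by simp
    have "real (rc G n w0) \<le> real n + real M + 1" using rc_of_covered(2)[OF w n0 C] by simp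
    then have "real (rc G n w0) - (real n + y) \<le> e * y + 2" using M(2) by (simp add: algebra_simps)
    then show "real (rc G n w0) - (real n + y) \<le> \<epsilon> * (real n + y)"
      unfolding distrib_left using ey(4) n(2) by linarith
    show "real n + y - real (rc G n w0) \<le> \<epsilon> * (real n + y)"
    proof (cases "f \<le> 1 / \<epsilon>")
      case True
      have "real (n + M') \<le> real (rc G n w0 + m)" by (intro of_nat_mono lower C NS True)
      then have "real n + y - real (rc G n w0) \<le> 3 / 4 * (e * y) + 1" using M'(1) m by (simp add: algebra_simps)
      also have "\<dots> \<le> \<epsilon> * (real n + y)" unfolding distrib_left using ey(3,4) n(2) by linarith
      finally show ?thesis .
    next
      case False
      have "real n \<le> real (rc G n w0)" using rc_of_covered(1)[OF w n0 C] by simp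
      moreover have "y \<le> \<epsilon> * real n"
      proof -
        have "1 / f \<le> \<epsilon>" using False \<epsilon> f by (simp add: field_simps)
        then have "real n * (1 / f) \<le> real n * \<epsilon>" by (intro mult_left_mono) auto
        then show ?thesis by (simp add: y_def mult.commute)
      qed
      moreover have "0 \<le> \<epsilon> * y" using \<epsilon> y by simp
      ultimately show ?thesis by (simp add: algebra_simps)
    qed
  qed
  let ?P = "random_graph n p"
  have p1: "0 \<le> p" "p \<le> 1" using p by auto
  have "measure_pmf.prob ?P {G. \<bar>real (rc G n w0) / (real n + y) - 1\<bar> > \<epsilon>} \<le>
      measure_pmf.prob ?P ({G. \<not> covered G n w0 ?K} \<union> ?NS)"
    using det by (intro prob_mono_on) (fastforce simp: not_le[symmetric])
  also have "\<dots> \<le> measure_pmf.prob ?P {G. \<not> covered G n w0 ?K} + measure_pmf.prob ?P ?NS"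
    by (rule measure_Un_le) auto
  also have "\<dots> \<le> (real n * (2 * exp (1 - real n * p / 4)) + (7 * real n ^ 4 * exp (1 - real n * p / 4) + real n powr (- e))) + 1 / B"
  proof (rule add_mono)
    have "measure_pmf.prob ?P {G. \<not> covered G n w0 ?K} \<le>
        real n * (2 * exp (1 - real n * p / 4)) + (7 * real n ^ 4 * exp (1 - real n * p / 4) + real n * (1 - p) ^ M)"
    proof (rule prob_not_covered[OF w p1 refl])
      show "real M \<le> real n / 14 + 1" using M(2) ey y28 by (simp add: algebra_simps)
    qed (use n p in auto)
    also have "real n * (1 - p) ^ M \<le> real n powr (- e)"
    proof (cases "p = 1")
      case True
      \<comment> \<open>For \<open>p = 1\<close> the formula for the density may fail, but the power
        vanishes for positive \<open>M\<close>.\<close>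
      have "M \<noteq> 0" using M(1) ey by linarith
      then show ?thesis using True by (simp add: zero_power)
    next
      case False
      then have pe: "p = f * ln (real n) / real n" using p by (auto simp: min_def split: if_splits)
      have "(1 - p) ^ M \<le> exp (- p * real M)" using one_plus_power_le_exp[of "- p" M] p1 by simp
      also have "\<dots> \<le> exp (- ((1 + e) * ln (real n)))"
      proof -
        have "p * ((1 + e) * y) \<le> p * real M" using M(1) p1 by (intro mult_left_mono) auto
        moreover have "p * ((1 + e) * y) = (1 + e) * ln (real n)" using f n by (simp add: pe y_def)
        ultimately show ?thesis by simp
      qed
      also have "\<dots> = real n powr (- (1 + e))" using n by (simp add: powr_def algebra_simps)
      finally have "real n * (1 - p) ^ M \<le> real n powr 1 * real n powr (- (1 + e))" using n by (simp add: mult_left_mono)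
      also have "\<dots> = real n powr (- e)" unfolding powr_add[symmetric] by simp
      finally show ?thesis .
    qed
    finally show "measure_pmf.prob ?P {G. \<not> covered G n w0 ?K} \<le>
       real n * (2 * exp (1 - real n * p / 4)) + (7 * real n ^ 4 * exp (1 - real n * p / 4) + real n powr (- e))" by simp
    show "measure_pmf.prob ?P ?NS \<le> 1 / B"
    proof (cases "f \<le> 1 / \<epsilon>")
      case False
      then show ?thesis using B(2) by simp
    next
      case True
      have m1: "1 \<le> m" unfolding m_def using B(1)[OF True] by (simp add: le_nat_floor mult.commute)
      have "measure_pmf.prob ?P ?NS = measure_pmf.prob ?P {G. \<forall>u\<in>?W. \<not> survives n w0 ?W M' ?K u G}"
        using True by simp
      also have "\<dots> \<le> 1 / (real m * (1 - p) ^ M')"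
        using B(1)[OF True] by (intro prob_no_survivor w p1 m1 mn) auto
      also have "\<dots> \<le> 1 / B"
        using B(1)[OF True] by (intro divide_left_mono) (auto simp: m_def M'_def intro!: mult_pos_pos)
      finally show ?thesis .
    qed
  qed
  finally show ?thesis by (simp add: y_def)
qed

text \<open>By \<open>ln (1 - p) \<ge> - p - 2 * p ^ 2\<close> the quadratic term shifts the
  exponent by at most 1, because \<open>2 * p * ln n \<le> 1\<close> for bounded \<open>f\<close>;
  this is the \<open>- 1\<close> inside \<open>exp\<close>. Writing \<open>F\<close> for
  \<open>f\<close> in the first factor makes the rate independent of \<open>f\<close>.\<close>

lemma survivor_rate:
  fixes f :: real
  assumes f: "28 < f" "f \<le> F" and e: "0 < e" "e \<le> 1" and n: "1 < n"
    and big: "F * ln (real n) / real n \<le> 1 / 2" "2 * F * ln (real n) ^ 2 / real n \<le> 1" "1 \<le> e * real n / (4 * F)"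
    and p: "p = min 1 (f * ln (real n) / real n)"
  shows "p < 1 \<and> 1 \<le> real n * e / (4 * f) \<and>
     (e * real n / (4 * F) - 1) * exp (- (1 - e / 2) * ln (real n) - 1)
      \<le> real (nat \<lfloor>e * real n / (4 * f)\<rfloor>) * (1 - p) ^ nat \<lfloor>(1 - e / 2) * real n / f\<rfloor>"
proof -
  define L where "L = ln (real n)"
  have L: "0 < L" using n by (simp add: L_def)
  have n0: "0 < real n" using n by simp
  have fF: "f * L / real n \<le> F * L / real n" using f L n0 by (intro divide_right_mono mult_right_mono) auto
  then have half: "f * L / real n \<le> 1 / 2" using big(1) unfolding L_def by linarith
  then have pe: "p = f * L / real n" unfolding p L_def by linarith
  then have ph: "p \<le> 1 / 2" using half by simp
  have p0: "0 \<le> p" using pe f L n0 by simp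
  have mf: "e * real n / (4 * F) \<le> e * real n / (4 * f)" using f e n0 by (intro divide_left_mono mult_pos_pos) auto
  define m where "m = real (nat \<lfloor>e * real n / (4 * f)\<rfloor>)"
  have m: "e * real n / (4 * F) - 1 \<le> m" unfolding m_def using mf big(3) by linarith
  define M where "M = nat \<lfloor>(1 - e / 2) * real n / f\<rfloor>"
  have M: "real M \<le> (1 - e / 2) * real n / f" unfolding M_def using e f n0 by (intro of_nat_floor) auto
  have "real M * (p + 2 * p\<^sup>2) \<le> (1 - e / 2) * real n / f * (p + 2 * p\<^sup>2)"
    using M p0 by (intro mult_right_mono) auto
  also have "\<dots> = (1 - e / 2) * L * (1 + 2 * p)"
    using f n0 unfolding pe by (simp add: field_simps power2_eq_square)
  also have "\<dots> = (1 - e / 2) * L + (1 - e / 2) * (2 * p * L)" by (simp add: algebra_simps)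
  also have "\<dots> \<le> (1 - e / 2) * L + 1"
  proof -
    have "2 * p * L \<le> 2 * (F * L / real n) * L" using fF L pe by (intro mult_right_mono) auto
    also have "\<dots> \<le> 1" using big(2) by (simp add: L_def power2_eq_square mult_ac)
    finally have "(1 - e / 2) * (2 * p * L) \<le> 1 * 1" using e p0 L by (intro mult_mono) auto
    then show ?thesis by simp
  qed
  finally have hM: "real M * (p + 2 * p\<^sup>2) \<le> (1 - e / 2) * L + 1" .
  have "exp (- (1 - e / 2) * L - 1) \<le> exp (real M * ln (1 - p))"
  proof -
    have "real M * (- p - 2 * p\<^sup>2) \<le> real M * ln (1 - p)"
      using ln_one_minus_pos_lower_bound[OF p0 ph] by (intro mult_left_mono) auto
    then have "- (1 - e / 2) * L - 1 \<le> real M * ln (1 - p)" using hM by (simp add: algebra_simps)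
    then show ?thesis by simp
  qed
  also have "\<dots> = (1 - p) ^ M" using ph by (simp add: exp_of_nat_mult)
  finally have q: "exp (- (1 - e / 2) * L - 1) \<le> (1 - p) ^ M" .
  have "(e * real n / (4 * F) - 1) * exp (- (1 - e / 2) * L - 1) \<le> m * (1 - p) ^ M"
    using m q big(3) by (intro mult_mono) auto
  moreover have "1 \<le> real n * e / (4 * f)" using mf big(3) by (simp add: mult.commute)
  ultimately show ?thesis using ph by (simp add: L_def m_def M_def)
qed

theorem rc_concentration:
  fixes f :: "nat \<Rightarrow> real"
  assumes f: "\<And>n. f n > 28" and w: "\<And>n. weighting n (w0 n)" and \<epsilon>: "0 < \<epsilon>"
  shows "(\<lambda>n. measure_pmf.prob (gnp n (f n * ln (real n) / real n))
      {G. \<bar>real (rc G n (w0 n)) / (real n + real n / f n) - 1\<bar> > \<epsilon>}) \<longlonglongrightarrow> 0"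
proof -
  define p where "p = (\<lambda>n. min 1 (f n * ln (real n) / real n))"
  define x where "x = (\<lambda>n. real n * p n)"
  note ed = edge_density[of f, OF f]
  have x: "\<forall>\<^sub>F n in sequentially. 28 * ln (real n) \<le> x n" using ed(2) by (simp add: x_def p_def)
  have p01: "\<forall>\<^sub>F n in sequentially. 0 < p n \<and> p n \<le> 1" using ed(4) by (simp add: p_def)
  have gnp: "gnp n (f n * ln (real n) / real n) = random_graph n (p n)" for n
    unfolding p_def by (rule gnp_eq_rsub[OF ed(1)])
  define e where "e = min \<epsilon> 1"
  have e: "0 < e" "e \<le> 1" using \<epsilon> by (auto simp: e_def)
  define F where "F = 1 / \<epsilon>"
  have F: "0 < F" using \<epsilon> by (simp add: F_def)
  \<comment> \<open>Of order \<open>n powr (e / 2)\<close>, hence unbounded.\<close>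
  define B where "B = (\<lambda>n::nat. (e * real n / (4 * F) - 1) * exp (- (1 - e / 2) * ln (real n) - 1))"
  have B_top: "filterlim B at_top sequentially" unfolding B_def using e F by real_asymp
  let ?P = "\<lambda>n. measure_pmf.prob (random_graph n (p n)) {G. \<bar>real (rc G n (w0 n)) / (real n + real n / f n) - 1\<bar> > \<epsilon>}"
  let ?U = "\<lambda>n. real n * (2 * exp (1 - x n / 4)) + (7 * real n ^ 4 * exp (1 - x n / 4) + real n powr (- e)) + 1 / B n"
  have "?P \<longlonglongrightarrow> 0"
  proof (rule tendsto_sandwich[of "\<lambda>_. 0"])
    show "\<forall>\<^sub>F n in sequentially. ?P n \<le> ?U n"
    proof -
      have 1: "\<forall>\<^sub>F n in sequentially. 2 \<le> \<epsilon> * real n" using \<epsilon> by real_asymp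
      have 2: "\<forall>\<^sub>F n in sequentially. F * ln (real n) / real n \<le> 1 / 2" using F by real_asymp
      have 3: "\<forall>\<^sub>F n in sequentially. 2 * F * ln (real n) ^ 2 / real n \<le> 1" using F by real_asymp
      have 4: "\<forall>\<^sub>F n in sequentially. 1 \<le> e * real n / (4 * F)" using e F by real_asymp
      have 5: "\<forall>\<^sub>F n in sequentially. 0 < B n" using filterlim_at_top_dense[of B] B_top by blast
      show ?thesis using 1 2 3 4 5 p01 eventually_ge_at_top[of 14]
      proof eventually_elim
        case (elim n)
        show ?case unfolding x_def
        proof (rule rc_concentration_step[OF w \<epsilon> f e_def _ _ _ _ _ elim(5)])
          assume fF: "f n \<le> 1 / \<epsilon>"
          show "0 < B n \<and> p n < 1 \<and> 1 \<le> real n * e / (4 * f n) \<and>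
            B n \<le> real (nat \<lfloor>e * real n / (4 * f n)\<rfloor>) * (1 - p n) ^ nat \<lfloor>(1 - e / 2) * real n / f n\<rfloor>"
            using survivor_rate[OF f fF[folded F_def] e _ elim(2-4), of "p n"] elim(5,7)
            by (simp add: B_def p_def)
        qed (use elim in \<open>auto simp: p_def\<close>)
      qed
    qed
    have "(\<lambda>n. 7 * real n ^ 4 * exp (1 - x n / 4)) \<longlonglongrightarrow> 0"
    proof (rule tendsto_sandwich[of "\<lambda>_. 0"])
      show "(\<lambda>n. 7 * real n ^ 4 * exp (1 - 28 * ln (real n) / 4)) \<longlonglongrightarrow> 0" by real_asymp
      show "\<forall>\<^sub>F n in sequentially. 7 * real n ^ 4 * exp (1 - x n / 4) \<le> 7 * real n ^ 4 * exp (1 - 28 * ln (real n) / 4)"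
        using x by eventually_elim (intro mult_left_mono, auto)
    qed (auto intro!: always_eventually)
    moreover have "(\<lambda>n. real n powr (- e)) \<longlonglongrightarrow> 0" using e by real_asymp
    moreover have "(\<lambda>n. 1 / B n) \<longlonglongrightarrow> 0"
      by (rule tendsto_divide_0[OF tendsto_const filterlim_at_top_imp_at_infinity[OF B_top]])
    ultimately have "?U \<longlonglongrightarrow> 0 + (0 + 0) + 0"
      by (intro tendsto_add degree_error_tendsto x)
    then show "?U \<longlonglongrightarrow> 0" by simp
  qed (auto intro!: always_eventually)
  then show ?thesis unfolding gnp .
qed

theorem theorem4:
  fixes f :: "nat \<Rightarrow> real"
  assumes "mono f"
    and "\<And>n. f n > 28"
  shows "(\<exists>g :: nat \<Rightarrow> real. g \<longlonglongrightarrow> 0 \<and>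
           (\<lambda>n. measure_pmf.prob (gnp n (f n * ln (real n) / real n))
                   {G. real (RC G n) \<le> real n powr (2 + g n)}) \<longlonglongrightarrow> 1) \<and>
         (\<forall>w0 :: nat \<Rightarrow> nat \<Rightarrow> int.
           (\<forall>n. bij_betw (w0 n) {0..<n} {- int n .. -1}) \<longrightarrow>
           (\<forall>\<epsilon> > 0. (\<lambda>n. measure_pmf.prob (gnp n (f n * ln (real n) / real n))
                   {G. \<bar>real (rc G n (w0 n)) / (real n + real n / f n) - 1\<bar> > \<epsilon>})
              \<longlonglongrightarrow> 0))"
  using RC_upper_bound[of f] rc_concentration[of f] assms(2) by blast

end
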